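(* Let $r,s$ be integers with $r\geq 4$, $s\geq 3$, and $s\leq r\leq (s-2)^2+s$, and let $\lambda(r,s)=\frac{rs-2}{r+s-2}$. Then there exist constants $c(r,s),C(r,s)>0$ such that for all large enough $n$, $$c(r,s)\,(\log n)^{-1}\, n^{-1/\lambda(r,s)} \;\leq\; p_c(n,K_{r,s}) \;\leq\; C(r,s)\left(\frac{\log n}{\log\log n}\right)^{2/\lambda(r,s)} n^{-1/\lambda(r,s)}.$$
   Context: $K_{r,s}$ is the complete bipartite graph with parts of sizes $r$ and $s$. For a fixed graph $H$ and a graph $G$ on vertex set $[n]=\{1,\dots,n\}$, the $H$-bootstrap process on $K_n$ (the complete graph on $[n]$) is: $G_0=G$ and, for $t\ge 0$, $G_{t+1}=G_t\cup\{e\in E(K_n): \text{there is a copy of } H \text{ in } G_t\cup\{e\} \text{ containing the edge } e\}$ (copies are not necessarily induced subgraphs). The closure is $\langle G\rangle_H=\bigcup_{t\ge0}G_t$, and $G$ percolates if $\langle G\rangle_H=K_n$. $G_{n,p}$ is the random graph on $[n]$ in which each edge is present independently with probability $p$. The critical threshold is $p_c(n,H)=\inf\{p: \mathbb{P}(\langle G_{n,p}\rangle_H=K_n)\ge 1/2\}$. *)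

theory Defs
  imports "HOL-Probability.Probability"
begin

text \<open>
  A finite simple graph is a pair of a vertex set and a set of edges, each edge being a
  two-element set of vertices. Graphs on the vertex set \<open>[n] = {1..n}\<close> are represented by
  their edge sets alone, i.e. by subsets of \<open>K_edges n\<close>.
\<close>

type_synonym 'v ugraph = "'v set \<times> 'v set set"

definition complete_bipartite :: "nat \<Rightarrow> nat \<Rightarrow> (nat + nat) ugraph" where
  "complete_bipartite r s =
     (Inl ` {..<r} \<union> Inr ` {..<s}, {{Inl i, Inr j} | i j. i < r \<and> j < s})"

definition K_edges :: "nat \<Rightarrow> nat set set" where
  "K_edges n = {{u, v} | u v. u \<in> {1..n} \<and> v \<in> {1..n} \<and> u \<noteq> v}"

text \<open>The edge sets of the (not necessarily induced) copies of \<open>H\<close> in the graph \<open>([n], F)\<close>.\<close>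

definition copies :: "'v ugraph \<Rightarrow> nat \<Rightarrow> nat set set \<Rightarrow> nat set set set" where
  "copies H n F =
     {(\<lambda>e. \<phi> ` e) ` snd H | \<phi>.
        inj_on \<phi> (fst H) \<and> \<phi> ` fst H \<subseteq> {1..n} \<and> (\<lambda>e. \<phi> ` e) ` snd H \<subseteq> F}"

primrec bootstrap :: "'v ugraph \<Rightarrow> nat \<Rightarrow> nat set set \<Rightarrow> nat \<Rightarrow> nat set set" where
  "bootstrap H n G 0 = G"
| "bootstrap H n G (Suc t) =
     bootstrap H n G t \<union>
     {e \<in> K_edges n. \<exists>D \<in> copies H n (bootstrap H n G t \<union> {e}). e \<in> D}"

definition bootstrap_closure :: "'v ugraph \<Rightarrow> nat \<Rightarrow> nat set set \<Rightarrow> nat set set" where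
  "bootstrap_closure H n G = (\<Union>t. bootstrap H n G t)"

definition percolates :: "'v ugraph \<Rightarrow> nat \<Rightarrow> nat set set \<Rightarrow> bool" where
  "percolates H n G \<longleftrightarrow> bootstrap_closure H n G = K_edges n"

definition random_graph :: "nat \<Rightarrow> real \<Rightarrow> nat set set pmf" where
  "random_graph n p =
     map_pmf (\<lambda>\<omega>. {e \<in> K_edges n. \<omega> e}) (Pi_pmf (K_edges n) False (\<lambda>_. bernoulli_pmf p))"

text \<open>The range of \<open>p\<close> is restricted explicitly because \<open>bernoulli_pmf\<close> is total.\<close>

definition critical_threshold :: "nat \<Rightarrow> 'v ugraph \<Rightarrow> real" where
  "critical_threshold n H =
     Inf {p. 0 \<le> p \<and> p \<le> 1 \<and>
             measure_pmf.prob (random_graph n p) {G. percolates H n G} \<ge> 1 / 2}"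

definition lambda_bip :: "nat \<Rightarrow> nat \<Rightarrow> real" where
  "lambda_bip r s = (real r * real s - 2) / (real r + real s - 2)"

end

theory Submission
  imports Defs "HOL-Real_Asymp.Real_Asymp"
begin

text \<open>
  The hypothesis \<open>r \<le> (s - 2)\<^sup>2 + s\<close> says that \<open>K\<^bsub>r,s\<^esub>\<close> is balanced: a proper subgraph on \<open>t \<ge> 2\<close>
  vertices has at most \<open>\<lambda> (t - 2) + 1\<close> edges, where \<open>\<lambda> = \<lambda>(r, s)\<close>.

  Lower bound. Call an edge set \<open>F\<close> dense if it has at least \<open>\<lambda> (v - 2) + 1\<close> edges, \<open>v\<close> being the number of
  vertices it touches. Partition \<open>G\<close> into as few dense blocks on fewer than \<open>L\<close> vertices as possible. If
  \<open>G\<close> has no dense subset on between \<open>L\<close> and \<open>r s L\<close> vertices, then the pairs covered by the blocks are closed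
  under the process, since otherwise balancedness would let us merge the blocks meeting a new copy of
  \<open>K\<^bsub>r,s\<^esub>\<close>. Hence percolation forces a dense subset on about \<open>log n\<close> vertices, or a smaller one around the
  pair \<open>{1, 2}\<close>, and the first moment method applies.

  Upper bound. A pair is infected by a chain of \<open>l \<approx> log n / log log n\<close> copies of \<open>K\<^bsub>r,s\<^esub>\<close>, consecutive copies sharing
  two vertices whose edge is absent. Placing the vertices of the chain in disjoint parts of size
  of order \<open>n / l\<close>, the second moment method shows that each pair of roots is infected with probability close
  to 1. Most pairs in a linear-sized vertex set are then infected, so this set contains a linear-sized infected clique,
  which grows to all of \<open>[n]\<close> along edges of the random graph that have not been used before.
\<close>

section \<open>The bootstrap process for bicliques\<close>

text \<open>Both logarithmic losses come from counting. A dense set on \<open>v\<close> vertices is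
  a choice of about \<open>lam (v - 2) + 1\<close> edges among \<open>v^2 / 2\<close> pairs, which
  costs a factor of order \<open>v\<close> per edge. For \<open>p\<close> of order
  \<open>n^(-1/lam) / v\<close> the expected number of such sets through a given pair is small, but
  without a prescribed pair there are \<open>n^2\<close> times as many; a factor
  \<open>delta^(v - 2)\<close> makes up for this only when \<open>v\<close> is of order
  \<open>log n\<close>, and this \<open>v\<close> is the loss. A chain of \<open>l\<close> copies
  has \<open>K = l (r + s - 2)\<close> vertices besides the roots and \<open>lam K + 1\<close>
  edges. The surplus edge costs a factor \<open>1 / p\<close> and is what forces long chains. With
  parts of size \<open>N\<close> of order \<open>n / l\<close> and \<open>q = p^(-lam)\<close>, the
  second moment is governed by \<open>K q / N\<close> and \<open>(q / N)^K / p\<close>. The former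
  is bounded when \<open>p^lam\<close> is of order \<open>l^2 / n\<close>; the latter is then about
  \<open>l^(-K) n^(1/lam)\<close>, small once \<open>l log l\<close> is of order
  \<open>log n\<close>. Hence \<open>l\<close> is about \<open>log n / log log n\<close>, and the
  exponent is \<open>2 / lam\<close>.\<close>

definition biclique :: "'a set \<Rightarrow> 'a set \<Rightarrow> 'a set set" where
  "biclique A B = {{a, b} | a b. a \<in> A \<and> b \<in> B}"

text \<open>Only the images of the two sides matter, so embeddings of the sum type are replaced once
  and for all by disjoint vertex sets \<open>A\<close> and \<open>B\<close>.\<close>

lemma copies_complete_bipartite:
  "copies (complete_bipartite r s) n F =
     {biclique A B | A B. A \<union> B \<subseteq> {1..n} \<and> A \<inter> B = {} \<and> card A = r \<and> card B = s \<and>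
       biclique A B \<subseteq> F}" (is "?L = ?R")
proof (intro equalityI subsetI)
  fix D assume "D \<in> ?L"
  then obtain \<phi> where D: "D = (\<lambda>e. \<phi> ` e) ` snd (complete_bipartite r s)"
    and inj: "inj_on \<phi> (fst (complete_bipartite r s))"
    and sub: "\<phi> ` fst (complete_bipartite r s) \<subseteq> {1..n}" and DF: "D \<subseteq> F"
    unfolding copies_def by blast
  define A where "A = \<phi> ` Inl ` {..<r}"
  define B where "B = \<phi> ` Inr ` {..<s}"
  have inj': "inj_on \<phi> (Inl ` {..<r} \<union> Inr ` {..<s})"
    using inj by (simp add: complete_bipartite_def)
  have "D = {{\<phi> (Inl i), \<phi> (Inr j)} | i j. i < r \<and> j < s}"
    unfolding D complete_bipartite_def snd_conv by (auto simp: image_def; metis image_insert image_empty)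
  also have "\<dots> = biclique A B"
    unfolding biclique_def A_def B_def by blast
  finally have "D = biclique A B" .
  moreover have "A \<union> B \<subseteq> {1..n}"
    using sub by (auto simp: A_def B_def complete_bipartite_def)
  moreover have "A \<inter> B = {}"
  proof -
    have "\<phi> (Inl i) \<noteq> \<phi> (Inr j)" if "i < r" "j < s" for i j
      using inj_onD[OF inj', of "Inl i" "Inr j"] that by auto
    then show ?thesis
      unfolding A_def B_def by auto
  qed
  moreover have "card A = r"
    unfolding A_def using inj_on_subset[OF inj', of "Inl ` {..<r}"] by (simp add: card_image)
  moreover have "card B = s"
    unfolding B_def using inj_on_subset[OF inj', of "Inr ` {..<s}"] by (simp add: card_image)
  ultimately show "D \<in> ?R" using DF by blast
next
  fix D assume "D \<in> ?R"
  then obtain A B where D: "D = biclique A B" and sub: "A \<union> B \<subseteq> {1..n}" and disj: "A \<inter> B = {}"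
    and cA: "card A = r" and cB: "card B = s" and DF: "D \<subseteq> F"
    by blast
  have "finite A" "finite B"
    using sub finite_subset[of _ "{1..n}"] by auto
  then obtain f g where f: "bij_betw f {..<r} A" and g: "bij_betw g {..<s} B"
    using ex_bij_betw_nat_finite[of A] ex_bij_betw_nat_finite[of B] cA cB
    by (metis atLeast0LessThan)
  define \<phi> where "\<phi> = case_sum f g"
  have fA: "f ` {..<r} = A" and gB: "g ` {..<s} = B"
    using f g by (auto simp: bij_betw_def)
  have img: "\<phi> ` (Inl ` {..<r} \<union> Inr ` {..<s}) = A \<union> B"
    using fA gB by (auto simp: \<phi>_def image_Un image_image)
  have "inj_on \<phi> (Inl ` {..<r} \<union> Inr ` {..<s})"
  proof (rule inj_onI)
    fix z z'
    assume z: "z \<in> Inl ` {..<r} \<union> Inr ` {..<s}" "z' \<in> Inl ` {..<r} \<union> Inr ` {..<s}" "\<phi> z = \<phi> z'"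
    have ran: "f i \<in> A" if "i < r" for i using that fA by blast
    have ran': "g i \<in> B" if "i < s" for i using that gB by blast
    have ne: "f i \<noteq> g j" if "i < r" "j < s" for i j
      using ran[OF that(1)] ran'[OF that(2)] disj by auto
    have inj: "i = j" if "f i = f j" "i < r" "j < r" for i j
      using f that by (auto simp: bij_betw_def dest: inj_onD)
    have inj': "i = j" if "g i = g j" "i < s" "j < s" for i j
      using g that by (auto simp: bij_betw_def dest: inj_onD)
    show "z = z'"
    proof (cases z; cases z')
      fix i j assume "z = Inl i" "z' = Inl j"
      then show ?thesis using z inj[of i j] by (auto simp: \<phi>_def)
    next
      fix i j assume "z = Inr i" "z' = Inr j"
      then show ?thesis using z inj'[of i j] by (auto simp: \<phi>_def)
    next
      fix i j assume "z = Inl i" "z' = Inr j"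
      then show ?thesis using z ne[of i j] by (auto simp: \<phi>_def)
    next
      fix i j assume "z = Inr i" "z' = Inl j"
      then show ?thesis using z ne[of j i] by (auto simp: \<phi>_def)
    qed
  qed
  moreover have "D = (\<lambda>e. \<phi> ` e) ` snd (complete_bipartite r s)"
  proof (intro equalityI subsetI)
    fix d assume "d \<in> D"
    then obtain i j where "i < r" "j < s" "d = {f i, g j}"
      unfolding D biclique_def fA[symmetric] gB[symmetric] by auto
    then have "d = \<phi> ` {Inl i, Inr j}" "{Inl i, Inr j} \<in> snd (complete_bipartite r s)"
      by (auto simp: \<phi>_def complete_bipartite_def)
    then show "d \<in> (\<lambda>e. \<phi> ` e) ` snd (complete_bipartite r s)" by blast
  next
    fix d assume "d \<in> (\<lambda>e. \<phi> ` e) ` snd (complete_bipartite r s)"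
    then obtain i j where "i < r" "j < s" "d = \<phi> ` {Inl i, Inr j}"
      by (auto simp: complete_bipartite_def)
    then show "d \<in> D"
      unfolding D biclique_def using fA gB by (auto simp: \<phi>_def)
  qed
  moreover have "\<phi> ` fst (complete_bipartite r s) \<subseteq> {1..n}"
    using img sub by (simp add: complete_bipartite_def)
  moreover have "inj_on \<phi> (fst (complete_bipartite r s))"
    using \<open>inj_on \<phi> _\<close> by (simp add: complete_bipartite_def)
  ultimately show "D \<in> ?L"
    unfolding copies_def mem_Collect_eq using DF by (intro exI[of _ \<phi>]) simp
qed

text \<open>Closed sets remove the time index: the closure of \<open>G\<close> is the least closed
  set containing \<open>G\<close>. The lower bound exhibits a closed superset, the upper bound
  applies the closure condition directly.\<close>

definition bip_closed :: "nat \<Rightarrow> nat \<Rightarrow> nat \<Rightarrow> nat set set \<Rightarrow> bool" where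
  "bip_closed r s n C \<longleftrightarrow>
     (\<forall>A B u v. A \<union> B \<subseteq> {1..n} \<longrightarrow> A \<inter> B = {} \<longrightarrow> card A = r \<longrightarrow> card B = s \<longrightarrow> u \<in> A \<longrightarrow> v \<in> B \<longrightarrow>
        biclique A B - {{u, v}} \<subseteq> C \<longrightarrow> {u, v} \<in> C)"

lemma bip_closedD:
  "\<lbrakk>bip_closed r s n C; A \<union> B \<subseteq> {1..n}; A \<inter> B = {}; card A = r; card B = s; u \<in> A; v \<in> B;
    biclique A B - {{u, v}} \<subseteq> C\<rbrakk> \<Longrightarrow> {u, v} \<in> C"
  unfolding bip_closed_def by blast

lemma finite_K_edges [simp]: "finite (K_edges n)"
  by (rule finite_subset[of _ "Pow {1..n}"]) (auto simp: K_edges_def)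

lemma K_edges_iff: "{u, v} \<in> K_edges n \<longleftrightarrow> u \<in> {1..n} \<and> v \<in> {1..n} \<and> u \<noteq> v"
  by (auto simp: K_edges_def doubleton_eq_iff)

lemma card_K_edge: "e \<in> K_edges n \<Longrightarrow> card e = 2"
  by (auto simp: K_edges_def)

lemma K_edge_subset: "e \<in> K_edges n \<Longrightarrow> e \<subseteq> {1..n}"
  by (auto simp: K_edges_def)

lemma K_edges_mono:
  assumes "m \<le> n" shows "K_edges m \<subseteq> K_edges n"
proof
  fix e assume "e \<in> K_edges m"
  then obtain u v where "e = {u, v}" "{u, v} \<in> K_edges m"
    unfolding K_edges_def by blast
  then show "e \<in> K_edges n"
    using assms by (simp add: K_edges_iff)
qed

lemma finite_biclique: "finite A \<Longrightarrow> finite B \<Longrightarrow> finite (biclique A B)"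
  unfolding biclique_def by (rule finite_image_set2) simp_all

lemma bootstrap_subset_closed:
  assumes "bip_closed r s n C" "G \<subseteq> C"
  shows "bootstrap (complete_bipartite r s) n G t \<subseteq> C"
proof (induction t)
  case (Suc t)
  have "e \<in> C" if e: "D \<in> copies (complete_bipartite r s) n
      (bootstrap (complete_bipartite r s) n G t \<union> {e})" "e \<in> D" for e D
  proof -
    from e(1) obtain A B where D: "D = biclique A B" "A \<union> B \<subseteq> {1..n}" "A \<inter> B = {}"
      "card A = r" "card B = s" "D \<subseteq> bootstrap (complete_bipartite r s) n G t \<union> {e}"
      unfolding copies_complete_bipartite by blast
    obtain u v where uv: "u \<in> A" "v \<in> B" "e = {u, v}"
      using e(2) D(1) by (auto simp: biclique_def)
    have "biclique A B - {{u, v}} \<subseteq> C"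
      using D(1,6) uv Suc by blast
    then show ?thesis
      using bip_closedD[OF assms(1) D(2-5)] uv by blast
  qed
  then have "{e \<in> K_edges n. \<exists>D \<in> copies (complete_bipartite r s) n
      (bootstrap (complete_bipartite r s) n G t \<union> {e}). e \<in> D} \<subseteq> C"
    by blast
  then show ?case using Suc by simp
qed (use assms in simp)

lemma closure_subset_closed:
  "bip_closed r s n C \<Longrightarrow> G \<subseteq> C \<Longrightarrow> bootstrap_closure (complete_bipartite r s) n G \<subseteq> C"
  unfolding bootstrap_closure_def using bootstrap_subset_closed by blast

lemma subset_closure: "G \<subseteq> bootstrap_closure H n G"
  unfolding bootstrap_closure_def using UN_upper[of 0 UNIV "bootstrap H n G"] by simp

lemma bootstrap_mono: "t \<le> t' \<Longrightarrow> bootstrap H n G t \<subseteq> bootstrap H n G t'"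
  by (induction rule: dec_induct) auto

text \<open>The edges of one biclique are finitely many, so those in the closure are all present at
  some common time, and the missing edge enters at the next one.\<close>

lemma bip_closed_closure:
  "bip_closed r s n (bootstrap_closure (complete_bipartite r s) n G)"
  unfolding bip_closed_def
proof (intro allI impI)
  fix A B u v
  assume AB: "A \<union> B \<subseteq> {1..n}" "A \<inter> B = {}" "card A = r" "card B = s" "u \<in> A" "v \<in> B"
    and sub: "biclique A B - {{u, v}} \<subseteq> bootstrap_closure (complete_bipartite r s) n G"
  let ?b = "bootstrap (complete_bipartite r s) n G"
  have "finite A" "finite B"
    using AB(1) finite_subset[of _ "{1..n}"] by auto
  then have finD: "finite (biclique A B - {{u, v}})"
    by (simp add: finite_biclique)
  have fin: "\<exists>t. S \<subseteq> ?b t" if "finite S" "S \<subseteq> bootstrap_closure (complete_bipartite r s) n G" for S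
    using that
  proof (induction S rule: finite_induct)
    case empty
    then show ?case by simp
  next
    case (insert a F)
    then obtain t where "F \<subseteq> ?b t" by blast
    moreover obtain t' where "a \<in> ?b t'"
      using insert by (auto simp: bootstrap_closure_def)
    ultimately have "insert a F \<subseteq> ?b (max t t')"
      using bootstrap_mono[of t "max t t'" "complete_bipartite r s" n G]
        bootstrap_mono[of t' "max t t'" "complete_bipartite r s" n G] by auto
    then show ?case by blast
  qed
  obtain t where t: "biclique A B \<subseteq> ?b t \<union> {{u, v}}"
    using fin[OF finD sub] by blast
  have "{u, v} \<in> K_edges n"
    unfolding K_edges_iff using AB(1,2,5,6) by blast
  moreover have "biclique A B \<in> copies (complete_bipartite r s) n (?b t \<union> {{u, v}})"
    unfolding copies_complete_bipartite mem_Collect_eq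
    by (intro exI[of _ A] exI[of _ B] conjI AB refl t)
  moreover have "{u, v} \<in> biclique A B"
    unfolding biclique_def using AB(5,6) by blast
  ultimately have "{u, v} \<in> ?b (Suc t)"
    unfolding bootstrap.simps by blast
  then show "{u, v} \<in> bootstrap_closure (complete_bipartite r s) n G"
    unfolding bootstrap_closure_def by blast
qed

lemma closure_mono:
  "G \<subseteq> G' \<Longrightarrow> bootstrap_closure (complete_bipartite r s) n G \<subseteq> bootstrap_closure (complete_bipartite r s) n G'"
  by (rule closure_subset_closed[OF bip_closed_closure order_trans[OF _ subset_closure]])

lemma closure_subset_K_edges:
  assumes "G \<subseteq> K_edges n"
  shows "bootstrap_closure H n G \<subseteq> K_edges n"
proof -
  have "bootstrap H n G t \<subseteq> K_edges n" for t
    using assms by (induction t) auto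
  then show ?thesis
    by (auto simp: bootstrap_closure_def)
qed

text \<open>With \<open>x = a - 1\<close>, \<open>y = b - 1\<close>, \<open>X = r - 1\<close>, \<open>Y = s - 1\<close> the claim becomes
  \<open>x + y \<le> x X (Y - y) + y Y (X - x)\<close>.\<close>

lemma balanced:
  assumes "r \<ge> 4" "s \<ge> 3" "s \<le> r" "r \<le> (s - 2)^2 + s"
    and "a \<le> r" "b \<le> s" "(a, b) \<noteq> (r, s)" "a + b \<ge> 2"
  shows "real a * real b \<le> lambda_bip r s * (real a + real b - 2) + 1"
proof (cases "a = 0 \<or> b = 0")
  case True
  have "real r * real s \<ge> 4 * 3"
    using assms by (intro mult_mono) auto
  then have "lambda_bip r s \<ge> 0"
    using assms by (auto simp: lambda_bip_def)
  then show ?thesis using True assms by auto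
next
  case False
  define x y X Y where "x = real a - 1" and "y = real b - 1" and "X = real r - 1" and "Y = real s - 1"
  have pos: "x \<ge> 0" "y \<ge> 0" "X \<ge> 3" "Y \<ge> 2" "x \<le> X" "y \<le> Y" "Y \<le> X"
    using assms False by (auto simp: x_def y_def X_def Y_def)
  have "real r \<le> (real s - 2)^2 + real s"
    using assms(2,4) of_nat_mono[OF assms(4), where 'a = real] by (simp add: of_nat_diff)
  \<comment> \<open>The upper bound on \<open>r\<close> is exactly the inequality for deleting one
    vertex from the side of size \<open>r\<close>: put \<open>y = Y\<close> and
    \<open>x = X - 1\<close> in the target.\<close>
  then have XY: "X + Y \<le> Y^2 + 1"
    by (simp add: X_def Y_def power2_eq_square algebra_simps)
  have key: "x + y \<le> x * X * (Y - y) + y * Y * (X - x)"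
  proof (cases "a < r")
    case a: True
    show ?thesis
    proof (cases "b < s")
      case True
      then have "X - x \<ge> 1" "Y - y \<ge> 1"
        using a by (auto simp: x_def y_def X_def Y_def)
      moreover have "x \<le> x * X" "y \<le> y * Y"
        using pos mult_left_mono[of 1 X x] mult_left_mono[of 1 Y y] by auto
      ultimately have "x * 1 \<le> (x * X) * (Y - y)" "y * 1 \<le> (y * Y) * (X - x)"
        using pos by (intro mult_mono; simp)+
      then show ?thesis by simp
    next
      case False
      then have "y = Y" "X - x \<ge> 1"
        using a assms by (auto simp: x_def y_def X_def Y_def)
      then have "(Y^2 + 1) * 1 \<le> (Y^2 + 1) * (X - x)"
        by (intro mult_left_mono) auto
      then show ?thesis
        using \<open>y = Y\<close> XY by (simp add: algebra_simps power2_eq_square)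
    qed
  next
    case False
    then have "x = X" "Y - y \<ge> 1"
      using assms by (auto simp: x_def y_def X_def Y_def)
    then have "(X^2 + 1) * 1 \<le> (X^2 + 1) * (Y - y)"
      by (intro mult_left_mono) auto
    \<comment> \<open>Deleting vertices from the smaller side is the easier case:
      \<open>Y \<le> X\<close> and \<open>X \<ge> 3\<close> suffice.\<close>
    moreover have "X + Y \<le> X^2 + 1"
    proof -
      have "0 \<le> X * (X - 3)" using pos by simp
      then have "3 * X \<le> X^2" unfolding right_diff_distrib power2_eq_square by linarith
      then show ?thesis using pos by linarith
    qed
    ultimately show ?thesis
      using \<open>x = X\<close> by (simp add: algebra_simps power2_eq_square)
  qed
  have "x * y * (X + Y) \<le> (X * Y - 1) * (x + y)"
    using key by (simp add: algebra_simps)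
  then have "(real a * real b - 1) * (real r + real s - 2) \<le> (real r * real s - 2) * (real a + real b - 2)"
    by (simp add: x_def y_def X_def Y_def algebra_simps)
  moreover have "real r + real s - 2 > 0" using assms by auto
  ultimately have "real a * real b - 1 \<le> (real r * real s - 2) * (real a + real b - 2) / (real r + real s - 2)"
    by (simp add: pos_le_divide_eq)
  then show ?thesis
    by (simp add: lambda_bip_def)
qed

text \<open>The bound is equivalent to \<open>(r - 2) (s - 2) \<ge> 2\<close>. It serves the edge
  count (\<open>v \<le> 2 m\<close> for a dense set with \<open>m\<close> edges on \<open>v\<close>
  vertices) and the crude bound \<open>p \<ge> n^(-1/2)\<close>.\<close>

lemma lambda_bip_ge_2:
  assumes "r \<ge> 4" "s \<ge> 3"
  shows "lambda_bip r s \<ge> 2"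
proof -
  have "(real r - 2) * (real s - 2) \<ge> 2 * 1"
    using assms by (intro mult_mono) auto
  then show ?thesis
    using assms by (simp add: lambda_bip_def field_simps)
qed

section \<open>Dense edge sets and the closure\<close>

lemma biclique_eq_image: "biclique A B = (\<lambda>(a, b). {a, b}) ` (A \<times> B)"
  by (auto simp: biclique_def image_iff)

lemma bicliqueI: "a \<in> A \<Longrightarrow> b \<in> B \<Longrightarrow> {a, b} \<in> biclique A B"
  unfolding biclique_def by blast

lemma bicliqueE:
  assumes "e \<in> biclique A B"
  obtains a b where "a \<in> A" "b \<in> B" "e = {a, b}"
  using assms unfolding biclique_def by blast

lemma card_biclique_le:
  assumes "finite A" "finite B"
  shows "card (biclique A B) \<le> card A * card B"
  unfolding biclique_eq_image card_cartesian_product[symmetric]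
  by (rule card_image_le) (use assms in simp)

lemma card_biclique:
  assumes "A \<inter> B = {}"
  shows "card (biclique A B) = card A * card B"
proof -
  have "inj_on (\<lambda>(a, b). {a, b}) (A \<times> B)"
    using assms by (auto simp: inj_on_def doubleton_eq_iff)
  then show ?thesis
    unfolding biclique_eq_image by (simp add: card_image card_cartesian_product)
qed

text \<open>Normalised so that a single edge and, for \<open>lam = lambda_bip r s\<close>, a copy of
  the biclique minus one edge attain equality.\<close>

definition dense_edges :: "real \<Rightarrow> nat set set \<Rightarrow> bool" where
  "dense_edges lam F \<longleftrightarrow> lam * (real (card (\<Union>F)) - 2) + 1 \<le> real (card F)"

text \<open>Merging is possible because the blocks are edge-disjoint while each of them contributes at most
  \<open>lam (t - 2) + 1\<close> edges to the new copy, \<open>t\<close> being its number of vertices in that copy.\<close>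

lemma dense_merge:
  assumes rs: "r \<ge> 4" "s \<ge> 3" "s \<le> r" "r \<le> (s - 2)^2 + s"
    and AB: "finite A" "finite B" "A \<inter> B = {}" "card A = r" "card B = s" "u \<in> A" "v \<in> B"
    and X: "finite X" "\<And>F. F \<in> X \<Longrightarrow> finite F \<and> finite (\<Union>F) \<and> dense_edges (lambda_bip r s) F"
    and disj: "disjoint X"
    and cover: "\<And>e. e \<in> biclique A B - {{u, v}} \<Longrightarrow> \<exists>F\<in>X. e \<subseteq> \<Union>F"
    and touch: "\<And>F. F \<in> X \<Longrightarrow> \<exists>e \<in> biclique A B - {{u, v}}. e \<subseteq> \<Union>F"
    and uv: "\<And>F. F \<in> X \<Longrightarrow> \<not> {u, v} \<subseteq> \<Union>F"
  shows "dense_edges (lambda_bip r s) (\<Union>X)"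
proof -
  define lam where "lam = lambda_bip r s"
  define a b where "a = (\<lambda>F. card (A \<inter> \<Union>F))" and "b = (\<lambda>F. card (B \<inter> \<Union>F))"
  have lam: "lam \<ge> 2" unfolding lam_def using rs lambda_bip_ge_2 by blast
  have part: "real (a F) * real (b F) \<le> lam * (real (a F) + real (b F) - 2) + 1" if FX: "F \<in> X" for F
    unfolding lam_def
  proof (rule balanced[OF rs])
    show "a F \<le> r" "b F \<le> s"
      unfolding a_def b_def using AB card_mono[of A "A \<inter> \<Union>F"] card_mono[of B "B \<inter> \<Union>F"] by auto
    show "(a F, b F) \<noteq> (r, s)"
    proof
      assume "(a F, b F) = (r, s)"
      then have "A \<inter> \<Union>F = A" "B \<inter> \<Union>F = B"
        using AB card_subset_eq[of A "A \<inter> \<Union>F"] card_subset_eq[of B "B \<inter> \<Union>F"]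
        by (simp_all add: a_def b_def)
      then show False using uv[OF FX] AB by blast
    qed
    obtain e where "e \<in> biclique A B" "e \<subseteq> \<Union>F" using touch[OF FX] by blast
    then have "A \<inter> \<Union>F \<noteq> {}" "B \<inter> \<Union>F \<noteq> {}" unfolding biclique_def by blast+
    then have "a F > 0" "b F > 0"
      using AB by (simp_all add: a_def b_def card_gt_0_iff)
    then show "2 \<le> a F + b F" by simp
  qed
  have edges: "r * s - 1 \<le> (\<Sum>F\<in>X. a F * b F)"
  proof -
    have "{u, v} \<in> biclique A B" using AB by (simp add: bicliqueI)
    then have "r * s - 1 = card (biclique A B - {{u, v}})"
      using AB card_biclique[of A B] finite_biclique[of A B] by simp
    also have "\<dots> \<le> card (\<Union>F\<in>X. biclique (A \<inter> \<Union>F) (B \<inter> \<Union>F))"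
    proof (rule card_mono)
      show "finite (\<Union>F\<in>X. biclique (A \<inter> \<Union>F) (B \<inter> \<Union>F))"
        using X AB by (intro finite_UN_I finite_biclique) auto
      show "biclique A B - {{u, v}} \<subseteq> (\<Union>F\<in>X. biclique (A \<inter> \<Union>F) (B \<inter> \<Union>F))"
      proof
        fix e assume e: "e \<in> biclique A B - {{u, v}}"
        then obtain p q where pq: "p \<in> A" "q \<in> B" "e = {p, q}" using bicliqueE by blast
        obtain F where F: "F \<in> X" "e \<subseteq> \<Union>F" using cover[OF e] by blast
        then have "e \<in> biclique (A \<inter> \<Union>F) (B \<inter> \<Union>F)"
          unfolding pq(3) by (intro bicliqueI) (use pq in auto)
        then show "e \<in> (\<Union>F\<in>X. biclique (A \<inter> \<Union>F) (B \<inter> \<Union>F))" using F by blast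
      qed
    qed
    also have "\<dots> \<le> (\<Sum>F\<in>X. card (biclique (A \<inter> \<Union>F) (B \<inter> \<Union>F)))"
      by (rule card_UN_le) (use X in simp)
    also have "\<dots> \<le> (\<Sum>F\<in>X. a F * b F)"
      unfolding a_def b_def using AB by (intro sum_mono card_biclique_le) auto
    finally show ?thesis .
  qed
  \<comment> \<open>Vertices of the copy are counted once, as \<open>r + s\<close>, while the blocks
    count them \<open>a F + b F\<close> times; only vertices outside the copy are bounded block by
    block.\<close>
  have verts: "card (\<Union>(\<Union>X)) + (\<Sum>F\<in>X. a F + b F) \<le> r + s + (\<Sum>F\<in>X. card (\<Union>F))"
  proof -
    have "card (\<Union>(\<Union>X)) \<le> card ((A \<union> B) \<union> (\<Union>F\<in>X. \<Union>F - (A \<union> B)))"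
      using AB X by (intro card_mono) auto
    also have "\<dots> \<le> card (A \<union> B) + card (\<Union>F\<in>X. \<Union>F - (A \<union> B))"
      by (rule card_Un_le)
    also have "card (\<Union>F\<in>X. \<Union>F - (A \<union> B)) \<le> (\<Sum>F\<in>X. card (\<Union>F - (A \<union> B)))"
      by (rule card_UN_le) (use X in simp)
    finally have *: "card (\<Union>(\<Union>X)) \<le> r + s + (\<Sum>F\<in>X. card (\<Union>F - (A \<union> B)))"
      using AB by (simp add: card_Un_disjoint)
    have "card (\<Union>F - (A \<union> B)) + (a F + b F) = card (\<Union>F)" if "F \<in> X" for F
    proof -
      have fin: "finite (\<Union>F)" using X that by blast
      have "a F + b F = card ((A \<inter> \<Union>F) \<union> (B \<inter> \<Union>F))"
        unfolding a_def b_def using AB by (intro card_Un_disjoint[symmetric]) auto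
      also have "(A \<inter> \<Union>F) \<union> (B \<inter> \<Union>F) = \<Union>F \<inter> (A \<union> B)" by blast
      finally show ?thesis
        using card_Diff_subset_Int[of "\<Union>F" "A \<union> B"] fin card_mono[of "\<Union>F" "\<Union>F \<inter> (A \<union> B)"] by auto
    qed
    then have "(\<Sum>F\<in>X. card (\<Union>F)) = (\<Sum>F\<in>X. card (\<Union>F - (A \<union> B))) + (\<Sum>F\<in>X. a F + b F)"
      by (simp add: sum.distrib[symmetric])
    then show ?thesis using * by linarith
  qed
  have "real r * real s - 1 \<le> (\<Sum>F\<in>X. real (a F) * real (b F))"
  proof -
    have "real (r * s - 1) \<le> real (\<Sum>F\<in>X. a F * b F)"
      using edges by (rule of_nat_mono)
    moreover have "r * s \<ge> 1" using rs by (simp add: Suc_le_eq)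
    ultimately show ?thesis by (simp add: of_nat_diff)
  qed
  also have "\<dots> \<le> (\<Sum>F\<in>X. lam * (real (a F) + real (b F) - 2) + 1)"
    by (intro sum_mono part)
  finally have E: "real r * real s - 1 \<le> (\<Sum>F\<in>X. lam * (real (a F) + real (b F) - 2) + 1)" .
  have "real (card (\<Union>(\<Union>X)) + (\<Sum>F\<in>X. a F + b F)) \<le> real (r + s + (\<Sum>F\<in>X. card (\<Union>F)))"
    using verts by (rule of_nat_mono)
  then have V: "real (card (\<Union>(\<Union>X))) + (\<Sum>F\<in>X. real (a F) + real (b F)) \<le> real r + real s + (\<Sum>F\<in>X. real (card (\<Union>F)))"
    by simp
  \<comment> \<open>The copy thus calls for \<open>lam (r + s - 2) + 1 = r s - 1\<close> edges,
    which is exactly what the traces of the blocks supply through \<open>E\<close>.\<close>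
  have "lam * (real r + real s - 2) = real r * real s - 2"
    using rs by (simp add: lam_def lambda_bip_def)
  then have "lam * (real (card (\<Union>(\<Union>X))) - 2) + 1
      \<le> real r * real s - 1 + lam * ((\<Sum>F\<in>X. real (card (\<Union>F))) - (\<Sum>F\<in>X. real (a F) + real (b F)))"
    using mult_left_mono[OF V, of lam] lam by (simp add: algebra_simps)
  also have "\<dots> \<le> (\<Sum>F\<in>X. lam * (real (a F) + real (b F) - 2) + 1)
      + lam * ((\<Sum>F\<in>X. real (card (\<Union>F))) - (\<Sum>F\<in>X. real (a F) + real (b F)))"
    using E by simp
  also have "\<dots> = (\<Sum>F\<in>X. lam * (real (card (\<Union>F)) - 2) + 1)"
    unfolding sum_subtractf[symmetric] sum_distrib_left sum.distrib[symmetric]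
    by (intro sum.cong) (auto simp: algebra_simps)
  also have "\<dots> \<le> (\<Sum>F\<in>X. real (card F))"
    using X(2) by (intro sum_mono) (simp add: dense_edges_def lam_def)
  also have "\<dots> = real (card (\<Union>X))"
    using X disj by (simp add: card_Union_disjoint pairwise_def disjnt_def)
  finally show ?thesis
    unfolding dense_edges_def lam_def .
qed

text \<open>The window from \<open>L\<close> to \<open>r s L\<close> is too wide for a merge to jump
  over it: at most \<open>r s\<close> blocks are merged, each on fewer than \<open>L\<close>
  vertices. Minimality of the number of blocks replaces an explicit merging procedure.\<close>

lemma closure_covered_by_dense:
  assumes rs: "r \<ge> 4" "s \<ge> 3" "s \<le> r" "r \<le> (s - 2)^2 + s"
    and G: "G \<subseteq> K_edges n" and L: "2 < L"
    and gap: "\<And>F. F \<subseteq> G \<Longrightarrow> dense_edges (lambda_bip r s) F \<Longrightarrow> L \<le> card (\<Union>F) \<Longrightarrow> r * s * L < card (\<Union>F)"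
    and e: "e \<in> bootstrap_closure (complete_bipartite r s) n G"
  shows "\<exists>F\<subseteq>G. dense_edges (lambda_bip r s) F \<and> e \<subseteq> \<Union>F \<and> card (\<Union>F) < L"
proof -
  define lam where "lam = lambda_bip r s"
  define ok where "ok = (\<lambda>P. partition_on G P \<and> (\<forall>F\<in>P. dense_edges lam F \<and> card (\<Union>F) < L))"
  have finG: "finite G" using G finite_K_edges finite_subset by blast
  have finV: "finite (\<Union>F)" if "F \<subseteq> G" for F
  proof (rule finite_subset)
    show "\<Union>F \<subseteq> {1..n}" using K_edge_subset that G by blast
  qed simp
  \<comment> \<open>Single edges are dense, so an admissible partition exists and a minimal one can
    be taken.\<close>
  have "ok ((\<lambda>e. {e}) ` G)"
    unfolding ok_def
  proof (intro conjI ballI)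
    show "partition_on G ((\<lambda>e. {e}) ` G)"
      by (auto simp: partition_on_def disjoint_def)
    fix F assume "F \<in> (\<lambda>e. {e}) ` G"
    then obtain d where "F = {d}" "d \<in> G" by blast
    then have "card (\<Union>F) = 2" "card F = 1" using G card_K_edge by auto
    then show "dense_edges lam F" "card (\<Union>F) < L" using L by (auto simp: dense_edges_def)
  qed
  then obtain P where P: "ok P" and minP: "\<And>Q. ok Q \<Longrightarrow> card P \<le> card Q"
    using ex_has_least_nat[of ok _ card] by blast
  have part: "partition_on G P" and dense: "\<And>F. F \<in> P \<Longrightarrow> dense_edges lam F"
    and small: "\<And>F. F \<in> P \<Longrightarrow> card (\<Union>F) < L"
    using P by (auto simp: ok_def)
  have finP: "finite P" using part finG finite_elements by blast
  have PG: "\<And>F. F \<in> P \<Longrightarrow> F \<subseteq> G" using part by (auto simp: partition_on_def)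
  \<comment> \<open>Covering is by the vertex set of a block, not by its edges: a block accounts for
    all pairs of its vertices.\<close>
  define C where "C = {e. \<exists>F\<in>P. e \<subseteq> \<Union>F}"
  have "G \<subseteq> C"
    using part by (auto simp: partition_on_def C_def)
  moreover have "bip_closed r s n C"
    unfolding bip_closed_def
  proof (intro allI impI)
    fix A B u v
    assume AB: "A \<union> B \<subseteq> {1..n}" "A \<inter> B = {}" "card A = r" "card B = s" "u \<in> A" "v \<in> B"
      and sub: "biclique A B - {{u, v}} \<subseteq> C"
    show "{u, v} \<in> C"
    proof (rule ccontr)
      assume uv: "{u, v} \<notin> C"
      have fin: "finite A" "finite B" using AB(1) finite_subset[of _ "{1..n}"] by auto
      define D where "D = biclique A B - {{u, v}}"
      \<comment> \<open>One block is selected per edge of the copy, which limits their number to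
        \<open>r * s\<close>.\<close>
      have "\<forall>e\<in>D. \<exists>F. F \<in> P \<and> e \<subseteq> \<Union>F" using sub by (auto simp: D_def C_def)
      then obtain blk where blk: "\<And>e. e \<in> D \<Longrightarrow> blk e \<in> P \<and> e \<subseteq> \<Union>(blk e)"
        by metis
      define X where "X = blk ` D"
      have finD: "finite D" using fin by (simp add: D_def finite_biclique)
      have cardD: "card D \<le> r * s"
        using card_biclique[OF AB(2)] card_Diff1_le[of "biclique A B" "{u, v}"] AB(3,4)
        by (simp add: D_def)
      have X: "finite X" "X \<subseteq> P" "card X \<le> r * s"
        using finD blk cardD card_image_le[of D blk] by (fastforce simp: X_def)+
      have disjX: "disjoint X"
        using part X by (auto simp: partition_on_def disjoint_def)
      have dm: "dense_edges lam (\<Union>X)"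
        unfolding lam_def
      proof (rule dense_merge[OF rs fin AB(2-6)])
        show "finite X" "disjoint X" by fact+
        show "finite F \<and> finite (\<Union>F) \<and> dense_edges (lambda_bip r s) F" if "F \<in> X" for F
        proof -
          have "F \<in> P" using that X by blast
          then show ?thesis
            using dense[of F] PG[of F] finV[of F] finite_subset[OF _ finG, of F] by (simp add: lam_def)
        qed
        show "\<exists>F\<in>X. e \<subseteq> \<Union>F" if "e \<in> biclique A B - {{u, v}}" for e
          using blk[of e] that unfolding X_def D_def[symmetric] by blast
        show "\<exists>e\<in>biclique A B - {{u, v}}. e \<subseteq> \<Union>F" if "F \<in> X" for F
          using blk that unfolding X_def D_def[symmetric] by blast
        show "\<not> {u, v} \<subseteq> \<Union>F" if "F \<in> X" for F
          using that uv X(2) unfolding C_def by blast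
      qed
      have "card (\<Union>(\<Union>X)) \<le> r * s * L"
      proof -
        have "card (\<Union>(\<Union>X)) = card (\<Union>F\<in>X. \<Union>F)" by (rule arg_cong[of _ _ card]) blast
        also have "\<dots> \<le> (\<Sum>F\<in>X. card (\<Union>F))" by (rule card_UN_le) fact
        also have "\<dots> \<le> (\<Sum>F\<in>X. L)"
          by (intro sum_mono less_imp_le small) (use X in blast)
        also have "\<dots> \<le> r * s * L" using X by simp
        finally show ?thesis .
      qed
      moreover have "\<Union>X \<subseteq> G" using X PG by blast
      ultimately have smallX: "card (\<Union>(\<Union>X)) < L"
        using gap[of "\<Union>X"] dm unfolding lam_def by linarith
      \<comment> \<open>A merge lowers the number of blocks only if two are involved. If a single
        block served all edges, those at \<open>u\<close> and at \<open>v\<close> would put both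
        vertices into it, and \<open>{u, v}\<close> would be covered already.\<close>
      have "card X \<ge> 2"
      proof (rule ccontr)
        assume "\<not> card X \<ge> 2"
        then have single: "F = F'" if "F \<in> X" "F' \<in> X" for F F'
          using that card_le_Suc0_iff_eq[OF X(1)] by auto
        have "\<not> card B \<le> Suc 0" "\<not> card A \<le> Suc 0"
          using AB rs by auto
        then obtain u' v' where v': "v' \<in> B" "v' \<noteq> v" and u': "u' \<in> A" "u' \<noteq> u"
          unfolding card_le_Suc0_iff_eq[OF fin(1)] card_le_Suc0_iff_eq[OF fin(2)] by blast
        have "{u, v'} \<in> D" "{u', v} \<in> D"
          unfolding D_def using u' v' AB(2,5,6) by (auto simp: doubleton_eq_iff intro!: bicliqueI)
        then have "blk {u, v'} = blk {u', v}"
          by (intro single) (auto simp: X_def)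
        then have "{u, v} \<subseteq> \<Union>(blk {u, v'})"
          using blk[OF \<open>{u, v'} \<in> D\<close>] blk[OF \<open>{u', v} \<in> D\<close>] by simp
        then have "{u, v} \<in> C"
          unfolding C_def using blk[OF \<open>{u, v'} \<in> D\<close>] by blast
        then show False using uv by blast
      qed
      define Q where "Q = insert (\<Union>X) (P - X)"
      have "ok Q"
        unfolding ok_def
      proof (intro conjI ballI)
        have "X \<noteq> {}" using \<open>card X \<ge> 2\<close> by auto
        have "{} \<notin> P" using part by (auto simp: partition_on_def)
        have dP: "F \<inter> F' = {}" if "F \<in> P" "F' \<in> P" "F \<noteq> F'" for F F'
          using part that by (auto simp: partition_on_def disjoint_def)
        show "partition_on G Q"
        proof (rule partition_onI)
          show "\<Union>Q = G"
            using part X(2) unfolding Q_def partition_on_def by blast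
          show "disjnt F F'" if "F \<in> Q" "F' \<in> Q" "F \<noteq> F'" for F F'
          proof -
            have *: "\<Union>X \<inter> F = {}" if "F \<in> P - X" for F
            proof -
              have "F' \<inter> F = {}" if "F' \<in> X" for F'
                using dP[of F' F] that \<open>F \<in> P - X\<close> X(2) by blast
              then show ?thesis by blast
            qed
            show ?thesis
              using that(1,2) unfolding Q_def disjnt_def
            proof (elim insertE)
              assume "F = \<Union>X" "F' = \<Union>X"
              then show "F \<inter> F' = {}" using that(3) by simp
            next
              assume "F = \<Union>X" "F' \<in> P - X"
              then show "F \<inter> F' = {}" using * by simp
            next
              assume "F \<in> P - X" "F' = \<Union>X"
              then show "F \<inter> F' = {}" using *[of F] by (simp add: Int_commute)
            next
              assume "F \<in> P - X" "F' \<in> P - X"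
              then show "F \<inter> F' = {}" using dP that(3) by simp
            qed
          qed
          show "{} \<notin> Q"
          proof -
            obtain F where "F \<in> X" using \<open>X \<noteq> {}\<close> by blast
            then have "F \<noteq> {}" using X(2) \<open>{} \<notin> P\<close> by blast
            then have "\<Union>X \<noteq> {}" using \<open>F \<in> X\<close> by blast
            then show ?thesis using \<open>{} \<notin> P\<close> by (simp add: Q_def)
          qed
        qed
        fix F assume "F \<in> Q"
        then have "F = \<Union>X \<or> F \<in> P" by (auto simp: Q_def)
        then show "dense_edges lam F" "card (\<Union>F) < L"
          using dm smallX dense[of F] small[of F] by auto
      qed
      then have "card P \<le> card Q" by (rule minP)
      moreover have "card Q \<le> Suc (card P - card X)"
        unfolding Q_def card_Diff_subset[OF X(1,2), symmetric] by (simp add: card_insert_if finP)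
      moreover have "card X \<le> card P" using X finP by (simp add: card_mono)
      ultimately show False using \<open>card X \<ge> 2\<close> by linarith
    qed
  qed
  ultimately have "e \<in> C"
    using closure_subset_closed e by blast
  then show ?thesis
    using dense small PG unfolding C_def lam_def by blast
qed

section \<open>The lower bound\<close>

definition random_subset :: "'a set \<Rightarrow> real \<Rightarrow> 'a set pmf" where
  "random_subset I p = map_pmf (\<lambda>\<omega>. {e \<in> I. \<omega> e}) (Pi_pmf I False (\<lambda>_. bernoulli_pmf p))"

lemma random_graph_eq: "random_graph n p = random_subset (K_edges n) p"
  by (simp add: random_graph_def random_subset_def)

lemma set_random_subset: "set_pmf (random_subset I p) \<subseteq> Pow I"
  by (auto simp: random_subset_def)

lemma prob_random_subset_cong:
  assumes "\<And>G. G \<subseteq> I \<Longrightarrow> P G \<longleftrightarrow> Q G"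
  shows "measure_pmf.prob (random_subset I p) {G. P G} = measure_pmf.prob (random_subset I p) {G. Q G}"
  using assms set_random_subset[of I p]
  by (intro measure_pmf.finite_measure_eq_AE) (auto simp: AE_measure_pmf_iff)

lemma prob_random_subset_mono:
  assumes "\<And>G. G \<subseteq> I \<Longrightarrow> P G \<Longrightarrow> Q G"
  shows "measure_pmf.prob (random_subset I p) {G. P G} \<le> measure_pmf.prob (random_subset I p) {G. Q G}"
  using assms set_random_subset[of I p]
  by (intro measure_pmf.finite_measure_mono_AE) (auto simp: AE_measure_pmf_iff)

lemma prob_random_subset_contains:
  assumes "finite I" "D \<subseteq> I" "0 \<le> p" "p \<le> 1"
  shows "measure_pmf.prob (random_subset I p) {G. D \<subseteq> G} = p ^ card D"
proof -
  have "(\<lambda>\<omega>. {e \<in> I. \<omega> e}) -` {G. D \<subseteq> G} = Pi I (\<lambda>e. if e \<in> D then {True} else UNIV)"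
    using assms by (auto simp: Pi_def)
  then have "measure_pmf.prob (random_subset I p) {G. D \<subseteq> G} =
      (\<Prod>e\<in>I. measure_pmf.prob (bernoulli_pmf p) (if e \<in> D then {True} else UNIV))"
    using assms by (simp add: random_subset_def measure_map_pmf measure_Pi_pmf_Pi)
  also have "\<dots> = (\<Prod>e\<in>I. if e \<in> D then p else 1)"
    using assms by (intro prod.cong) (auto simp: measure_pmf_single)
  also have "\<dots> = p ^ card D"
    using assms by (simp add: prod.If_cases Int_absorb1)
  finally show ?thesis .
qed

lemma prob_random_subset_avoids:
  assumes "finite I" "D \<subseteq> I" "0 \<le> p" "p \<le> 1"
  shows "measure_pmf.prob (random_subset I p) {G. D \<inter> G = {}} = (1 - p) ^ card D"
proof -
  have "(\<lambda>\<omega>. {e \<in> I. \<omega> e}) -` {G. D \<inter> G = {}} = Pi I (\<lambda>e. if e \<in> D then {False} else UNIV)"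
    using assms by (auto simp: Pi_def)
  then have "measure_pmf.prob (random_subset I p) {G. D \<inter> G = {}} =
      (\<Prod>e\<in>I. measure_pmf.prob (bernoulli_pmf p) (if e \<in> D then {False} else UNIV))"
    using assms by (simp add: random_subset_def measure_map_pmf measure_Pi_pmf_Pi)
  also have "\<dots> = (\<Prod>e\<in>I. if e \<in> D then 1 - p else 1)"
    using assms by (intro prod.cong) (auto simp: measure_pmf_single)
  also have "\<dots> = (1 - p) ^ card D"
    using assms by (simp add: prod.If_cases Int_absorb1)
  finally show ?thesis .
qed

text \<open>The product measure splits over \<open>S\<close> and its complement, and both parts can
  be recovered from their union because the index sets are disjoint. This permits exposing the graph
  in two rounds.\<close>

lemma prob_random_subset_indep:
  assumes "finite I" "S \<subseteq> I"
  shows "measure_pmf.prob (random_subset I p) {G. P (G \<inter> S) \<and> Q (G - S)} =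
    measure_pmf.prob (random_subset I p) {G. P (G \<inter> S)} * measure_pmf.prob (random_subset I p) {G. Q (G - S)}"
proof -
  define A where "A = random_subset S p"
  define B where "B = random_subset (I - S) p"
  have I: "S \<union> (I - S) = I" using assms by blast
  have fin: "finite S" using assms finite_subset by blast
  have "random_subset I p = map_pmf (\<lambda>(F, F'). F \<union> F') (pair_pmf A B)"
  proof -
    have "Pi_pmf I False (\<lambda>_. bernoulli_pmf p) = map_pmf (\<lambda>(f, g) x. if x \<in> S then f x else g x)
        (pair_pmf (Pi_pmf S False (\<lambda>_. bernoulli_pmf p)) (Pi_pmf (I - S) False (\<lambda>_. bernoulli_pmf p)))"
      using Pi_pmf_union[of S "I - S" False "\<lambda>_. bernoulli_pmf p"] fin assms I by simp
    note eq = this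
    show ?thesis
      unfolding random_subset_def A_def B_def eq pair_map_pmf1 pair_map_pmf2 map_pmf_comp
      by (rule map_pmf_cong) (use assms in auto)
  qed
  \<comment> \<open>Stated for arbitrary predicates, so that the two marginals arise by putting
    \<open>True\<close> for the other one.\<close>
  then have *: "measure_pmf.prob (random_subset I p) {G. P (G \<inter> S) \<and> Q (G - S)} =
      measure_pmf.prob A {F. P F} * measure_pmf.prob B {F. Q F}" for P Q
  proof -
    have "measure_pmf.prob (random_subset I p) {G. P (G \<inter> S) \<and> Q (G - S)} =
        measure_pmf.prob (pair_pmf A B) ((\<lambda>(F, F'). F \<union> F') -` {G. P (G \<inter> S) \<and> Q (G - S)})"
      by (simp add: \<open>random_subset I p = _\<close> measure_map_pmf)
    also have "\<dots> = measure_pmf.prob (pair_pmf A B) ({F. F \<subseteq> S \<and> P F} \<times> {F. F \<subseteq> I - S \<and> Q F})"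
    proof (rule measure_pmf.finite_measure_eq_AE; (simp add: AE_measure_pmf_iff)?)
      have "(F \<union> F') \<inter> S = F \<and> (F \<union> F') - S = F'" if "F \<in> set_pmf A" "F' \<in> set_pmf B" for F F'
        using that set_random_subset[of S p] set_random_subset[of "I - S" p]
        unfolding A_def B_def by blast
      moreover have "F \<subseteq> S \<and> F' \<subseteq> I - S" if "F \<in> set_pmf A" "F' \<in> set_pmf B" for F F'
        using that set_random_subset[of S p] set_random_subset[of "I - S" p]
        unfolding A_def B_def by blast
      ultimately show "\<forall>x\<in>set_pmf A. \<forall>y\<in>set_pmf B.
          (P ((x \<union> y) \<inter> S) \<and> Q (x \<union> y - S)) = (x \<subseteq> S \<and> P x \<and> y \<subseteq> I - S \<and> Q y)"
        by simp
    qed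
    also have "\<dots> = measure_pmf.prob A {F. F \<subseteq> S \<and> P F} * measure_pmf.prob B {F. F \<subseteq> I - S \<and> Q F}"
      using fin assms by (intro measure_pmf_prob_product countable_finite) simp_all
    also have "\<dots> = measure_pmf.prob A {F. P F} * measure_pmf.prob B {F. Q F}"
      unfolding A_def B_def
      by (intro arg_cong2[where f = "(*)"] prob_random_subset_cong) auto
    finally show ?thesis .
  qed
  show ?thesis
    using *[of P "\<lambda>_. True"] *[of "\<lambda>_. True" Q] *[of P Q] by simp
qed

section \<open>Union bounds and the counting of dense edge sets\<close>

lemma prob_Ex_le:
  assumes "finite S"
  shows "measure_pmf.prob M {G. \<exists>D\<in>S. P D G} \<le> (\<Sum>D\<in>S. measure_pmf.prob M {G. P D G})"
proof -
  have "{G. \<exists>D\<in>S. P D G} = (\<Union>D\<in>S. {G. P D G})" by auto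
  then show ?thesis
    using measure_pmf.finite_measure_subadditive_finite[of S "\<lambda>D. {G. P D G}" M] assms by simp
qed

lemma prob_random_subset_contains_some_le:
  assumes "finite I" "finite S" "\<And>D. D \<in> S \<Longrightarrow> D \<subseteq> I" "0 \<le> p" "p \<le> 1"
  shows "measure_pmf.prob (random_subset I p) {G. \<exists>D\<in>S. D \<subseteq> G} \<le> (\<Sum>D\<in>S. p ^ card D)"
proof -
  have "measure_pmf.prob (random_subset I p) {G. \<exists>D\<in>S. D \<subseteq> G}
      \<le> (\<Sum>D\<in>S. measure_pmf.prob (random_subset I p) {G. D \<subseteq> G})"
    using assms by (intro prob_Ex_le) simp
  also have "\<dots> = (\<Sum>D\<in>S. p ^ card D)"
    using assms by (intro sum.cong prob_random_subset_contains) auto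
  finally show ?thesis .
qed

text \<open>One term of the binomial expansion of \<open>(1 + 1 / v) ^ N\<close> is at most the
  whole sum, which is at most \<open>exp (N / v)\<close>. For \<open>N\<close> pairs on
  \<open>v\<close> vertices the exponent is at most \<open>v / 2 \<le> m\<close>.\<close>

lemma binomial_le_exp_mult_power:
  assumes "v > 0" "2 * N \<le> v * v" "v \<le> 2 * m"
  shows "real (N choose m) \<le> (exp 1 * real v) ^ m"
proof -
  have "real (N choose m) * (1 / real v) ^ m \<le> (\<Sum>k\<le>N. real (N choose k) * (1 / real v) ^ k)"
  proof (cases "m \<le> N")
    case True
    then show ?thesis
      by (intro member_le_sum[of m _ "\<lambda>k. real (N choose k) * (1 / real v) ^ k"]) auto
  qed (simp add: binomial_eq_0 sum_nonneg)
  also have "\<dots> = (1 / real v + 1) ^ N"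
    using binomial_ring[of "1 / real v" 1 N] by simp
  also have "\<dots> \<le> exp (1 / real v) ^ N"
    using exp_ge_add_one_self[of "1 / real v"] by (intro power_mono) (simp_all add: add.commute)
  also have "\<dots> = exp (real N / real v)"
    by (simp add: exp_of_nat_mult[symmetric])
  also have "\<dots> \<le> exp (real m)"
  proof -
    have "2 * real N \<le> real v * real v"
      using of_nat_mono[OF assms(2), where 'a = real] by simp
    also have "\<dots> \<le> real v * (2 * real m)"
      using of_nat_mono[OF assms(3), where 'a = real] by (intro mult_left_mono) auto
    finally show ?thesis using assms(1) by (simp add: field_simps)
  qed
  also have "\<dots> = exp 1 ^ m" by (simp add: exp_of_nat_mult[symmetric])
  finally have "real (N choose m) / real v ^ m \<le> exp 1 ^ m" by (simp add: power_divide)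
  then show ?thesis using assms(1) by (simp add: field_simps power_mult_distrib)
qed

definition edges_within :: "nat \<Rightarrow> nat set \<Rightarrow> nat set set" where
  "edges_within n V = {e \<in> K_edges n. e \<subseteq> V}"

lemma card_edges_within:
  assumes "finite V"
  shows "2 * card (edges_within n V) \<le> card V * card V"
proof -
  have "card (edges_within n V) \<le> card {e. e \<subseteq> V \<and> card e = 2}"
    using assms by (intro card_mono) (auto simp: edges_within_def card_K_edge)
  also have "\<dots> = card V choose 2"
    using assms by (rule n_subsets)
  also have "2 * (card V choose 2) \<le> card V * card V"
    unfolding choose_two
    by (rule order_trans[OF times_div_less_eq_dividend]) simp
  finally show ?thesis by simp
qed

definition min_edges :: "real \<Rightarrow> nat \<Rightarrow> nat" where
  "min_edges lam v = nat \<lceil>lam * (real v - 2) + 1\<rceil>"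

text \<open>Passing to the least admissible number of edges makes all sets in the union bound
  equally large. The smaller set may touch fewer vertices, so \<open>\<Union>F\<close> is kept as a
  separate parameter.\<close>

lemma dense_edges_within:
  assumes "F \<subseteq> K_edges n" "dense_edges lam F"
  shows "\<exists>D\<subseteq>edges_within n (\<Union>F). card D = min_edges lam (card (\<Union>F)) \<and> D \<subseteq> F"
proof -
  have "min_edges lam (card (\<Union>F)) \<le> card F"
    using assms(2) unfolding min_edges_def nat_le_iff ceiling_le_iff dense_edges_def by simp
  then obtain D where "D \<subseteq> F" "card D = min_edges lam (card (\<Union>F))"
    using obtain_subset_with_card_n by metis
  then show ?thesis
    using assms(1) by (intro exI[of _ D]) (auto simp: edges_within_def)
qed

text \<open>Choosing and including one edge costs \<open>exp 1 * v * p\<close>, at most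
  \<open>q = \<delta> n^(-1/lam)\<close>. Raised to the power \<open>lam (v - 2) + 1\<close>, this
  gives \<open>n^(-(v - 2))\<close>, to be cancelled by the choice of \<open>v - 2\<close> vertices,
  and a spare \<open>n^(-1/lam)\<close> from the additional edge.\<close>

lemma dense_weight_le:
  fixes lam p x \<delta> :: real
  assumes "2 \<le> card V" "finite V" "2 \<le> lam" "0 \<le> p"
    and "exp 1 * real (card V) * p \<le> \<delta> * real n powr (- 1 / lam)" "0 < \<delta>" "\<delta> \<le> 1" "0 < n"
  shows "(\<Sum>D | D \<subseteq> edges_within n V \<and> card D = min_edges lam (card V). p ^ card D)
    \<le> \<delta> ^ (card V - 2) * (1 / real n) ^ (card V - 2) * real n powr (- 1 / lam)"
proof -
  define v m where "v = card V" and "m = min_edges lam v"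
  define q where "q = \<delta> * real n powr (- 1 / lam)"
  have m: "real m \<ge> lam * (real v - 2) + 1"
    unfolding m_def min_edges_def by (rule real_nat_ceiling_ge)
  have "lam * (real v - 2) \<ge> 2 * (real v - 2)"
    using assms by (intro mult_right_mono) (auto simp: v_def)
  then have "real v \<le> 2 * real m" using m assms by (simp add: v_def)
  then have vm: "v \<le> 2 * m" by linarith
  have q: "0 < q" "q \<le> 1"
  proof -
    show "0 < q" using assms by (simp add: q_def)
    have "real n powr (- 1 / lam) \<le> real n powr 0"
      using assms by (intro powr_mono) auto
    then have "\<delta> * real n powr (- 1 / lam) \<le> 1 * 1"
      using assms by (intro mult_mono) auto
    then show "q \<le> 1" by (simp add: q_def)
  qed
  have "finite (edges_within n V)" by (simp add: edges_within_def)
  then have "(\<Sum>D | D \<subseteq> edges_within n V \<and> card D = m. p ^ card D) = real (card (edges_within n V) choose m) * p ^ m"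
    by (simp add: n_subsets)
  also have "\<dots> \<le> (exp 1 * real v) ^ m * p ^ m"
    using assms vm card_edges_within[of V n]
    by (intro mult_right_mono binomial_le_exp_mult_power) (auto simp: v_def)
  also have "\<dots> = (exp 1 * real v * p) ^ m" by (simp add: power_mult_distrib)
  also have "\<dots> \<le> q ^ m"
    using assms by (intro power_mono) (auto simp: v_def q_def)
  also have "\<dots> = q powr real m" using q by (simp add: powr_realpow)
  \<comment> \<open>As \<open>q \<le> 1\<close>, the rounding up in \<open>min_edges\<close> only
    helps.\<close>
  also have "\<dots> \<le> q powr (lam * (real v - 2) + 1)"
    using q m by (intro powr_mono') auto
  also have "\<dots> = \<delta> powr (lam * (real v - 2) + 1) * real n powr (- 1 / lam * (lam * (real v - 2) + 1))"
    using assms by (simp add: q_def powr_mult powr_powr)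
  also have "- 1 / lam * (lam * (real v - 2) + 1) = - real (v - 2) + - 1 / lam"
    using assms by (simp add: field_simps v_def of_nat_diff)
  also have "real n powr (- real (v - 2) + - 1 / lam) = (1 / real n) ^ (v - 2) * real n powr (- 1 / lam)"
    unfolding powr_add using assms
    by (simp add: powr_minus powr_realpow power_one_over inverse_eq_divide)
  also have "\<delta> powr (lam * (real v - 2) + 1) \<le> \<delta> powr real (v - 2)"
  proof -
    have "1 * (real v - 2) \<le> lam * (real v - 2)"
      using assms by (intro mult_right_mono) (auto simp: v_def)
    then show ?thesis using assms by (intro powr_mono') (auto simp: v_def)
  qed
  also have "\<delta> powr real (v - 2) = \<delta> ^ (v - 2)"
    using assms by (simp add: powr_realpow)
  finally show ?thesis
    using assms by (simp add: v_def m_def mult_right_mono mult.assoc)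
qed

text \<open>Sets below size \<open>L\<close> are tied to the pair \<open>{1, 2}\<close>, which saves
  a factor \<open>n^2\<close> in their number; larger ones may lie anywhere.\<close>

definition candidates :: "nat \<Rightarrow> nat \<Rightarrow> nat \<Rightarrow> nat set set" where
  "candidates n L v = {V. V \<subseteq> {1..n} \<and> card V = v \<and> (v < L \<longrightarrow> {1, 2} \<subseteq> V)}"

lemma finite_candidates [simp]: "finite (candidates n L v)"
  by (rule finite_subset[of _ "Pow {1..n}"]) (auto simp: candidates_def)

lemma card_candidates_le:
  assumes "2 \<le> v"
  shows "card (candidates n L v) \<le> (if v < L then n ^ (v - 2) else n ^ v)"
proof (cases "v < L")
  case True
  have "card (candidates n L v) \<le> card {W. W \<subseteq> {1..n} \<and> card W = v - 2}"
  proof (rule card_inj_on_le[of "\<lambda>V. V - {1, 2}"])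
    show "inj_on (\<lambda>V. V - {1, 2}) (candidates n L v)"
    proof (rule inj_onI)
      fix V W assume "V \<in> candidates n L v" "W \<in> candidates n L v" "V - {1, 2} = W - {1, 2}"
      moreover from this have "{1, 2} \<subseteq> V" "{1, 2} \<subseteq> W" using True by (auto simp: candidates_def)
      ultimately show "V = W" by blast
    qed
    show "(\<lambda>V. V - {1, 2}) ` candidates n L v \<subseteq> {W. W \<subseteq> {1..n} \<and> card W = v - 2}"
    proof
      fix W assume "W \<in> (\<lambda>V. V - {1, 2}) ` candidates n L v"
      then obtain V where V: "W = V - {1, 2}" "V \<subseteq> {1..n}" "card V = v" "{1, 2} \<subseteq> V"
        using True by (auto simp: candidates_def)
      have "card W = card V - card {1::nat, 2}"
        unfolding V(1) using V(4) by (intro card_Diff_subset) auto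
      then show "W \<in> {W. W \<subseteq> {1..n} \<and> card W = v - 2}" using V by auto
    qed
  qed simp
  also have "\<dots> = n choose (v - 2)" by (simp add: n_subsets)
  also have "\<dots> \<le> n ^ (v - 2)"
    by (metis binomial_eq_0 binomial_le_pow le_less_linear zero_le)
  finally show ?thesis using True by simp
next
  case False
  then have "candidates n L v = {W. W \<subseteq> {1..n} \<and> card W = v}" by (auto simp: candidates_def)
  then have "card (candidates n L v) = n choose v" by (simp add: n_subsets)
  also have "\<dots> \<le> n ^ v"
    by (metis binomial_eq_0 binomial_le_pow le_less_linear zero_le)
  finally show ?thesis using False by simp
qed

lemma percolates_imp_dense:
  assumes rs: "r \<ge> 4" "s \<ge> 3" "s \<le> r" "r \<le> (s - 2)^2 + s"
    and G: "G \<subseteq> K_edges n" and L: "2 < L" and n: "2 \<le> n"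
    and perc: "percolates (complete_bipartite r s) n G"
  shows "\<exists>v\<in>{2..r * s * L}. \<exists>V\<in>candidates n L v.
    \<exists>D\<in>{D. D \<subseteq> edges_within n V \<and> card D = min_edges (lambda_bip r s) v}. D \<subseteq> G"
proof -
  let ?lam = "lambda_bip r s"
  have "L \<le> r * s * L" using rs by simp
  have "\<exists>F\<subseteq>G. dense_edges ?lam F \<and> 2 \<le> card (\<Union>F) \<and> card (\<Union>F) \<le> r * s * L \<and>
    (card (\<Union>F) < L \<longrightarrow> {1, 2} \<subseteq> \<Union>F)"
  proof (cases "\<exists>F\<subseteq>G. dense_edges ?lam F \<and> L \<le> card (\<Union>F) \<and> card (\<Union>F) \<le> r * s * L")
    case True
    then obtain F where "F \<subseteq> G" "dense_edges ?lam F" "L \<le> card (\<Union>F)" "card (\<Union>F) \<le> r * s * L" by blast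
    then show ?thesis using L by (intro exI[of _ F]) simp
  next
    case False
    \<comment> \<open>With no dense subset in the window the gap condition holds, so this infected
      pair is covered by a dense set on fewer than \<open>L\<close> vertices.\<close>
    have "{1, 2} \<in> bootstrap_closure (complete_bipartite r s) n G"
      using perc n by (simp add: percolates_def K_edges_iff)
    then obtain F where F: "F \<subseteq> G" "dense_edges ?lam F" "{1, 2} \<subseteq> \<Union>F" "card (\<Union>F) < L"
      using closure_covered_by_dense[OF rs G L, of "{1, 2}"] False not_le_imp_less by blast
    have "\<Union>F \<subseteq> {1..n}" using F(1) G K_edge_subset by blast
    then have "card {1::nat, 2} \<le> card (\<Union>F)"
      using F(3) finite_subset[of "\<Union>F" "{1..n}"] by (intro card_mono) auto
    moreover have "card (\<Union>F) \<le> r * s * L"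
      using F(4) \<open>L \<le> r * s * L\<close> by linarith
    ultimately show ?thesis using F by (intro exI[of _ F]) simp
  qed
  then obtain F where F: "F \<subseteq> G" "dense_edges ?lam F" "2 \<le> card (\<Union>F)" "card (\<Union>F) \<le> r * s * L"
    "card (\<Union>F) < L \<longrightarrow> {1, 2} \<subseteq> \<Union>F" by blast
  have "\<Union>F \<subseteq> {1..n}" using F(1) G K_edge_subset by blast
  then have "\<Union>F \<in> candidates n L (card (\<Union>F))" using F by (simp add: candidates_def)
  moreover obtain D where "D \<subseteq> edges_within n (\<Union>F)" "card D = min_edges ?lam (card (\<Union>F))" "D \<subseteq> F"
    using dense_edges_within[of F n ?lam] F G by blast
  moreover from this have "D \<subseteq> G" using F(1) by blast
  ultimately show ?thesis
    using F(3,4) by (intro bexI[of _ "card (\<Union>F)"] bexI[of _ "\<Union>F"] bexI[of _ D]) auto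
qed

text \<open>Every size \<open>v\<close> contributes at most \<open>n^(-1/lam)\<close>. For
  \<open>v < L\<close> the choices of vertices cancel; for \<open>v \<ge> L\<close> they leave a
  surplus \<open>n^2\<close>, absorbed by \<open>\<delta>^(L - 2)\<close>. There are at most
  \<open>r s L\<close> sizes.\<close>

lemma prob_percolates_le:
  assumes rs: "r \<ge> 4" "s \<ge> 3" "s \<le> r" "r \<le> (s - 2)^2 + s"
    and L: "2 < L" and n: "2 \<le> n" and p: "0 \<le> p" "p \<le> 1"
    and \<delta>: "0 < \<delta>" "\<delta> \<le> 1" "real n ^ 2 * \<delta> ^ (L - 2) \<le> 1"
    and small: "exp 1 * real (r * s * L) * p \<le> \<delta> * real n powr (- 1 / lambda_bip r s)"
  shows "measure_pmf.prob (random_graph n p) {G. percolates (complete_bipartite r s) n G}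
    \<le> real (r * s * L) * real n powr (- 1 / lambda_bip r s)"
proof -
  let ?lam = "lambda_bip r s"
  define M where "M = r * s * L"
  let ?D = "\<lambda>v V. {D. D \<subseteq> edges_within n V \<and> card D = min_edges ?lam v}"
  let ?pr = "measure_pmf.prob (random_subset (K_edges n) p)"
  have lam: "2 \<le> ?lam" using rs lambda_bip_ge_2 by blast
  have "?pr {G. percolates (complete_bipartite r s) n G}
      \<le> ?pr {G. \<exists>v\<in>{2..M}. \<exists>V\<in>candidates n L v. \<exists>D\<in>?D v V. D \<subseteq> G}"
    unfolding M_def using percolates_imp_dense[OF rs _ L n] by (rule prob_random_subset_mono)
  also have "\<dots> \<le> (\<Sum>v\<in>{2..M}. ?pr {G. \<exists>V\<in>candidates n L v. \<exists>D\<in>?D v V. D \<subseteq> G})"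
    by (rule prob_Ex_le) simp
  also have "\<dots> \<le> (\<Sum>v\<in>{2..M}. real n powr (- 1 / ?lam))"
  proof (rule sum_mono)
    fix v assume v: "v \<in> {2..M}"
    have "?pr {G. \<exists>V\<in>candidates n L v. \<exists>D\<in>?D v V. D \<subseteq> G}
        \<le> (\<Sum>V\<in>candidates n L v. ?pr {G. \<exists>D\<in>?D v V. D \<subseteq> G})"
      by (rule prob_Ex_le) simp
    also have "\<dots> \<le> (\<Sum>V\<in>candidates n L v. \<delta> ^ (v - 2) * (1 / real n) ^ (v - 2) * real n powr (- 1 / ?lam))"
    proof (rule sum_mono)
      fix V assume V: "V \<in> candidates n L v"
      then have cV: "card V = v" "finite V" by (auto simp: candidates_def intro: finite_subset)
      have "?pr {G. \<exists>D\<in>?D v V. D \<subseteq> G} \<le> (\<Sum>D\<in>?D v V. p ^ card D)"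
        using p by (intro prob_random_subset_contains_some_le) (auto simp: edges_within_def)
      also have "\<dots> = (\<Sum>D | D \<subseteq> edges_within n V \<and> card D = min_edges ?lam (card V). p ^ card D)"
        by (simp add: cV)
      also have "\<dots> \<le> \<delta> ^ (card V - 2) * (1 / real n) ^ (card V - 2) * real n powr (- 1 / ?lam)"
      proof (rule dense_weight_le)
        have "exp 1 * real v * p \<le> exp 1 * real M * p"
          using v p by (intro mult_right_mono mult_left_mono) auto
        then show "exp 1 * real (card V) * p \<le> \<delta> * real n powr (- 1 / ?lam)"
          using small unfolding cV M_def by linarith
      qed (use v cV lam p \<delta> n in auto)
      finally show "?pr {G. \<exists>D\<in>?D v V. D \<subseteq> G} \<le> \<delta> ^ (v - 2) * (1 / real n) ^ (v - 2) * real n powr (- 1 / ?lam)"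
        by (simp add: cV)
    qed
    also have "\<dots> = real (card (candidates n L v)) * (\<delta> ^ (v - 2) * (1 / real n) ^ (v - 2)) * real n powr (- 1 / ?lam)"
      by simp
    also have "real (card (candidates n L v)) * (\<delta> ^ (v - 2) * (1 / real n) ^ (v - 2)) \<le> 1"
    proof (cases "v < L")
      case True
      have "real (card (candidates n L v)) \<le> real (n ^ (v - 2))"
        using card_candidates_le[of v n L] v True by (intro of_nat_mono) simp
      then have "real (card (candidates n L v)) * (\<delta> ^ (v - 2) * (1 / real n) ^ (v - 2))
          \<le> real n ^ (v - 2) * (\<delta> ^ (v - 2) * (1 / real n) ^ (v - 2))"
        using \<delta> by (intro mult_right_mono) auto
      also have "\<dots> = \<delta> ^ (v - 2)"
        using n by (simp add: power_divide)
      also have "\<dots> \<le> 1" using \<delta> by (intro power_le_one) auto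
      finally show ?thesis .
    next
      case False
      have "real (card (candidates n L v)) \<le> real (n ^ v)"
        using card_candidates_le[of v n L] v False by (intro of_nat_mono) simp
      then have "real (card (candidates n L v)) * (\<delta> ^ (v - 2) * (1 / real n) ^ (v - 2))
          \<le> real n ^ v * (\<delta> ^ (v - 2) * (1 / real n) ^ (v - 2))"
        using \<delta> by (intro mult_right_mono) auto
      also have "\<dots> = real n ^ (2 + (v - 2)) * (\<delta> ^ (v - 2) * (1 / real n) ^ (v - 2))"
      proof -
        have "2 + (v - 2) = v" using v by (intro le_add_diff_inverse) simp
        then show ?thesis by simp
      qed
      also have "\<dots> = real n ^ 2 * \<delta> ^ (v - 2)"
        using n unfolding power_add by (simp add: power_divide)
      also have "\<dots> \<le> real n ^ 2 * \<delta> ^ (L - 2)"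
        using \<delta> False by (intro mult_left_mono power_decreasing) auto
      also have "\<dots> \<le> 1" by (rule \<delta>)
      finally show ?thesis .
    qed
    then have "real (card (candidates n L v)) * (\<delta> ^ (v - 2) * (1 / real n) ^ (v - 2)) * real n powr (- 1 / ?lam)
       \<le> 1 * real n powr (- 1 / ?lam)"
      by (intro mult_right_mono) auto
    finally show "?pr {G. \<exists>V\<in>candidates n L v. \<exists>D\<in>?D v V. D \<subseteq> G} \<le> real n powr (- 1 / ?lam)"
      by simp
  qed
  also have "\<dots> = real (M - 1) * real n powr (- 1 / ?lam)" by simp
  also have "\<dots> \<le> real M * real n powr (- 1 / ?lam)"
    by (intro mult_right_mono) auto
  finally show ?thesis by (simp add: random_graph_eq M_def)
qed

text \<open>The threshold is an infimum, so the bound is formulated for every \<open>p\<close> at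
  which percolation has probability at least one half.\<close>

lemma critical_lower:
  assumes rs: "r \<ge> 4" "s \<ge> 3" "s \<le> r" "r \<le> (s - 2)^2 + s"
  defines "lam \<equiv> lambda_bip r s"
  shows "\<exists>c>0. \<forall>\<^sub>F n in sequentially. \<forall>p. 0 \<le> p \<longrightarrow> p \<le> 1 \<longrightarrow>
    1 / 2 \<le> measure_pmf.prob (random_graph n p) {G. percolates (complete_bipartite r s) n G} \<longrightarrow>
    c * inverse (ln (real n)) * real n powr (- 1 / lam) \<le> p"
proof -
  \<comment> \<open>The product \<open>exp 1 * (2 * r * s) * c\<close> equals
    \<open>exp (-2)\<close>, the value of \<open>\<delta>\<close> used below; the factor 2 accounts
    for \<open>L \<le> 2 ln n\<close>.\<close>
  define c where "c = exp (-3) / (2 * real (r * s))"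
  have rs0: "real (r * s) > 0" using rs by simp
  have lam: "lam \<ge> 2" unfolding lam_def using rs lambda_bip_ge_2 by blast
  have "c > 0" using rs0 by (simp add: c_def)
  moreover have "\<forall>\<^sub>F n in sequentially. \<forall>p. 0 \<le> p \<longrightarrow> p \<le> 1 \<longrightarrow>
    1 / 2 \<le> measure_pmf.prob (random_graph n p) {G. percolates (complete_bipartite r s) n G} \<longrightarrow>
    c * inverse (ln (real n)) * real n powr (- 1 / lam) \<le> p"
  proof -
    have "((\<lambda>x::real. ln x * x powr (- 1 / lam)) \<longlongrightarrow> 0) at_top"
      using lam by real_asymp
    then have "((\<lambda>n. 2 * real (r * s) * (ln (real n) * real n powr (- 1 / lam))) \<longlonglongrightarrow> 2 * real (r * s) * 0)"
      by (intro tendsto_mult tendsto_const) (rule filterlim_compose[OF _ filterlim_real_sequentially])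
    then have ev1: "\<forall>\<^sub>F n in sequentially. 2 * real (r * s) * (ln (real n) * real n powr (- 1 / lam)) < 1 / 2"
      by (rule order_tendstoD) simp
    have ev2: "\<forall>\<^sub>F n in sequentially. ln (real n) \<ge> 4"
      by real_asymp
    show ?thesis
      using ev1 ev2 eventually_ge_at_top[of 2]
    proof eventually_elim
      case (elim n)
      show ?case
      proof (intro allI impI, rule ccontr)
        fix p assume p: "0 \<le> p" "p \<le> 1"
          and perc: "1 / 2 \<le> measure_pmf.prob (random_graph n p) {G. percolates (complete_bipartite r s) n G}"
          and "\<not> c * inverse (ln (real n)) * real n powr (- 1 / lam) \<le> p"
        then have pc: "p \<le> c * inverse (ln (real n)) * real n powr (- 1 / lam)" by simp
        \<comment> \<open>The summand 2 gives \<open>L - 2 \<ge> ln n\<close>, hence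
          \<open>exp (-2) ^ (L - 2) \<le> n^(-2)\<close>.\<close>
        define L where "L = nat \<lceil>ln (real n)\<rceil> + 2"
        have L: "real L \<ge> ln (real n) + 2" "real L \<le> 2 * ln (real n)"
          unfolding L_def using elim by linarith+
        have "2 < L" using L elim by linarith
        have M: "real (r * s * L) \<le> 2 * real (r * s) * ln (real n)"
          using mult_left_mono[OF L(2), of "real (r * s)"] by (simp add: mult_ac)
        have "measure_pmf.prob (random_graph n p) {G. percolates (complete_bipartite r s) n G}
          \<le> real (r * s * L) * real n powr (- 1 / lam)"
          unfolding lam_def
        proof (rule prob_percolates_le[OF rs \<open>2 < L\<close> elim(3) p, of "exp (-2)"])
          have "exp (-2) ^ (L - 2) = exp (-2 * real (L - 2))"
            by (simp add: exp_of_nat_mult[symmetric] mult.commute)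
          also have "\<dots> \<le> exp (-2 * ln (real n))"
            using L \<open>2 < L\<close> by simp
          also have "\<dots> = real n powr (-2)"
            using elim by (simp add: powr_def)
          also have "\<dots> = inverse (real n ^ 2)"
            using elim by (simp add: powr_minus)
          finally show "real n ^ 2 * exp (-2) ^ (L - 2) \<le> 1"
            using elim by (simp add: field_simps)
          have "exp 1 * real (r * s * L) * p \<le> exp 1 * (2 * real (r * s) * ln (real n)) *
              (c * inverse (ln (real n)) * real n powr (- 1 / lam))"
            using M pc p elim rs0 by (intro mult_mono) auto
          also have "\<dots> = exp 1 * exp (-3) * real n powr (- 1 / lam)"
          proof -
            have "2 * real (r * s) * c = exp (-3)" "ln (real n) * inverse (ln (real n)) = 1"
              unfolding c_def using rs elim by auto
            moreover have "exp 1 * (2 * real (r * s) * ln (real n)) * (c * inverse (ln (real n)) * real n powr (- 1 / lam))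
              = exp 1 * (2 * real (r * s) * c) * (ln (real n) * inverse (ln (real n))) * real n powr (- 1 / lam)"
              by (simp only: mult_ac)
            ultimately show ?thesis by (simp only: mult_1_right)
          qed
          also have "exp 1 * exp (-3) = exp (-2::real)" by (simp add: exp_add[symmetric])
          finally show "exp 1 * real (r * s * L) * p \<le> exp (-2) * real n powr (- 1 / lambda_bip r s)"
            by (simp add: lam_def)
        qed auto
        also have "\<dots> \<le> (2 * real (r * s) * ln (real n)) * real n powr (- 1 / lam)"
          using M by (intro mult_right_mono) auto
        also have "\<dots> < 1 / 2" using elim(1) by (simp add: mult.assoc)
        finally show False using perc by simp
      qed
    qed
  qed
  ultimately show ?thesis by blast
qed

section \<open>Chains of copies\<close>

text \<open>The left vertices of a chain are numbered \<open>0..l (r - 1)\<close> and the right ones \<open>0..l (s - 1)\<close>. The \<open>i\<close>-th copy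
  occupies the \<open>i\<close>-th blocks on both sides, so it shares its first vertices with copy \<open>i - 1\<close> and its last ones
  with copy \<open>i + 1\<close>; the pairs of shared vertices are not edges, nor is the pair \<open>(0, 0)\<close> of roots.\<close>

definition chain_block :: "nat \<Rightarrow> nat \<Rightarrow> nat set" where
  "chain_block r i = {i * (r - 1)..Suc i * (r - 1)}"

definition chain_edges :: "nat \<Rightarrow> nat \<Rightarrow> nat \<Rightarrow> (nat \<times> nat) set" where
  "chain_edges r s l = (\<Union>i<l. chain_block r i \<times> chain_block s i) - (\<lambda>i. (i * (r - 1), i * (s - 1))) ` {..<l}"

lemma card_chain_block: "1 \<le> r \<Longrightarrow> card (chain_block r i) = r"
  by (simp add: chain_block_def)

lemma finite_chain_block [simp]: "finite (chain_block r i)"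
  by (simp add: chain_block_def)

lemma chain_block_subset: "i < l \<Longrightarrow> chain_block r i \<subseteq> {0..l * (r - 1)}"
  unfolding chain_block_def using mult_le_mono1[of "Suc i" l "r - 1"] by auto

lemma finite_chain_edges [simp]: "finite (chain_edges r s l)"
  by (simp add: chain_edges_def)

text \<open>Corners sit at multiples of the block step, and a block spans one step; so a copy
  contains no corners besides its own two.\<close>

lemma multiple_mem_chain_block:
  assumes "2 \<le> r" "j * (r - 1) \<in> chain_block r i"
  shows "j = i \<or> j = Suc i"
proof -
  have "i * (r - 1) \<le> j * (r - 1)" "j * (r - 1) \<le> Suc i * (r - 1)"
    using assms(2) by (auto simp: chain_block_def)
  then have "i \<le> j" "j \<le> Suc i"
    using assms(1) by (simp_all only: mult_le_cancel2)
  then show ?thesis by linarith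
qed

text \<open>Infection runs backwards. The last corner is the only one present as an edge; it
  completes the last copy up to its first corner, which is the last corner of the preceding copy,
  and so on down to the roots.\<close>

lemma chain_infects:
  assumes C: "bip_closed r s n C" and rs: "2 \<le> r" "2 \<le> s" and l: "0 < l"
    and f: "inj_on f {0..l * (r - 1)}" "f ` {0..l * (r - 1)} \<subseteq> {1..n}"
    and g: "inj_on g {0..l * (s - 1)}" "g ` {0..l * (s - 1)} \<subseteq> {1..n}"
    and fg: "f ` {0..l * (r - 1)} \<inter> g ` {0..l * (s - 1)} = {}"
    and edges: "\<And>a b. (a, b) \<in> chain_edges r s l \<Longrightarrow> {f a, g b} \<in> C"
  shows "{f 0, g 0} \<in> C"
proof -
  have "{f (i * (r - 1)), g (i * (s - 1))} \<in> C" if "i \<le> l" for i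
    using that
  proof (induction rule: inc_induct)
    case base
    obtain m where m: "l = Suc m" using l gr0_conv_Suc by blast
    have "(l * (r - 1), l * (s - 1)) \<in> chain_block r m \<times> chain_block s m"
      by (simp add: m chain_block_def)
    moreover have "(l * (r - 1), l * (s - 1)) \<notin> (\<lambda>i. (i * (r - 1), i * (s - 1))) ` {..<l}"
      using rs by auto
    ultimately have "(l * (r - 1), l * (s - 1)) \<in> chain_edges r s l"
      using m unfolding chain_edges_def by blast
    then show ?case by (rule edges)
  next
    case (step i)
    define A B where "A = f ` chain_block r i" and "B = g ` chain_block s i"
    have sub: "chain_block r i \<subseteq> {0..l * (r - 1)}" "chain_block s i \<subseteq> {0..l * (s - 1)}"
      using chain_block_subset step(2) by auto
    show ?case
    proof (rule bip_closedD[OF C, of A B])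
      show "A \<union> B \<subseteq> {1..n}" unfolding A_def B_def using f(2) g(2) sub by blast
      show "A \<inter> B = {}" unfolding A_def B_def using fg sub by blast
      show "card A = r"
        unfolding A_def using inj_on_subset[OF f(1) sub(1)] rs by (simp add: card_image card_chain_block)
      show "card B = s"
        unfolding B_def using inj_on_subset[OF g(1) sub(2)] rs by (simp add: card_image card_chain_block)
      show "f (i * (r - 1)) \<in> A" "g (i * (s - 1)) \<in> B"
        unfolding A_def B_def by (auto simp: chain_block_def)
      show "biclique A B - {{f (i * (r - 1)), g (i * (s - 1))}} \<subseteq> C"
      proof
        fix e assume e: "e \<in> biclique A B - {{f (i * (r - 1)), g (i * (s - 1))}}"
        then obtain a b where ab: "a \<in> chain_block r i" "b \<in> chain_block s i" "e = {f a, g b}"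
          unfolding A_def B_def biclique_def by blast
        show "e \<in> C"
        proof (cases "(a, b) \<in> (\<lambda>i. (i * (r - 1), i * (s - 1))) ` {..<l}")
          case True
          then obtain j where j: "a = j * (r - 1)" "b = j * (s - 1)" by blast
          then have "j = i \<or> j = Suc i" using multiple_mem_chain_block[OF rs(1)] ab by blast
          moreover have "j \<noteq> i" using e ab j by auto
          ultimately show ?thesis using step.IH ab j by simp
        next
          case False
          then have "(a, b) \<in> chain_edges r s l"
            unfolding chain_edges_def using ab step(2) by blast
          then show ?thesis using edges ab by blast
        qed
      qed
    qed
  qed
  from this[of 0] show ?thesis by simp
qed

text \<open>One step along a chain: \<open>A\<close> and \<open>B\<close> are the traces of a vertex
  set on the newest copy, \<open>(x, y)\<close> is the corner shared with the previous copy,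
  \<open>(x', y')\<close> the last corner, and \<open>k\<close> counts the new vertices. A full copy
  attains \<open>r s - 2 = lam (r + s - 2)\<close>; every other trace is governed by
  balancedness.\<close>

lemma biclique_minus_corners:
  fixes A :: "'a set" and B :: "'b set" and y y' :: 'b
  assumes rs: "r \<ge> 4" "s \<ge> 3" "s \<le> r" "r \<le> (s - 2)^2 + s"
    and fin: "finite A" "finite B" and le: "card A \<le> r" "card B \<le> s" and x: "x \<noteq> x'"
    and full_corner: "card A = r \<Longrightarrow> x' \<in> A" "card B = s \<Longrightarrow> y' \<in> B"
  defines "lam \<equiv> lambda_bip r s"
    and "k \<equiv> real (card A) + real (card B) - of_bool (x \<in> A) - of_bool (y \<in> B)"
  shows "real (card (A \<times> B - {(x, y), (x', y')})) \<le> lam * k"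
    and "x' \<in> A \<Longrightarrow> y' \<in> B \<Longrightarrow> (card A, card B) \<noteq> (r, s) \<Longrightarrow>
      real (card (A \<times> B - {(x, y), (x', y')})) \<le> lam * k - 1"
proof -
  define a b where "a = card A" and "b = card B"
  have lam: "lam \<ge> 2" unfolding lam_def using rs lambda_bip_ge_2 by blast
  have card_eq: "real (card (A \<times> B - {(x, y), (x', y')})) =
      real a * real b - of_bool (x \<in> A \<and> y \<in> B) - of_bool (x' \<in> A \<and> y' \<in> B)"
  proof -
    have "A \<times> B \<inter> {(x, y), (x', y')} =
        (if x \<in> A \<and> y \<in> B then {(x, y)} else {}) \<union> (if x' \<in> A \<and> y' \<in> B then {(x', y')} else {})"
      by auto
    then have "card (A \<times> B \<inter> {(x, y), (x', y')}) = of_bool (x \<in> A \<and> y \<in> B) + of_bool (x' \<in> A \<and> y' \<in> B)"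
      using x by simp
    moreover have "card (A \<times> B - {(x, y), (x', y')}) + card (A \<times> B \<inter> {(x, y), (x', y')}) = a * b"
      using card_Diff_subset_Int[of "A \<times> B" "{(x, y), (x', y')}"] fin
        card_mono[of "A \<times> B" "A \<times> B \<inter> {(x, y), (x', y')}"]
      by (simp add: a_def b_def card_cartesian_product)
    ultimately have "real (card (A \<times> B - {(x, y), (x', y')})) +
        real (of_bool (x \<in> A \<and> y \<in> B) + of_bool (x' \<in> A \<and> y' \<in> B)) = real (a * b)"
      by (metis of_nat_add)
    then show ?thesis by simp
  qed
  have pos: "x \<in> A \<Longrightarrow> a \<ge> 1" "x' \<in> A \<Longrightarrow> a \<ge> 1" "y \<in> B \<Longrightarrow> b \<ge> 1" "y' \<in> B \<Longrightarrow> b \<ge> 1"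
    using fin by (auto simp: a_def b_def Suc_le_eq card_gt_0_iff)
  have bal: "real a * real b \<le> lam * (real a + real b - 2) + 1" if "a + b \<ge> 2" "(a, b) \<noteq> (r, s)"
    unfolding lam_def using that le by (intro balanced[OF rs]) (auto simp: a_def b_def)
  have full: "real r * real s - 2 = lam * (real r + real s - 2)"
    using rs by (simp add: lam_def lambda_bip_def)
  have k: "k = real a + real b - of_bool (x \<in> A) - of_bool (y \<in> B)"
    by (simp add: k_def a_def b_def)
  \<comment> \<open>If a vertex of the first corner is absent, one vertex more counts as new; the
    gain \<open>lam \<ge> 2\<close> covers the pair \<open>(x, y)\<close> that is then not
    subtracted.\<close>
  have lam_k: "lam * (real a + real b - 2) + lam \<le> lam * k" if "\<not> (x \<in> A \<and> y \<in> B)"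
  proof -
    have "lam * (real a + real b - 1) \<le> lam * k"
      using that lam unfolding k by (intro mult_left_mono) auto
    then show ?thesis by (simp add: algebra_simps)
  qed
  have lam_k': "lam * (real a + real b - 2) = lam * k" if "x \<in> A \<and> y \<in> B"
    using that unfolding k by simp
  show second: "real (card (A \<times> B - {(x, y), (x', y')})) \<le> lam * k - 1"
    if "x' \<in> A" "y' \<in> B" "(card A, card B) \<noteq> (r, s)"
  proof -
    have "real a * real b \<le> lam * (real a + real b - 2) + 1"
      using that pos by (intro bal) (auto simp: a_def b_def)
    then show ?thesis
      unfolding card_eq using that lam lam_k lam_k' by (cases "x \<in> A \<and> y \<in> B") auto
  qed
  show "real (card (A \<times> B - {(x, y), (x', y')})) \<le> lam * k"
  proof (cases "(a, b) = (r, s)")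
    case True
    then have "x' \<in> A" "y' \<in> B" using full_corner by (simp_all add: a_def b_def)
    then show ?thesis
      unfolding card_eq using True full lam lam_k lam_k' by (cases "x \<in> A \<and> y \<in> B") auto
  next
    case False
    show ?thesis
    proof (cases "a + b \<ge> 2")
      case True
      then show ?thesis
        unfolding card_eq using bal False lam lam_k lam_k' by (cases "x \<in> A \<and> y \<in> B") auto
    next
      case small: False
      then have "a = 0 \<or> b = 0" by linarith
      moreover have "k \<ge> 0" unfolding k using pos by auto
      ultimately show ?thesis unfolding card_eq using pos lam by auto
    qed
  qed
qed

text \<open>All \<open>l + 1\<close> corners are removed, so attaching a copy only adds pairs and
  induction on \<open>l\<close> works. The last corner of \<open>chain_edges\<close>, in contrast,
  stops being an edge when a further copy follows.\<close>

definition chain_inner :: "nat \<Rightarrow> nat \<Rightarrow> nat \<Rightarrow> (nat \<times> nat) set" where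
  "chain_inner r s l = (\<Union>i<l. chain_block r i \<times> chain_block s i) - (\<lambda>i. (i * (r - 1), i * (s - 1))) ` {..l}"

text \<open>The bound improves by one when the last corner is present and the set is not everything, because
  some copy of the chain then meets the set in a proper subset; this pays for the last corner, which is
  an edge of \<open>chain_edges\<close> but not of \<open>chain_inner\<close>.\<close>

lemma card_chain_inner_le:
  assumes rs: "r \<ge> 4" "s \<ge> 3" "s \<le> r" "r \<le> (s - 2)^2 + s"
    and S: "S \<subseteq> {0..l * (r - 1)}" "T \<subseteq> {0..l * (s - 1)}" "0 \<in> S" "0 \<in> T"
  defines "lam \<equiv> lambda_bip r s"
  shows "real (card (chain_inner r s l \<inter> S \<times> T)) \<le> lam * (real (card S) + real (card T) - 2) \<and>
    (l * (r - 1) \<in> S \<longrightarrow> l * (s - 1) \<in> T \<longrightarrow> (S, T) \<noteq> ({0..l * (r - 1)}, {0..l * (s - 1)}) \<longrightarrow>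
      real (card (chain_inner r s l \<inter> S \<times> T)) \<le> lam * (real (card S) + real (card T) - 2) - 1)"
  using S
proof (induction l arbitrary: S T)
  case 0
  then have "S = {0}" "T = {0}" by auto
  then show ?case by (simp add: chain_inner_def)
next
  case (Suc l)
  define S' T' where "S' = S \<inter> {0..l * (r - 1)}" and "T' = T \<inter> {0..l * (s - 1)}"
  define A B where "A = S \<inter> chain_block r l" and "B = T \<inter> chain_block s l"
  let ?x = "l * (r - 1)" and ?y = "l * (s - 1)" and ?x' = "Suc l * (r - 1)" and ?y' = "Suc l * (s - 1)"
  define k where "k = real (card A) + real (card B) - of_bool (?x \<in> A) - of_bool (?y \<in> B)"
  \<comment> \<open>The two ranges overlap exactly in the shared vertex \<open>l * (q - 1)\<close>,
    which must not be counted twice.\<close>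
  have split: "real (card U) = real (card (U \<inter> {0..l * (q - 1)})) + real (card (U \<inter> chain_block q l)) -
      of_bool (l * (q - 1) \<in> U \<inter> chain_block q l)" if U: "U \<subseteq> {0..Suc l * (q - 1)}" for U q
  proof -
    have "U = (U \<inter> {0..l * (q - 1)}) \<union> (U \<inter> chain_block q l)"
      using U by (auto simp: chain_block_def)
    moreover have "(U \<inter> {0..l * (q - 1)}) \<inter> (U \<inter> chain_block q l) = (if l * (q - 1) \<in> U then {l * (q - 1)} else {})"
      by (auto simp: chain_block_def)
    ultimately have "card (U \<inter> {0..l * (q - 1)}) + card (U \<inter> chain_block q l) = card U + of_bool (l * (q - 1) \<in> U)"
      using card_Un_Int[of "U \<inter> {0..l * (q - 1)}" "U \<inter> chain_block q l"] by simp
    then have "real (card (U \<inter> {0..l * (q - 1)})) + real (card (U \<inter> chain_block q l)) = real (card U) + of_bool (l * (q - 1) \<in> U)"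
      by (metis of_nat_add of_nat_of_bool)
    moreover have "l * (q - 1) \<in> chain_block q l" by (simp add: chain_block_def)
    ultimately show ?thesis by simp
  qed
  have kk: "real (card S) + real (card T) - 2 = (real (card S') + real (card T') - 2) + k"
    using split[OF Suc.prems(1)] split[OF Suc.prems(2)] by (simp add: S'_def T'_def A_def B_def k_def)
  have "chain_inner r s (Suc l) \<inter> S \<times> T \<subseteq>
      (chain_inner r s l \<inter> S' \<times> T') \<union> (A \<times> B - {(?x, ?y), (?x', ?y')})"
  proof
    fix z assume z: "z \<in> chain_inner r s (Suc l) \<inter> S \<times> T"
    then obtain i where i: "i < Suc l" "z \<in> chain_block r i \<times> chain_block s i"
      and nz: "z \<notin> (\<lambda>i. (i * (r - 1), i * (s - 1))) ` {..Suc l}" and zST: "z \<in> S \<times> T"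
      unfolding chain_inner_def by blast
    show "z \<in> (chain_inner r s l \<inter> S' \<times> T') \<union> (A \<times> B - {(?x, ?y), (?x', ?y')})"
    proof (cases "i = l")
      case True
      have "z \<noteq> (j * (r - 1), j * (s - 1))" if "j \<le> Suc l" for j
        using nz that by blast
      from this[of l] this[of "Suc l"] have "z \<noteq> (?x, ?y)" "z \<noteq> (?x', ?y')"
        by (simp_all del: mult_Suc)
      then show ?thesis using True i zST unfolding A_def B_def by auto
    next
      case False
      then have "i < l" using i by simp
      then have "z \<in> {0..l * (r - 1)} \<times> {0..l * (s - 1)}"
        using i(2) chain_block_subset[of i l r] chain_block_subset[of i l s] by blast
      moreover have "z \<in> chain_inner r s l"
        unfolding chain_inner_def using \<open>i < l\<close> i(2) nz by auto
      ultimately show ?thesis using zST unfolding S'_def T'_def by auto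
    qed
  qed
  then have "card (chain_inner r s (Suc l) \<inter> S \<times> T) \<le>
      card ((chain_inner r s l \<inter> S' \<times> T') \<union> (A \<times> B - {(?x, ?y), (?x', ?y')}))"
    by (intro card_mono) (auto simp: A_def B_def chain_inner_def)
  also have "\<dots> \<le> card (chain_inner r s l \<inter> S' \<times> T') + card (A \<times> B - {(?x, ?y), (?x', ?y')})"
    by (rule card_Un_le)
  finally have card_le: "real (card (chain_inner r s (Suc l) \<inter> S \<times> T)) \<le>
      real (card (chain_inner r s l \<inter> S' \<times> T')) + real (card (A \<times> B - {(?x, ?y), (?x', ?y')}))"
    by linarith
  have S'T': "S' \<subseteq> {0..l * (r - 1)}" "T' \<subseteq> {0..l * (s - 1)}" "0 \<in> S'" "0 \<in> T'"
    using Suc.prems by (auto simp: S'_def T'_def)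
  have ne: "?x \<noteq> ?x'" using rs by simp
  have le: "card A \<le> r" "card B \<le> s"
    using card_mono[of "chain_block r l" A] card_mono[of "chain_block s l" B] rs
    by (simp_all add: A_def B_def card_chain_block)
  have fullA: "A = chain_block r l" if "card A = r"
    using that rs by (intro card_subset_eq) (auto simp: A_def card_chain_block)
  have fullB: "B = chain_block s l" if "card B = s"
    using that rs by (intro card_subset_eq) (auto simp: B_def card_chain_block)
  have finAB: "finite A" "finite B" by (simp_all add: A_def B_def)
  have cornA: "?x' \<in> A" if "card A = r" using fullA[OF that] by (auto simp: chain_block_def)
  have cornB: "?y' \<in> B" if "card B = s" using fullB[OF that] by (auto simp: chain_block_def)
  have step1: "real (card (A \<times> B - {(?x, ?y), (?x', ?y')})) \<le> lam * k"
    unfolding lam_def k_def by (rule biclique_minus_corners(1)[OF rs finAB le ne cornA cornB])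
  have step2: "real (card (A \<times> B - {(?x, ?y), (?x', ?y')})) \<le> lam * k - 1"
    if "?x' \<in> A" "?y' \<in> B" "(card A, card B) \<noteq> (r, s)"
    unfolding lam_def k_def by (rule biclique_minus_corners(2)[OF rs finAB le ne cornA cornB that])
  note IH = Suc.IH[OF S'T']
  show ?case
  proof (intro conjI impI)
    show "real (card (chain_inner r s (Suc l) \<inter> S \<times> T)) \<le> lam * (real (card S) + real (card T) - 2)"
      using card_le IH step1 unfolding kk distrib_left by linarith
    assume corner: "?x' \<in> S" "?y' \<in> T" and not_full: "(S, T) \<noteq> ({0..?x'}, {0..?y'})"
    have cAB: "?x' \<in> A" "?y' \<in> B" using corner by (auto simp: A_def B_def chain_block_def)
    \<comment> \<open>If the last copy is met in full, the deficiency lies in the earlier copies and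
      their last corner is present, so the induction hypothesis saves one; otherwise the last copy
      saves one.\<close>
    show "real (card (chain_inner r s (Suc l) \<inter> S \<times> T)) \<le> lam * (real (card S) + real (card T) - 2) - 1"
    proof (cases "(card A, card B) = (r, s)")
      case True
      then have AB: "A = chain_block r l" "B = chain_block s l" using fullA fullB by auto
      have "?x \<in> chain_block r l" "?y \<in> chain_block s l" by (simp_all add: chain_block_def)
      then have "?x \<in> S'" "?y \<in> T'"
        using AB by (auto simp: A_def B_def S'_def T'_def)
      moreover have "(S', T') \<noteq> ({0..?x}, {0..?y})"
      proof
        assume "(S', T') = ({0..?x}, {0..?y})"
        then have "{0..?x} \<union> chain_block r l \<subseteq> S" "{0..?y} \<union> chain_block s l \<subseteq> T"
          using AB by (auto simp: A_def B_def S'_def T'_def)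
        moreover have "{0..?x} \<union> chain_block r l = {0..?x'}" "{0..?y} \<union> chain_block s l = {0..?y'}"
          by (auto simp: chain_block_def)
        ultimately show False using Suc.prems(1,2) not_full by auto
      qed
      ultimately show ?thesis
        using card_le IH step1 unfolding kk distrib_left by linarith
    next
      case False
      then show ?thesis
        using card_le IH step2[OF cAB False] unfolding kk distrib_left by linarith
    qed
  qed
qed

text \<open>Relative to the roots, no proper part of the chain exceeds \<open>lam\<close> edges per
  vertex; only the whole chain is allowed one more. This confines the factor \<open>1 / p\<close> in
  the second moment to the diagonal.\<close>

lemma card_chain_edges_le:
  assumes rs: "r \<ge> 4" "s \<ge> 3" "s \<le> r" "r \<le> (s - 2)^2 + s"
    and S: "S \<subseteq> {0..l * (r - 1)}" "T \<subseteq> {0..l * (s - 1)}" "0 \<in> S" "0 \<in> T"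
  defines "lam \<equiv> lambda_bip r s"
  shows "real (card (chain_edges r s l \<inter> S \<times> T)) \<le> lam * (real (card S) + real (card T) - 2) +
    of_bool ((S, T) = ({0..l * (r - 1)}, {0..l * (s - 1)}))"
proof -
  let ?c = "(l * (r - 1), l * (s - 1))"
  note inner = card_chain_inner_le[OF rs S, folded lam_def]
  have fin: "finite (chain_inner r s l)" by (simp add: chain_inner_def)
  have sub: "chain_edges r s l \<inter> S \<times> T \<subseteq> (chain_inner r s l \<inter> S \<times> T) \<union> ({?c} \<inter> S \<times> T)"
    unfolding chain_edges_def chain_inner_def by (auto simp: less_le)
  have "card (chain_edges r s l \<inter> S \<times> T) \<le> card (chain_inner r s l \<inter> S \<times> T) + card ({?c} \<inter> S \<times> T)"
    using card_mono[OF _ sub] card_Un_le[of "chain_inner r s l \<inter> S \<times> T" "{?c} \<inter> S \<times> T"] fin by auto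
  moreover have "card ({?c} \<inter> S \<times> T) = of_bool (?c \<in> S \<times> T)" by auto
  ultimately have "real (card (chain_edges r s l \<inter> S \<times> T)) \<le>
      real (card (chain_inner r s l \<inter> S \<times> T)) + of_bool (?c \<in> S \<times> T)"
    by (metis of_nat_add of_nat_mono of_nat_of_bool)
  then show ?thesis
    using inner by (cases "?c \<in> S \<times> T"; cases "(S, T) = ({0..l * (r - 1)}, {0..l * (s - 1)})") auto
qed

section \<open>The second moment method\<close>

text \<open>Chebyshev's inequality for the number \<open>X\<close> of sets contained in
  \<open>G\<close>. Two sets lie in \<open>G\<close> together with probability
  \<open>p ^ (2 * e) * (1 / p) ^ card (D \<phi> \<inter> D \<psi>)\<close>, so
  \<open>\<epsilon>\<close> bounds the variance divided by the squared mean.\<close>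

lemma second_moment:
  fixes D :: "'b \<Rightarrow> 'a set" and p \<epsilon> :: real
  assumes I: "finite I" and \<Phi>: "finite \<Phi>" "\<Phi> \<noteq> {}"
    and D: "\<And>\<phi>. \<phi> \<in> \<Phi> \<Longrightarrow> D \<phi> \<subseteq> I" "\<And>\<phi>. \<phi> \<in> \<Phi> \<Longrightarrow> card (D \<phi>) = e"
    and p: "0 < p" "p \<le> 1"
    and overlap: "\<And>\<phi>. \<phi> \<in> \<Phi> \<Longrightarrow> (\<Sum>\<psi>\<in>\<Phi>. (1 / p) ^ card (D \<phi> \<inter> D \<psi>)) \<le> real (card \<Phi>) * (1 + \<epsilon>)"
  shows "measure_pmf.prob (random_subset I p) {G. \<forall>\<phi>\<in>\<Phi>. \<not> D \<phi> \<subseteq> G} \<le> \<epsilon>"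
proof -
  let ?M = "random_subset I p"
  let ?E = "measure_pmf.expectation ?M"
  define X where "X = (\<lambda>G. \<Sum>\<phi>\<in>\<Phi>. indicator {G. D \<phi> \<subseteq> G} G :: real)"
  define \<mu> where "\<mu> = real (card \<Phi>) * p ^ e"
  have "finite (set_pmf ?M)"
    by (rule finite_subset[OF set_random_subset]) (simp add: I)
  then have int [simp]: "integrable ?M f" for f :: "'a set \<Rightarrow> real"
    by (rule integrable_measure_pmf_finite)
  have \<mu>: "\<mu> > 0" using \<Phi> p by (simp add: \<mu>_def card_gt_0_iff)
  have EX: "?E X = \<mu>"
  proof -
    have "?E X = (\<Sum>\<phi>\<in>\<Phi>. measure_pmf.prob ?M {G. D \<phi> \<subseteq> G})"
      by (simp add: X_def)
    also have "\<dots> = (\<Sum>\<phi>\<in>\<Phi>. p ^ e)"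
      using D p I by (intro sum.cong) (simp_all add: prob_random_subset_contains)
    finally show ?thesis by (simp add: \<mu>_def)
  qed
  have EX2: "?E (\<lambda>G. X G ^ 2) \<le> \<mu> ^ 2 * (1 + \<epsilon>)"
  proof -
    have "?E (\<lambda>G. X G ^ 2) = ?E (\<lambda>G. \<Sum>\<phi>\<in>\<Phi>. \<Sum>\<psi>\<in>\<Phi>. indicator {G. D \<phi> \<union> D \<psi> \<subseteq> G} G)"
      unfolding X_def power2_eq_square sum_product
      by (intro arg_cong[where f = ?E] ext sum.cong refl) (simp add: indicator_def)
    also have "\<dots> = (\<Sum>\<phi>\<in>\<Phi>. \<Sum>\<psi>\<in>\<Phi>. measure_pmf.prob ?M {G. D \<phi> \<union> D \<psi> \<subseteq> G})"
      by simp
    also have "\<dots> = (\<Sum>\<phi>\<in>\<Phi>. \<Sum>\<psi>\<in>\<Phi>. p ^ e * p ^ e * (1 / p) ^ card (D \<phi> \<inter> D \<psi>))"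
    proof (intro sum.cong refl)
      fix \<phi> \<psi> assume \<phi>\<psi>: "\<phi> \<in> \<Phi>" "\<psi> \<in> \<Phi>"
      then have sub: "D \<phi> \<union> D \<psi> \<subseteq> I" and fin: "finite (D \<phi>)" "finite (D \<psi>)"
        using D(1) I finite_subset by blast+
      have "card (D \<phi>) + card (D \<psi>) = card (D \<phi> \<union> D \<psi>) + card (D \<phi> \<inter> D \<psi>)"
        by (rule card_Un_Int[OF fin])
      then have "e + e = card (D \<phi> \<union> D \<psi>) + card (D \<phi> \<inter> D \<psi>)"
        using D(2) \<phi>\<psi> by simp
      then have "p ^ e * p ^ e = p ^ card (D \<phi> \<union> D \<psi>) * p ^ card (D \<phi> \<inter> D \<psi>)"
        by (metis power_add)
      then show "measure_pmf.prob ?M {G. D \<phi> \<union> D \<psi> \<subseteq> G} = p ^ e * p ^ e * (1 / p) ^ card (D \<phi> \<inter> D \<psi>)"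
        using prob_random_subset_contains[OF I sub, of p] p by (simp add: power_divide)
    qed
    also have "\<dots> = (\<Sum>\<phi>\<in>\<Phi>. p ^ e * p ^ e * (\<Sum>\<psi>\<in>\<Phi>. (1 / p) ^ card (D \<phi> \<inter> D \<psi>)))"
      by (simp only: sum_distrib_left)
    also have "\<dots> \<le> (\<Sum>\<phi>\<in>\<Phi>. p ^ e * p ^ e * (real (card \<Phi>) * (1 + \<epsilon>)))"
      using p overlap by (intro sum_mono mult_left_mono) auto
    also have "\<dots> = \<mu> ^ 2 * (1 + \<epsilon>)"
      by (simp add: \<mu>_def power2_eq_square algebra_simps)
    finally show ?thesis .
  qed
  \<comment> \<open>On this event \<open>X\<close> vanishes and so deviates from its mean by
    \<open>\<mu>\<close>.\<close>
  have "\<mu> ^ 2 * measure_pmf.prob ?M {G. \<forall>\<phi>\<in>\<Phi>. \<not> D \<phi> \<subseteq> G}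
      = ?E (\<lambda>G. \<mu> ^ 2 * indicator {G. \<forall>\<phi>\<in>\<Phi>. \<not> D \<phi> \<subseteq> G} G)"
    by simp
  also have "\<dots> \<le> ?E (\<lambda>G. (X G - \<mu>) ^ 2)"
  proof (rule integral_mono)
    fix G
    show "\<mu> ^ 2 * indicator {G. \<forall>\<phi>\<in>\<Phi>. \<not> D \<phi> \<subseteq> G} G \<le> (X G - \<mu>) ^ 2"
    proof (cases "\<forall>\<phi>\<in>\<Phi>. \<not> D \<phi> \<subseteq> G")
      case True
      then have "X G = 0" unfolding X_def by (intro sum.neutral) (simp add: indicator_def)
      then show ?thesis by (simp add: indicator_def)
    next
      case False
      then have "G \<notin> {G. \<forall>\<phi>\<in>\<Phi>. \<not> D \<phi> \<subseteq> G}" by blast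
      then have "indicator {G. \<forall>\<phi>\<in>\<Phi>. \<not> D \<phi> \<subseteq> G} G = (0 :: real)"
        by (rule indicator_simps(2))
      then show ?thesis by simp
    qed
  qed simp_all
  also have "\<dots> = ?E (\<lambda>G. X G ^ 2 - 2 * \<mu> * X G + \<mu> ^ 2)"
    by (simp add: power2_diff algebra_simps)
  also have "\<dots> = ?E (\<lambda>G. X G ^ 2) - 2 * \<mu> * ?E X + \<mu> ^ 2"
    by (simp add: Bochner_Integration.integral_add Bochner_Integration.integral_diff)
  also have "\<dots> \<le> \<mu> ^ 2 * \<epsilon>"
    using EX EX2 by (simp add: algebra_simps power2_eq_square)
  finally show ?thesis using \<mu> by simp
qed

text \<open>Embeddings choose one vertex from each of disjoint parts, so a vertex reveals its node,
  and two embeddings share an edge only where they agree on both ends. The overlap is thus at most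
  \<open>lam\<close> edges per non-root node of agreement, plus one on the diagonal. Working inside
  \<open>K_edges h\<close> leaves all other edges unexposed.\<close>

lemma chain_probability:
  fixes part :: "nat + nat \<Rightarrow> nat set" and p :: real
  assumes rs: "r \<ge> 4" "s \<ge> 3" "s \<le> r" "r \<le> (s - 2)^2 + s"
    and l: "0 < l" and N: "0 < N" and p: "0 < p" "p \<le> 1" and hn: "h \<le> n"
    and disj: "\<And>u v. u \<noteq> v \<Longrightarrow> part u \<inter> part v = {}"
    and roots: "part (Inl 0) = {x}" "part (Inr 0) = {y}"
    and card_part: "\<And>a. 0 < a \<Longrightarrow> card (part (Inl a)) = N" "\<And>b. 0 < b \<Longrightarrow> card (part (Inr b)) = N"
    and range: "\<And>a. a \<le> l * (r - 1) \<Longrightarrow> part (Inl a) \<subseteq> {1..h}" "\<And>b. b \<le> l * (s - 1) \<Longrightarrow> part (Inr b) \<subseteq> {1..h}"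
  defines "q \<equiv> (1 / p) powr lambda_bip r s" and "K \<equiv> l * (r - 1) + l * (s - 1)"
  shows "measure_pmf.prob (random_graph n p)
      {G. {x, y} \<notin> bootstrap_closure (complete_bipartite r s) n (G \<inter> K_edges h)}
    \<le> exp (real K * q / real N) - 1 + (q / real N) ^ K / p"
proof -
  let ?lam = "lambda_bip r s"
  define Nodes where "Nodes = Inl ` {0..l * (r - 1)} \<union> Inr ` {0..l * (s - 1)}"
  define Inner where "Inner = Inl ` {1..l * (r - 1)} \<union> Inr ` {1..l * (s - 1)}"
  define \<Phi> where "\<Phi> = PiE Nodes part"
  define D where "D = (\<lambda>\<phi> :: nat + nat \<Rightarrow> nat. (\<lambda>(a, b). {\<phi> (Inl a), \<phi> (Inr b)}) ` chain_edges r s l)"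
  have lam: "?lam \<ge> 2" using rs lambda_bip_ge_2 by blast
  have finN: "finite Nodes" "finite Inner" by (simp_all add: Nodes_def Inner_def)
  have Inner: "Inner \<subseteq> Nodes" "Nodes = insert (Inl 0) (insert (Inr 0) Inner)" "Inl 0 \<notin> Inner" "Inr 0 \<notin> Inner"
    by (auto simp: Nodes_def Inner_def image_iff)
  have card_Inner: "card Inner = K"
    unfolding Inner_def K_def by (subst card_Un_disjoint) (auto simp: card_image)
  have card_part': "card (part u) = N" if "u \<in> Inner" for u
    using that card_part by (auto simp: Inner_def)
  have part_range: "part u \<subseteq> {1..h}" if uN: "u \<in> Nodes" for u
  proof -
    consider a where "u = Inl a" "a \<le> l * (r - 1)" | b where "u = Inr b" "b \<le> l * (s - 1)"
      using uN by (auto simp: Nodes_def)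
    then show ?thesis by cases (simp_all only: range)
  qed
  have fin_part: "finite (part u)" if "u \<in> Nodes" for u
    using part_range[OF that] finite_subset by blast
  have fin\<Phi>: "finite \<Phi>" unfolding \<Phi>_def using finN fin_part by (intro finite_PiE) auto
  have card\<Phi>: "card \<Phi> = N ^ K"
  proof -
    have "card \<Phi> = (\<Prod>u\<in>Nodes. card (part u))"
      unfolding \<Phi>_def by (rule card_PiE[OF finN(1)])
    also have "\<dots> = (\<Prod>u\<in>Inner. card (part u))"
      unfolding Inner(2) using Inner finN roots by simp
    also have "\<dots> = N ^ K" using card_part' card_Inner by simp
    finally show ?thesis .
  qed
  have ne\<Phi>: "\<Phi> \<noteq> {}" using card\<Phi> N by auto
  have mem: "\<phi> u \<in> part u" if "\<phi> \<in> \<Phi>" "u \<in> Nodes" for \<phi> u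
    using that by (auto simp: \<Phi>_def)
  have node: "u = v" if "\<phi> \<in> \<Phi>" "\<psi> \<in> \<Phi>" "u \<in> Nodes" "v \<in> Nodes" "\<phi> u = \<psi> v" for \<phi> \<psi> u v
    using disj[of u v] mem[OF that(1,3)] mem[OF that(2,4)] that(5) by auto
  have ce: "Inl a \<in> Nodes \<and> Inr b \<in> Nodes" if ab: "(a, b) \<in> chain_edges r s l" for a b
  proof -
    obtain i where "i < l" "a \<in> chain_block r i" "b \<in> chain_block s i"
      using ab unfolding chain_edges_def by blast
    then have "a \<in> {0..l * (r - 1)}" "b \<in> {0..l * (s - 1)}"
      using chain_block_subset by blast+
    then show ?thesis by (simp add: Nodes_def)
  qed
  have pair: "a = a' \<and> b = b' \<and> \<phi> (Inl a) = \<psi> (Inl a) \<and> \<phi> (Inr b) = \<psi> (Inr b)"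
    if \<phi>\<psi>: "\<phi> \<in> \<Phi>" "\<psi> \<in> \<Phi>" and ab: "(a, b) \<in> chain_edges r s l" "(a', b') \<in> chain_edges r s l"
      and eq: "{\<phi> (Inl a), \<phi> (Inr b)} = {\<psi> (Inl a'), \<psi> (Inr b')}" for \<phi> \<psi> a b a' b'
  proof -
    have "\<phi> (Inl a) \<noteq> \<psi> (Inr b')" using node[OF \<phi>\<psi>, of "Inl a" "Inr b'"] ce ab by blast
    then have "\<phi> (Inl a) = \<psi> (Inl a')" "\<phi> (Inr b) = \<psi> (Inr b')"
      using eq by (auto simp: doubleton_eq_iff)
    then show ?thesis
      using node[OF \<phi>\<psi>, of "Inl a" "Inl a'"] node[OF \<phi>\<psi>, of "Inr b" "Inr b'"] ce ab by auto
  qed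
  have cardD: "card (D \<phi>) = card (chain_edges r s l)" if "\<phi> \<in> \<Phi>" for \<phi>
    unfolding D_def
  proof (rule card_image, rule inj_onI)
    fix z z' assume "z \<in> chain_edges r s l" "z' \<in> chain_edges r s l"
      "(case z of (a, b) \<Rightarrow> {\<phi> (Inl a), \<phi> (Inr b)}) = (case z' of (a, b) \<Rightarrow> {\<phi> (Inl a), \<phi> (Inr b)})"
    then show "z = z'"
      using pair[OF that that, of "fst z" "snd z" "fst z'" "snd z'"] by (simp add: case_prod_unfold prod_eq_iff)
  qed
  have Dsub: "D \<phi> \<subseteq> K_edges h" if "\<phi> \<in> \<Phi>" for \<phi>
  proof
    fix d assume "d \<in> D \<phi>"
    then obtain a b where ab: "(a, b) \<in> chain_edges r s l" "d = {\<phi> (Inl a), \<phi> (Inr b)}"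
      by (auto simp: D_def)
    have "\<phi> (Inl a) \<noteq> \<phi> (Inr b)" using node[OF that that, of "Inl a" "Inr b"] ce[OF ab(1)] by blast
    then show "d \<in> K_edges h"
      using mem[OF that, of "Inl a"] mem[OF that, of "Inr b"] part_range ce[OF ab(1)]
      unfolding ab(2) K_edges_iff by blast
  qed
  have infect: "{x, y} \<in> bootstrap_closure (complete_bipartite r s) n (G \<inter> K_edges h)"
    if \<phi>: "\<phi> \<in> \<Phi>" and DG: "D \<phi> \<subseteq> G" for \<phi> G
  proof -
    have L: "Inl a \<in> Nodes" if "a \<in> {0..l * (r - 1)}" for a using that by (simp add: Nodes_def)
    have R: "Inr b \<in> Nodes" if "b \<in> {0..l * (s - 1)}" for b using that by (simp add: Nodes_def)
    have "{\<phi> (Inl 0), \<phi> (Inr 0)} \<in> bootstrap_closure (complete_bipartite r s) n (G \<inter> K_edges h)"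
    proof (rule chain_infects[OF bip_closed_closure _ _ l, where f = "\<lambda>a. \<phi> (Inl a)" and g = "\<lambda>b. \<phi> (Inr b)"])
      show "inj_on (\<lambda>a. \<phi> (Inl a)) {0..l * (r - 1)}"
        using node[OF \<phi> \<phi> L L] by (intro inj_onI) blast
      show "inj_on (\<lambda>b. \<phi> (Inr b)) {0..l * (s - 1)}"
        using node[OF \<phi> \<phi> R R] by (intro inj_onI) blast
      show "(\<lambda>a. \<phi> (Inl a)) ` {0..l * (r - 1)} \<subseteq> {1..n}"
        using mem[OF \<phi> L] part_range[OF L] hn by fastforce
      show "(\<lambda>b. \<phi> (Inr b)) ` {0..l * (s - 1)} \<subseteq> {1..n}"
        using mem[OF \<phi> R] part_range[OF R] hn by fastforce
      show "(\<lambda>a. \<phi> (Inl a)) ` {0..l * (r - 1)} \<inter> (\<lambda>b. \<phi> (Inr b)) ` {0..l * (s - 1)} = {}"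
        using node[OF \<phi> \<phi> L R] by blast
      fix a b assume "(a, b) \<in> chain_edges r s l"
      then have "{\<phi> (Inl a), \<phi> (Inr b)} \<in> D \<phi>" by (force simp: D_def)
      then show "{\<phi> (Inl a), \<phi> (Inr b)} \<in> bootstrap_closure (complete_bipartite r s) n (G \<inter> K_edges h)"
        using DG Dsub[OF \<phi>] subset_closure by blast
    qed (use rs in auto)
    moreover have "\<phi> (Inl 0) = x" "\<phi> (Inr 0) = y"
      using mem[OF \<phi>, of "Inl 0"] mem[OF \<phi>, of "Inr 0"] roots by (simp_all add: Nodes_def)
    ultimately show ?thesis by simp
  qed
  have q: "q \<ge> 1" unfolding q_def using p lam by (intro ge_one_powr_ge_zero) auto
  have overlap: "(\<Sum>\<psi>\<in>\<Phi>. (1 / p) ^ card (D \<phi> \<inter> D \<psi>))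
      \<le> real (card \<Phi>) * (1 + (exp (real K * q / real N) - 1 + (q / real N) ^ K / p))" if \<phi>: "\<phi> \<in> \<Phi>" for \<phi>
  proof -
    text \<open>Up to the term for \<open>\<psi> = \<phi>\<close> the overlap is bounded by a product over the nodes, so the sum over all
      embeddings factorises.\<close>
    let ?w = "\<lambda>u v. if u \<in> Inner \<and> \<phi> u = v then q else 1"
    have summand: "(1 / p) ^ card (D \<phi> \<inter> D \<psi>) \<le> (\<Prod>u\<in>Nodes. ?w u (\<psi> u)) + (if \<psi> = \<phi> then q ^ K / p else 0)"
      if \<psi>: "\<psi> \<in> \<Phi>" for \<psi>
    proof -
      define S T where "S = {a \<in> {0..l * (r - 1)}. \<phi> (Inl a) = \<psi> (Inl a)}"
        and "T = {b \<in> {0..l * (s - 1)}. \<phi> (Inr b) = \<psi> (Inr b)}"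
      define A where "A = {u \<in> Inner. \<phi> u = \<psi> u}"
      have "D \<phi> \<inter> D \<psi> \<subseteq> (\<lambda>(a, b). {\<phi> (Inl a), \<phi> (Inr b)}) ` (chain_edges r s l \<inter> S \<times> T)"
      proof
        fix d assume "d \<in> D \<phi> \<inter> D \<psi>"
        then obtain a b a' b' where ab: "(a, b) \<in> chain_edges r s l" "d = {\<phi> (Inl a), \<phi> (Inr b)}"
          "(a', b') \<in> chain_edges r s l" "d = {\<psi> (Inl a'), \<psi> (Inr b')}"
          by (auto simp: D_def)
        have "{\<phi> (Inl a), \<phi> (Inr b)} = {\<psi> (Inl a'), \<psi> (Inr b')}" using ab(2,4) by simp
        then have "\<phi> (Inl a) = \<psi> (Inl a) \<and> \<phi> (Inr b) = \<psi> (Inr b)"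
          using pair[OF \<phi> \<psi> ab(1,3)] by blast
        then have "(a, b) \<in> chain_edges r s l \<inter> S \<times> T"
          using ce[OF ab(1)] ab(1) by (auto simp: S_def T_def Nodes_def)
        then show "d \<in> (\<lambda>(a, b). {\<phi> (Inl a), \<phi> (Inr b)}) ` (chain_edges r s l \<inter> S \<times> T)"
          using ab(2) by force
      qed
      then have "card (D \<phi> \<inter> D \<psi>) \<le> card (chain_edges r s l \<inter> S \<times> T)"
        by (rule surj_card_le[rotated]) simp
      moreover have zero: "0 \<in> S" "0 \<in> T"
        using mem[OF \<phi>, of "Inl 0"] mem[OF \<phi>, of "Inr 0"] mem[OF \<psi>, of "Inl 0"] mem[OF \<psi>, of "Inr 0"] roots
        by (simp_all add: Nodes_def S_def T_def)
      moreover have "real (card (chain_edges r s l \<inter> S \<times> T)) \<le> ?lam * (real (card S) + real (card T) - 2) +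
          of_bool ((S, T) = ({0..l * (r - 1)}, {0..l * (s - 1)}))"
        using zero by (intro card_chain_edges_le[OF rs]) (auto simp: S_def T_def)
      ultimately have card_le: "real (card (D \<phi> \<inter> D \<psi>)) \<le> ?lam * (real (card S) + real (card T) - 2) +
          of_bool ((S, T) = ({0..l * (r - 1)}, {0..l * (s - 1)}))"
        by linarith
      have full: "\<psi> = \<phi>" if ST: "(S, T) = ({0..l * (r - 1)}, {0..l * (s - 1)})"
      proof (rule PiE_ext)
        show "\<psi> \<in> PiE Nodes part" "\<phi> \<in> PiE Nodes part" using \<phi> \<psi> by (simp_all add: \<Phi>_def)
        fix u assume "u \<in> Nodes"
        then consider a where "u = Inl a" "a \<in> S" | b where "u = Inr b" "b \<in> T"
          using ST by (auto simp: Nodes_def)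
        then show "\<psi> u = \<phi> u" by cases (auto simp: S_def T_def)
      qed
      have cardA: "real (card A) = real (card S) + real (card T) - 2"
      proof -
        have A: "A = Inl ` (S - {0}) \<union> Inr ` (T - {0})"
          by (auto simp: A_def Inner_def S_def T_def image_iff)
        have fin: "finite S" "finite T" by (simp_all add: S_def T_def)
        then have "card A = (card S - 1) + (card T - 1)"
          unfolding A using zero by (subst card_Un_disjoint) (auto simp: card_image)
        moreover have "card S \<ge> 1" "card T \<ge> 1" using zero fin by (auto simp: Suc_le_eq card_gt_0_iff)
        ultimately show ?thesis by simp
      qed
      have "(1 / p) ^ card (D \<phi> \<inter> D \<psi>) = (1 / p) powr real (card (D \<phi> \<inter> D \<psi>))"
        using p by (simp add: powr_realpow)
      also have "\<dots> \<le> (1 / p) powr (?lam * real (card A) + of_bool (\<psi> = \<phi>))"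
      proof (rule powr_mono)
        have "of_bool ((S, T) = ({0..l * (r - 1)}, {0..l * (s - 1)})) \<le> (of_bool (\<psi> = \<phi>) :: real)"
          using full by auto
        then show "real (card (D \<phi> \<inter> D \<psi>)) \<le> ?lam * real (card A) + of_bool (\<psi> = \<phi>)"
          unfolding cardA using card_le by linarith
      qed (use p in simp)
      also have "\<dots> = q ^ card A * (if \<psi> = \<phi> then 1 / p else 1)"
        using p by (simp add: powr_add q_def powr_powr[symmetric] powr_realpow)
      \<comment> \<open>Off the diagonal the second summand vanishes; on it
        \<open>card A = K\<close>, and \<open>q ^ K / p\<close> alone suffices.\<close>
      also have "\<dots> \<le> q ^ card A + (if \<psi> = \<phi> then q ^ K / p else 0)"
      proof (cases "\<psi> = \<phi>")
        case True
        then have "card A = K" by (simp add: A_def card_Inner)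
        then show ?thesis using True q by simp
      qed simp
      also have "q ^ card A = (\<Prod>u\<in>Nodes. ?w u (\<psi> u))"
      proof -
        have "{u \<in> Nodes. u \<in> Inner \<and> \<phi> u = \<psi> u} = A" using Inner(1) by (auto simp: A_def)
        then show ?thesis using finN(1) by (simp add: prod.If_cases Int_def)
      qed
      finally show ?thesis .
    qed
    have "(\<Sum>\<psi>\<in>\<Phi>. (1 / p) ^ card (D \<phi> \<inter> D \<psi>))
        \<le> (\<Sum>\<psi>\<in>\<Phi>. (\<Prod>u\<in>Nodes. ?w u (\<psi> u)) + (if \<psi> = \<phi> then q ^ K / p else 0))"
      by (intro sum_mono summand)
    also have "\<dots> = (\<Sum>\<psi>\<in>\<Phi>. \<Prod>u\<in>Nodes. ?w u (\<psi> u)) + q ^ K / p"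
      using \<phi> fin\<Phi> by (simp add: sum.distrib)
    also have "(\<Sum>\<psi>\<in>\<Phi>. \<Prod>u\<in>Nodes. ?w u (\<psi> u)) = (\<Prod>u\<in>Nodes. \<Sum>v\<in>part u. ?w u v)"
      unfolding \<Phi>_def by (rule prod_sum_PiE[symmetric]) (use finN fin_part in auto)
    also have "\<dots> = (\<Prod>u\<in>Inner. \<Sum>v\<in>part u. ?w u v)"
      unfolding Inner(2) using Inner finN roots by simp
    \<comment> \<open>One vertex of the part agrees with \<open>\<phi>\<close> and has weight
      \<open>q\<close>; the other \<open>N - 1\<close> have weight 1.\<close>
    also have "\<dots> = (\<Prod>u\<in>Inner. real N - 1 + q)"
    proof (intro prod.cong refl)
      fix u assume u: "u \<in> Inner"
      then have "\<phi> u \<in> part u" "finite (part u)" using mem[OF \<phi>] fin_part Inner(1) by auto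
      have "(\<Sum>v\<in>part u. ?w u v) = (\<Sum>v\<in>part u. 1 + (if v = \<phi> u then q - 1 else 0))"
        using u by (intro sum.cong) auto
      also have "\<dots> = real N - 1 + q"
        using \<open>\<phi> u \<in> part u\<close> \<open>finite (part u)\<close> card_part'[OF u] by (simp add: sum.distrib)
      finally show "(\<Sum>v\<in>part u. ?w u v) = real N - 1 + q" .
    qed
    also have "\<dots> = (real N - 1 + q) ^ K" by (simp add: card_Inner)
    also have "\<dots> \<le> (real N * exp (q / real N)) ^ K"
    proof (rule power_mono)
      have "real N - 1 + q \<le> real N * (1 + q / real N)" using N by (simp add: field_simps)
      also have "\<dots> \<le> real N * exp (q / real N)"
        by (intro mult_left_mono) auto
      finally show "real N - 1 + q \<le> real N * exp (q / real N)" .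
      show "0 \<le> real N - 1 + q" using q by simp
    qed
    also have "\<dots> = real (card \<Phi>) * exp (real K * q / real N)"
      by (simp add: power_mult_distrib card\<Phi> exp_of_nat_mult[symmetric])
    finally have "(\<Sum>\<psi>\<in>\<Phi>. (1 / p) ^ card (D \<phi> \<inter> D \<psi>)) \<le> real (card \<Phi>) * exp (real K * q / real N) + q ^ K / p"
      by simp
    also have "q ^ K / p = real (card \<Phi>) * ((q / real N) ^ K / p)"
      using N by (simp add: card\<Phi> power_divide)
    finally show ?thesis by (simp add: algebra_simps)
  qed
  have "measure_pmf.prob (random_graph n p)
      {G. {x, y} \<notin> bootstrap_closure (complete_bipartite r s) n (G \<inter> K_edges h)}
    \<le> measure_pmf.prob (random_graph n p) {G. \<forall>\<phi>\<in>\<Phi>. \<not> D \<phi> \<subseteq> G}"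
    unfolding random_graph_eq using infect by (intro prob_random_subset_mono) blast
  also have "\<dots> \<le> exp (real K * q / real N) - 1 + (q / real N) ^ K / p"
    unfolding random_graph_eq
  proof (rule second_moment[OF finite_K_edges fin\<Phi> ne\<Phi> _ cardD p overlap])
    show "D \<phi> \<subseteq> K_edges n" if "\<phi> \<in> \<Phi>" for \<phi>
      using Dsub[OF that] K_edges_mono[OF hn] by blast
  qed
  finally show ?thesis .
qed

section \<open>Growing a clique\<close>

definition clique_in :: "'a set set \<Rightarrow> 'a set \<Rightarrow> bool" where
  "clique_in C Q \<longleftrightarrow> (\<forall>u\<in>Q. \<forall>v\<in>Q. u \<noteq> v \<longrightarrow> {u, v} \<in> C)"

lemma clique_inD: "clique_in C Q \<Longrightarrow> u \<in> Q \<Longrightarrow> v \<in> Q \<Longrightarrow> u \<noteq> v \<Longrightarrow> {u, v} \<in> C"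
  by (simp add: clique_in_def)

lemma clique_in_subset: "clique_in C Q \<Longrightarrow> Q' \<subseteq> Q \<Longrightarrow> clique_in C Q'"
  by (auto simp: clique_in_def)

lemma clique_in_insert:
  assumes "clique_in C Q" "\<And>v. v \<in> Q \<Longrightarrow> v \<noteq> w \<Longrightarrow> {w, v} \<in> C"
  shows "clique_in C (insert w Q)"
  unfolding clique_in_def
proof (intro ballI impI)
  fix u v assume "u \<in> insert w Q" "v \<in> insert w Q" "u \<noteq> v"
  then consider "u = w" "v \<in> Q" "v \<noteq> w" | "v = w" "u \<in> Q" "u \<noteq> w" | "u \<in> Q" "v \<in> Q" "u \<noteq> v" by blast
  then show "{u, v} \<in> C"
    using assms(2)[of v] assms(2)[of u] clique_inD[OF assms(1)] by cases (simp_all add: insert_commute)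
qed

text \<open>The common neighbours can be divided arbitrarily, since they form a clique:
  \<open>r - 1\<close> of them join \<open>u\<close> on one side, \<open>s - 1\<close> join
  \<open>v\<close> on the other, and \<open>{u, v}\<close> is the only pair that may be
  missing.\<close>

lemma infect_via_clique:
  assumes C: "bip_closed r s n C" and rs: "1 \<le> r" "1 \<le> s"
    and W: "W \<subseteq> {1..n}" "card W = r + s - 2" "clique_in C W"
    and uv: "u \<in> {1..n}" "v \<in> {1..n}" "u \<noteq> v" "u \<notin> W" "v \<notin> W"
    and adj: "\<And>w. w \<in> W \<Longrightarrow> {u, w} \<in> C" "\<And>w. w \<in> W \<Longrightarrow> {v, w} \<in> C"
  shows "{u, v} \<in> C"
proof -
  have finW: "finite W" using W(1) finite_subset by blast
  have "r - 1 \<le> card W" using W(2) rs by simp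
  then obtain A where A: "A \<subseteq> W" "card A = r - 1"
    using obtain_subset_with_card_n by metis
  define B where "B = W - A"
  have finA: "finite A" using A finW finite_subset by blast
  have B: "B \<subseteq> W" "card B = s - 1" "A \<inter> B = {}"
    unfolding B_def using A W(2) rs card_Diff_subset[OF finA A(1)] by auto
  show ?thesis
  proof (rule bip_closedD[OF C, of "insert u A" "insert v B"])
    show "insert u A \<union> insert v B \<subseteq> {1..n}" using A B W uv by blast
    show "insert u A \<inter> insert v B = {}" using A B uv by blast
    have "u \<notin> A" "v \<notin> B" using A B uv by blast+
    moreover have "finite B" using finW B(1) finite_subset by blast
    ultimately show "card (insert u A) = r" "card (insert v B) = s" using A B rs finA by simp_all
    show "biclique (insert u A) (insert v B) - {{u, v}} \<subseteq> C"
    proof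
      fix e assume e: "e \<in> biclique (insert u A) (insert v B) - {{u, v}}"
      then obtain a b where ab: "a \<in> insert u A" "b \<in> insert v B" "e = {a, b}"
        using bicliqueE by blast
      then consider "a = u" "b = v" | "a = u" "b \<in> B" | "a \<in> A" "b = v" | "a \<in> A" "b \<in> B" by blast
      then show "e \<in> C"
      proof cases
        case 1
        then show ?thesis using e ab by simp
      next
        case 2
        then show ?thesis using adj(1) B ab by blast
      next
        case 3
        then have "{v, a} \<in> C" using adj(2) A by blast
        then show ?thesis using 3 ab by (simp add: insert_commute)
      next
        case 4
        then show ?thesis using clique_inD[OF W(3), of a b] A(1) B(1,3) ab(3) by blast
      qed
    qed
  qed simp_all
qed

text \<open>Let \<open>m = card R\<close>, \<open>t = r + s\<close>, and let \<open>Q\<close> be the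
  vertices with fewer than \<open>m / (4 t)\<close> missing pairs. By averaging these are at least
  half of \<open>R\<close>, and fewer than \<open>t\<close> of them rule out less than
  \<open>m / 4 + m / 4 \<le> card Q\<close> vertices as common neighbours. So a clique in the common
  neighbourhood of two vertices of \<open>Q\<close> can be built greedily.\<close>

lemma dense_core:
  assumes C: "bip_closed r s n C" and rs: "1 \<le> r" "1 \<le> s" and R: "R \<subseteq> {1..n}"
    and big: "4 * (r + s) \<le> card R"
    and few: "8 * real (r + s) * real (card {z \<in> R \<times> R. fst z \<noteq> snd z \<and> {fst z, snd z} \<notin> C}) \<le> real (card R) ^ 2"
  shows "\<exists>Q\<subseteq>R. card R \<le> 2 * card Q \<and> clique_in C Q"
proof -
  define m t where "m = real (card R)" and "t = real (r + s)"
  have t: "t > 0" using rs by (simp add: t_def)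
  have m: "m \<ge> 4 * t" using of_nat_mono[OF big, where 'a = real] by (simp add: m_def t_def)
  have finR: "finite R" using R finite_subset by blast
  define bad where "bad = (\<lambda>x. {y \<in> R. x \<noteq> y \<and> {x, y} \<notin> C})"
  define Q where "Q = {x \<in> R. 4 * t * real (card (bad x)) < m}"
  have finbad: "finite (bad x)" for x using finR by (simp add: bad_def)
  have QR: "Q \<subseteq> R" by (auto simp: Q_def)
  have finQ: "finite Q" using QR finR finite_subset by blast
  have "(\<Sum>x\<in>R. real (card (bad x))) = real (card {z \<in> R \<times> R. fst z \<noteq> snd z \<and> {fst z, snd z} \<notin> C})"
  proof -
    have "{z \<in> R \<times> R. fst z \<noteq> snd z \<and> {fst z, snd z} \<notin> C} = Sigma R bad"
      by (auto simp: bad_def)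
    then show ?thesis using finR finbad by (simp add: card_SigmaI)
  qed
  then have total: "8 * t * (\<Sum>x\<in>R. real (card (bad x))) \<le> m ^ 2"
    using few by (simp add: m_def t_def)
  have "real (card (R - Q)) * m = (\<Sum>x\<in>R - Q. m)" by simp
  also have "\<dots> \<le> (\<Sum>x\<in>R - Q. 4 * t * real (card (bad x)))"
    by (intro sum_mono) (auto simp: Q_def)
  also have "\<dots> \<le> (\<Sum>x\<in>R. 4 * t * real (card (bad x)))"
    using finR t by (intro sum_mono2) auto
  also have "\<dots> = 4 * t * (\<Sum>x\<in>R. real (card (bad x)))" by (simp add: sum_distrib_left)
  also have "\<dots> \<le> m * (m / 2)" using total by (simp add: power2_eq_square)
  finally have "m * real (card (R - Q)) \<le> m * (m / 2)" by (simp add: mult.commute)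
  then have "real (card (R - Q)) \<le> m / 2"
    using m t by (subst (asm) mult_le_cancel_left_pos) auto
  moreover have "card (R - Q) = card R - card Q" "card Q \<le> card R"
    using QR finR finQ by (simp_all add: card_Diff_subset card_mono)
  ultimately have cardQ: "m \<le> 2 * real (card Q)" by (simp add: m_def of_nat_diff)
  have ext: "\<exists>w\<in>Q - T. \<forall>x\<in>T. {x, w} \<in> C" if T: "T \<subseteq> Q" "card T < r + s" for T
  proof -
    have finT: "finite T" using T finQ finite_subset by blast
    have "card (T \<union> (\<Union>x\<in>T. bad x)) \<le> card T + (\<Sum>x\<in>T. card (bad x))"
      using card_Un_le[of T "\<Union>x\<in>T. bad x"] card_UN_le[OF finT, of bad] by linarith
    then have "real (card (T \<union> (\<Union>x\<in>T. bad x))) \<le> real (card T) + (\<Sum>x\<in>T. real (card (bad x)))"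
      by (metis of_nat_add of_nat_mono of_nat_sum)
    also have "(\<Sum>x\<in>T. real (card (bad x))) \<le> (\<Sum>x\<in>T. m / (4 * t))"
      using T(1) t by (intro sum_mono) (auto simp: Q_def field_simps)
    also have "\<dots> = real (card T) * (m / (4 * t))" by simp
    also have "real (card T) * (m / (4 * t)) \<le> t * (m / (4 * t))"
      using T(2) t m by (intro mult_right_mono) (auto simp: t_def)
    also have "real (card T) + t * (m / (4 * t)) < m / 2"
    proof -
      have "t * (m / (4 * t)) = m / 4" using t by simp
      moreover have "real (card T) < t" unfolding t_def using T(2) by (rule of_nat_less_iff[THEN iffD2])
      ultimately show ?thesis using m by linarith
    qed
    finally have "card (T \<union> (\<Union>x\<in>T. bad x)) < card Q" using cardQ by linarith
    then have "\<not> Q \<subseteq> T \<union> (\<Union>x\<in>T. bad x)"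
      using finT finbad card_mono[of "T \<union> (\<Union>x\<in>T. bad x)" Q] by auto
    then obtain w where w: "w \<in> Q" "w \<notin> T" "\<And>x. x \<in> T \<Longrightarrow> w \<notin> bad x" by blast
    then have "\<forall>x\<in>T. {x, w} \<in> C"
      using QR by (auto simp: bad_def)
    then show ?thesis using w by blast
  qed
  have "clique_in C Q"
    unfolding clique_in_def
  proof (intro ballI impI)
    fix u v assume uv: "u \<in> Q" "v \<in> Q" "u \<noteq> v"
    \<comment> \<open>Each new vertex must be adjacent to \<open>u\<close> and \<open>v\<close> as
      well, which is why \<open>ext\<close> has to handle sets of up to \<open>r + s - 1\<close>
      vertices.\<close>
    have "\<exists>W\<subseteq>Q - {u, v}. card W = k \<and> clique_in C W \<and> (\<forall>w\<in>W. {u, w} \<in> C \<and> {v, w} \<in> C)"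
      if "k \<le> r + s - 2" for k
      using that
    proof (induction k)
      case 0
      then show ?case by (intro exI[of _ "{}"]) (simp add: clique_in_def)
    next
      case (Suc k)
      then obtain W where W: "W \<subseteq> Q - {u, v}" "card W = k" "clique_in C W"
        "\<forall>w\<in>W. {u, w} \<in> C \<and> {v, w} \<in> C" by auto
      have finW: "finite W" using W(1) finQ finite_subset by blast
      have "card (insert u (insert v W)) \<le> k + 2"
        using finW W(2) by (simp add: card_insert_if)
      then have "card (insert u (insert v W)) < r + s" using Suc.prems by linarith
      moreover have "insert u (insert v W) \<subseteq> Q" using W(1) uv by blast
      ultimately obtain w where w: "w \<in> Q - insert u (insert v W)" "\<forall>x\<in>insert u (insert v W). {x, w} \<in> C"
        using ext by blast
      have "clique_in C (insert w W)"
        using W(3) w(2) by (intro clique_in_insert) (auto simp: insert_commute)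
      then show ?case
        using W w finW by (intro exI[of _ "insert w W"]) auto
    qed
    from this[of "r + s - 2"] obtain W where W: "W \<subseteq> Q - {u, v}" "card W = r + s - 2" "clique_in C W"
      "\<forall>w\<in>W. {u, w} \<in> C \<and> {v, w} \<in> C" by blast
    show "{u, v} \<in> C"
    proof (rule infect_via_clique[OF C rs _ W(2,3)])
      show "W \<subseteq> {1..n}" "u \<in> {1..n}" "v \<in> {1..n}" "u \<noteq> v" "u \<notin> W" "v \<notin> W"
        using W(1) QR R uv by blast+
    qed (use W(4) in blast)+
  qed
  moreover have "card R \<le> 2 * card Q" using cardQ by (simp add: m_def)
  ultimately show ?thesis using QR by blast
qed

text \<open>For \<open>v\<close> in the clique, \<open>s - 1\<close> neighbours of \<open>w\<close>
  together with \<open>v\<close> form one side, \<open>w\<close> with \<open>r - 1\<close> other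
  clique vertices the other, and only \<open>{w, v}\<close> can be missing.\<close>

lemma clique_extend_vertex:
  assumes C: "bip_closed r s n C" and rs: "1 \<le> r" "1 \<le> s"
    and Q: "Q \<subseteq> {1..n}" "clique_in C Q" "r + s \<le> card Q"
    and w: "w \<in> {1..n}" "s - 1 \<le> card {z \<in> Q. {w, z} \<in> C}"
  shows "clique_in C (insert w Q)"
proof (rule clique_in_insert[OF Q(2)])
  fix v assume v: "v \<in> Q" "v \<noteq> w"
  have finQ: "finite Q" using Q(1) finite_subset by blast
  show "{w, v} \<in> C"
  proof (rule ccontr)
    assume wv: "{w, v} \<notin> C"
    have "w \<notin> Q" using clique_inD[OF Q(2), of w v] v wv by blast
    obtain B where B: "B \<subseteq> {z \<in> Q. {w, z} \<in> C}" "card B = s - 1" "finite B"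
      using obtain_subset_with_card_n[OF w(2)] by metis
    have "v \<notin> B" using B(1) wv by blast
    have "card (insert v B) = s" using B \<open>v \<notin> B\<close> rs by simp
    have sub: "insert v B \<subseteq> Q" using B(1) v(1) by blast
    have "r - 1 \<le> card (Q - insert v B)"
      using card_Diff_subset[OF _ sub] B(3) \<open>card (insert v B) = s\<close> Q(3) by simp
    then obtain A where A: "A \<subseteq> Q - insert v B" "card A = r - 1" "finite A"
      using obtain_subset_with_card_n by metis
    have "w \<notin> A" using A(1) \<open>w \<notin> Q\<close> by blast
    have "{w, v} \<in> C"
    proof (rule bip_closedD[OF C, of "insert w A" "insert v B"])
      show "insert w A \<union> insert v B \<subseteq> {1..n}" using A(1) sub Q(1) w(1) by blast
      show "insert w A \<inter> insert v B = {}" using A(1) sub \<open>w \<notin> Q\<close> by blast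
      show "card (insert w A) = r" using A \<open>w \<notin> A\<close> rs by simp
      show "card (insert v B) = s" by fact
      show "biclique (insert w A) (insert v B) - {{w, v}} \<subseteq> C"
      proof
        fix e assume e: "e \<in> biclique (insert w A) (insert v B) - {{w, v}}"
        then obtain a b where ab: "a \<in> insert w A" "b \<in> insert v B" "e = {a, b}"
          using bicliqueE by blast
        show "e \<in> C"
        proof (cases "a = w")
          case True
          then have "b \<in> B" using e ab by auto
          then show ?thesis using B(1) True ab(3) by blast
        next
          case False
          then have "a \<in> A" using ab(1) by blast
          then have "a \<in> Q" "b \<in> Q" "a \<noteq> b" using A(1) sub ab(2) by blast+
          then show ?thesis using clique_inD[OF Q(2)] ab(3) by blast
        qed
      qed
    qed simp_all
    then show False using wv by blast
  qed
qed

lemma clique_extend: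
  assumes C: "bip_closed r s n C" and rs: "1 \<le> r" "1 \<le> s"
    and Q: "Q \<subseteq> {1..n}" "clique_in C Q" "r + s \<le> card Q"
    and W: "W \<subseteq> {1..n}" "\<And>w. w \<in> W \<Longrightarrow> s - 1 \<le> card {z \<in> Q. {w, z} \<in> C}"
  shows "clique_in C (W \<union> Q)"
proof -
  have "finite W" using W(1) finite_subset by blast
  then show ?thesis
    using W
  proof (induction W)
    case empty
    then show ?case using Q by simp
  next
    case (insert w W)
    have fin: "finite (W \<union> Q)" using insert Q(1) finite_subset by blast
    have sub: "W \<union> Q \<subseteq> {1..n}" using insert.prems(1) Q(1) by blast
    have "clique_in C (insert w (W \<union> Q))"
    proof (rule clique_extend_vertex[OF C rs sub])
      show "clique_in C (W \<union> Q)" using insert.IH insert.prems by blast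
      show "r + s \<le> card (W \<union> Q)" using Q(3) card_mono[OF fin, of Q] by simp
      show "w \<in> {1..n}" using insert.prems(1) by blast
      have "card {z \<in> Q. {w, z} \<in> C} \<le> card {z \<in> W \<union> Q. {w, z} \<in> C}"
        using fin by (intro card_mono) auto
      then show "s - 1 \<le> card {z \<in> W \<union> Q. {w, z} \<in> C}"
        using insert.prems(2)[of w] by simp
    qed
    then show ?case by simp
  qed
qed

text \<open>If at most \<open>k\<close> neighbours are seen, some \<open>J\<close> of size exactly
  \<open>k\<close> contains them all, and \<open>w\<close> has no edge to the rest of
  \<open>T\<close>. In the application \<open>E\<close> is the set of unexposed edges.\<close>

lemma prob_few_neighbours:
  assumes T: "T \<subseteq> {1..n}" and w: "w \<in> {1..n}" "w \<notin> T" and p: "0 \<le> p" "p \<le> 1"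
    and k: "k \<le> card T" and E: "(\<lambda>z. {w, z}) ` T \<subseteq> E"
  shows "measure_pmf.prob (random_graph n p) {G. card {z \<in> T. {w, z} \<in> G \<inter> E} \<le> k}
    \<le> real n ^ k * exp (- p * (real (card T) - real k))"
proof -
  have finT: "finite T" using T finite_subset by blast
  let ?J = "{J. J \<subseteq> T \<and> card J = k}"
  let ?D = "\<lambda>J. (\<lambda>z. {w, z}) ` (T - J)"
  have finJ: "finite ?J" using finT by simp
  have sub: "?D J \<subseteq> K_edges n" for J using T w by (auto simp: K_edges_iff)
  have cardD: "card (?D J) = card T - k" if "J \<in> ?J" for J
  proof -
    have "inj_on (\<lambda>z. {w, z}) (T - J)" by (auto simp: inj_on_def doubleton_eq_iff)
    then show ?thesis using that finT finite_subset[of J T] by (simp add: card_image card_Diff_subset)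
  qed
  have "measure_pmf.prob (random_graph n p) {G. card {z \<in> T. {w, z} \<in> G \<inter> E} \<le> k}
      \<le> measure_pmf.prob (random_graph n p) {G. \<exists>J\<in>?J. ?D J \<inter> G = {}}"
    unfolding random_graph_eq
  proof (rule prob_random_subset_mono)
    fix G assume "card {z \<in> T. {w, z} \<in> G \<inter> E} \<le> k"
    then obtain J where "{z \<in> T. {w, z} \<in> G \<inter> E} \<subseteq> J" "J \<subseteq> T" "card J = k"
      using exists_subset_between[of "{z \<in> T. {w, z} \<in> G \<inter> E}" k T] k finT by auto
    then show "\<exists>J\<in>?J. ?D J \<inter> G = {}" using E by (intro bexI[of _ J]) auto
  qed
  also have "\<dots> \<le> (\<Sum>J\<in>?J. measure_pmf.prob (random_graph n p) {G. ?D J \<inter> G = {}})"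
    by (rule prob_Ex_le[OF finJ])
  also have "\<dots> = (\<Sum>J\<in>?J. (1 - p) ^ (card T - k))"
    unfolding random_graph_eq
    by (intro sum.cong refl) (simp only: prob_random_subset_avoids[OF finite_K_edges sub p] cardD)
  also have "\<dots> = real (card T choose k) * (1 - p) ^ (card T - k)"
    using finT by (simp add: n_subsets)
  also have "\<dots> \<le> real n ^ k * exp (- p * (real (card T) - real k))"
  proof (rule mult_mono)
    have "card T choose k \<le> card T ^ k" using k by (rule binomial_le_pow)
    also have "\<dots> \<le> n ^ k" using card_mono[OF _ T] by (intro power_mono) auto
    finally show "real (card T choose k) \<le> real n ^ k" by (metis of_nat_mono of_nat_power)
    have "(1 - p) ^ (card T - k) \<le> exp (- p) ^ (card T - k)"
      using p exp_ge_add_one_self[of "- p"] by (intro power_mono) auto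
    also have "\<dots> = exp (- p * (real (card T) - real k))"
      using k by (simp add: exp_of_nat_mult[symmetric] of_nat_diff mult.commute)
    finally show "(1 - p) ^ (card T - k) \<le> exp (- p * (real (card T) - real k))" .
  qed (use p in auto)
  finally show ?thesis .
qed

section \<open>The upper bound\<close>

lemma prob_many_le:
  assumes I: "finite I" and S: "finite S" and \<epsilon>: "\<And>z. z \<in> S \<Longrightarrow> measure_pmf.prob (random_subset I p) {G. P z G} \<le> \<epsilon>"
    and a: "0 < a"
  shows "measure_pmf.prob (random_subset I p) {G. a \<le> real (card {z \<in> S. P z G})} \<le> real (card S) * \<epsilon> / a"
proof -
  let ?M = "random_subset I p"
  let ?E = "measure_pmf.expectation ?M"
  have "finite (set_pmf ?M)"
    by (rule finite_subset[OF set_random_subset]) (simp add: I)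
  then have int [simp]: "integrable ?M f" for f :: "'a set \<Rightarrow> real"
    by (rule integrable_measure_pmf_finite)
  have "a * measure_pmf.prob ?M {G. a \<le> real (card {z \<in> S. P z G})}
      = ?E (\<lambda>G. a * indicator {G. a \<le> real (card {z \<in> S. P z G})} G)"
    by simp
  also have "\<dots> \<le> ?E (\<lambda>G. \<Sum>z\<in>S. indicator {G. P z G} G)"
  proof (rule integral_mono)
    fix G
    have "(\<Sum>z\<in>S. indicator {G. P z G} G) = real (card {z \<in> S. P z G})"
      using S by (simp add: indicator_def sum.If_cases Int_def)
    then show "a * indicator {G. a \<le> real (card {z \<in> S. P z G})} G \<le> (\<Sum>z\<in>S. indicator {G. P z G} G)"
      by (simp add: indicator_def)
  qed simp_all
  also have "\<dots> = (\<Sum>z\<in>S. measure_pmf.prob ?M {G. P z G})" by simp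
  also have "\<dots> \<le> (\<Sum>z\<in>S. \<epsilon>)" by (intro sum_mono \<epsilon>)
  finally show ?thesis using a by (simp add: field_simps)
qed

text \<open>\<open>X\<close> is read off the exposed edges and \<open>B Q\<close> is tested on the
  others. Summing over the values of \<open>X\<close> costs nothing because the events
  \<open>X = Q\<close> are disjoint, even if \<open>\<Q>\<close> is exponentially large.\<close>

lemma prob_random_subset_conditional:
  assumes I: "finite I" "S \<subseteq> I" and \<Q>: "finite \<Q>" and \<eta>: "0 \<le> \<eta>"
    and B: "\<And>Q. Q \<in> \<Q> \<Longrightarrow> measure_pmf.prob (random_subset I p) {G. B Q (G - S)} \<le> \<eta>"
  shows "measure_pmf.prob (random_subset I p) {G. X (G \<inter> S) \<in> \<Q> \<and> B (X (G \<inter> S)) (G - S)} \<le> \<eta>"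
proof -
  let ?pr = "measure_pmf.prob (random_subset I p)"
  have "?pr {G. X (G \<inter> S) \<in> \<Q> \<and> B (X (G \<inter> S)) (G - S)} \<le> ?pr {G. \<exists>Q\<in>\<Q>. X (G \<inter> S) = Q \<and> B Q (G - S)}"
    by (rule measure_pmf.finite_measure_mono) auto
  also have "\<dots> \<le> (\<Sum>Q\<in>\<Q>. ?pr {G. X (G \<inter> S) = Q \<and> B Q (G - S)})"
    by (rule prob_Ex_le[OF \<Q>])
  also have "\<dots> = (\<Sum>Q\<in>\<Q>. ?pr {G. X (G \<inter> S) = Q} * ?pr {G. B Q (G - S)})"
    by (intro sum.cong refl) (rule prob_random_subset_indep[OF I])
  also have "\<dots> \<le> (\<Sum>Q\<in>\<Q>. ?pr {G. X (G \<inter> S) = Q} * \<eta>)"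
    by (intro sum_mono mult_left_mono B) auto
  also have "\<dots> = ?pr (\<Union>Q\<in>\<Q>. {G. X (G \<inter> S) = Q}) * \<eta>"
    unfolding sum_distrib_right[symmetric]
    by (subst measure_pmf.finite_measure_finite_Union) (auto simp: \<Q> disjoint_family_on_def)
  also have "\<dots> \<le> 1 * \<eta>"
    by (intro mult_right_mono \<eta> measure_pmf.prob_le_1)
  finally show ?thesis by simp
qed

text \<open>The first quarter \<open>R\<close> of the vertices provides the roots, the second
  quarter the inner vertices of the chains, and every edge meeting the upper half \<open>U\<close>
  stays unexposed. The clique found in \<open>R\<close> absorbs \<open>U\<close> through such edges,
  and \<open>U\<close>, then a clique, absorbs everything below it.\<close>

lemma prob_not_percolates_le:
  fixes p :: real and n l N :: nat
  assumes rs: "r \<ge> 4" "s \<ge> 3" "s \<le> r" "r \<le> (s - 2)^2 + s"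
    and l: "0 < l" and N: "0 < N" and p: "0 < p" "p \<le> 1"
    and size: "n div 4 + 2 * l * r * N \<le> n div 2" and n: "4 * (r + s) \<le> n div 4"
  defines "q \<equiv> (1 / p) powr lambda_bip r s" and "K \<equiv> l * (r - 1) + l * (s - 1)"
  shows "measure_pmf.prob (random_graph n p) {G. \<not> percolates (complete_bipartite r s) n G}
    \<le> 8 * real (r + s) * (exp (real K * q / real N) - 1 + (q / real N) ^ K / p)
      + 2 * (real n ^ (s - 1) * exp (- p * (real (n div 4) / 2 - real s)))"
proof -
  define \<epsilon> where "\<epsilon> = exp (real K * q / real N) - 1 + (q / real N) ^ K / p"
  define m h where "m = n div 4" and "h = n div 2"
  define R U where "R = {1..m}" and "U = {Suc h..n}"
  define \<eta> where "\<eta> = real n ^ (s - 1) * exp (- p * (real m / 2 - real s))"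
  let ?pr = "measure_pmf.prob (random_graph n p)"
  let ?cl = "\<lambda>F. bootstrap_closure (complete_bipartite r s) n F"
  let ?E = "K_edges h"
  have hn: "h \<le> n" by (simp add: h_def)
  have mh: "m \<le> h" by (simp add: m_def h_def)
  have m: "4 * (r + s) \<le> m" using n by (simp add: m_def)
  have RU: "R \<subseteq> {1..n}" "U \<subseteq> {1..n}" "card R = m" "R \<inter> U = {}"
    using mh hn by (auto simp: R_def U_def)
  have cardU: "m \<le> 2 * card U"
    by (simp add: U_def h_def m_def)
  have pair: "?pr {G. {x, y} \<notin> ?cl (G \<inter> ?E)} \<le> \<epsilon>" if xy: "x \<in> R" "y \<in> R" "x \<noteq> y" for x y
  proof -
    \<comment> \<open>Intervals of length \<open>N\<close> above \<open>m\<close> serve left and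
      right nodes alternately; \<open>node\<close> recovers the node from a vertex, which yields
      disjointness.\<close>
    define part where "part = case_sum
      (\<lambda>a. if a = 0 then {x} else {m + 2 * a * N + 1..m + (2 * a + 1) * N})
      (\<lambda>b. if b = 0 then {y} else {m + (2 * b + 1) * N + 1..m + (2 * b + 2) * N})"
    define node where "node = (\<lambda>v. if v = x then Inl 0 else if v = y then Inr 0 else
      (let z = (v - m - 1) div N in if even z then Inl (z div 2) else Inr (z div 2)))"
    have node: "node v = u" if "v \<in> part u" for u v
    proof (cases u)
      case (Inl a)
      show ?thesis
      proof (cases "a = 0")
        case False
        then have v: "m + 2 * a * N + 1 \<le> v" "v \<le> m + (2 * a + 1) * N"
          using that Inl by (auto simp: part_def)
        then have "(v - m - 1) div N = 2 * a"
          by (intro div_nat_eqI) (auto simp: algebra_simps)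
        moreover have "v \<noteq> x" "v \<noteq> y" using v xy by (auto simp: R_def)
        ultimately show ?thesis using Inl by (simp add: node_def)
      qed (use that Inl in \<open>simp add: part_def node_def\<close>)
    next
      case (Inr b)
      show ?thesis
      proof (cases "b = 0")
        case False
        then have v: "m + (2 * b + 1) * N + 1 \<le> v" "v \<le> m + (2 * b + 2) * N"
          using that Inr by (auto simp: part_def)
        then have "(v - m - 1) div N = 2 * b + 1"
          by (intro div_nat_eqI) (auto simp: algebra_simps)
        moreover have "v \<noteq> x" "v \<noteq> y" using v xy by (auto simp: R_def)
        ultimately show ?thesis using Inr by (simp add: node_def)
      qed (use that Inr xy in \<open>simp add: part_def node_def\<close>)
    qed
    have top: "m + 2 * l * r * N \<le> h" using size by (simp add: m_def h_def)
    show ?thesis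
      unfolding \<epsilon>_def q_def K_def
    proof (rule chain_probability[OF rs l N p hn, of part])
      show "part u \<inter> part v = {}" if "u \<noteq> v" for u v using node that by blast
      show "part (Inl 0) = {x}" "part (Inr 0) = {y}" by (simp_all add: part_def)
      show "card (part (Inl a)) = N" if "0 < a" for a
        using that by (simp add: part_def)
      show "card (part (Inr b)) = N" if "0 < b" for b
        using that by (simp add: part_def)
      show "part (Inl a) \<subseteq> {1..h}" if "a \<le> l * (r - 1)" for a
      proof (cases "a = 0")
        case True
        then show ?thesis using xy mh by (auto simp: part_def R_def)
      next
        case False
        have "2 * a + 1 \<le> 2 * (l * (r - 1)) + 1" using that by simp
        also have "\<dots> \<le> 2 * l * r"
        proof -
          have "l * r = l * (r - 1) + l" using rs(1) by (metis Suc_diff_1 mult_Suc_right add.commute less_le_trans zero_less_numeral)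
          then show ?thesis using l by linarith
        qed
        finally have "(2 * a + 1) * N \<le> 2 * l * r * N" by (rule mult_le_mono1)
        then have "m + (2 * a + 1) * N \<le> h" using top by linarith
        then show ?thesis using False by (auto simp: part_def)
      qed
      show "part (Inr b) \<subseteq> {1..h}" if "b \<le> l * (s - 1)" for b
      proof (cases "b = 0")
        case True
        then show ?thesis using xy mh by (auto simp: part_def R_def)
      next
        case False
        have "l * (s - 1) \<le> l * (r - 1)" using rs(3) by (intro mult_le_mono2 diff_le_mono)
        then have "2 * b + 2 \<le> 2 * (l * (r - 1)) + 2" using that by linarith
        also have "\<dots> \<le> 2 * l * r"
        proof -
          have "l * r = l * (r - 1) + l" using rs(1) by (metis Suc_diff_1 mult_Suc_right add.commute less_le_trans zero_less_numeral)
          then show ?thesis using l by linarith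
        qed
        finally have "(2 * b + 2) * N \<le> 2 * l * r * N" by (rule mult_le_mono1)
        then have "m + (2 * b + 2) * N \<le> h" using top by linarith
        then show ?thesis using False by (auto simp: part_def)
      qed
    qed
  qed
  have \<epsilon>0: "0 \<le> \<epsilon>"
    unfolding \<epsilon>_def q_def using p by (intro add_nonneg_nonneg) auto
  define Pairs where "Pairs = {z \<in> R \<times> R. fst z \<noteq> snd z}"
  define nbad where "nbad = (\<lambda>F. real (card {z \<in> Pairs. {fst z, snd z} \<notin> ?cl F}))"
  define good where "good = (\<lambda>F Q. Q \<subseteq> R \<and> m \<le> 2 * card Q \<and> clique_in (?cl F) Q)"
  \<comment> \<open>The clique is chosen as a function of the exposed edges alone, so that
    conditioning on it leaves the remaining edges random.\<close>
  define X where "X = (\<lambda>F. SOME Q. good F Q)"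
  \<comment> \<open>Failure means at most \<open>s - 2\<close> neighbours, since
    \<open>s - 1\<close> suffice for joining a clique.\<close>
  define few where "few = (\<lambda>(w :: nat) T F. card {z \<in> T. {w, z} \<in> F} \<le> s - 2)"
  \<comment> \<open>The number of missing ordered pairs that \<open>dense_core\<close>
    tolerates.\<close>
  define a where "a = real m ^ 2 / (8 * real (r + s))"
  have m0: "0 < m" using m rs by simp
  have a0: "0 < a" using m0 rs by (simp add: a_def)
  have X: "good F (X F)" if "nbad F \<le> a" for F
  proof -
    have "\<exists>Q\<subseteq>R. card R \<le> 2 * card Q \<and> clique_in (?cl F) Q"
    proof (rule dense_core[OF bip_closed_closure])
      have eq: "{z \<in> R \<times> R. fst z \<noteq> snd z \<and> {fst z, snd z} \<notin> ?cl F} = {z \<in> Pairs. {fst z, snd z} \<notin> ?cl F}"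
        by (auto simp: Pairs_def)
      have nb: "real (card {z \<in> Pairs. {fst z, snd z} \<notin> ?cl F}) = nbad F"
        by (simp add: nbad_def)
      have "8 * real (r + s) > 0" using rs(1) by simp
      then have "nbad F * (8 * real (r + s)) \<le> real m ^ 2"
        using that unfolding a_def by (simp only: pos_le_divide_eq)
      then show "8 * real (r + s) * real (card {z \<in> R \<times> R. fst z \<noteq> snd z \<and> {fst z, snd z} \<notin> ?cl F}) \<le> real (card R) ^ 2"
        unfolding eq nb RU(3) by (simp only: mult.commute)
      show "1 \<le> r" "1 \<le> s" using rs(1,2) by simp_all
      show "R \<subseteq> {1..n}" "4 * (r + s) \<le> card R" using RU(1,3) m by simp_all
    qed
    then have "\<exists>Q. good F Q" unfolding good_def RU(3) .
    then show ?thesis unfolding X_def by (rule someI_ex)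
  qed
  have fewI: "?pr {G. few w T (G - ?E)} \<le> real n ^ (s - 2) * exp (- p * (real m / 2 - real s))"
    if T: "T \<subseteq> {1..n}" "w \<in> {1..n}" "w \<notin> T" "m \<le> 2 * card T" "w \<in> U \<or> T \<subseteq> U" for w T
  proof -
    have "4 * (r + s) \<le> 2 * card T" using m T(4) by (rule le_trans)
    then have k: "s - 2 \<le> card T" by auto
    have "{w, z} \<in> UNIV - ?E" if "z \<in> T" for z
    proof -
      have "w \<in> U \<or> z \<in> U" using T(5) that by blast
      then have "\<not> (w \<le> h \<and> z \<le> h)" by (auto simp: U_def)
      then show ?thesis by (auto simp: K_edges_iff)
    qed
    then have "(\<lambda>z. {w, z}) ` T \<subseteq> UNIV - ?E" by blast
    note bound = prob_few_neighbours[OF T(1-3) less_imp_le[OF p(1)] p(2) k this]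
    have "G \<inter> (UNIV - ?E) = G - ?E" for G by blast
    then have "?pr {G. few w T (G - ?E)} \<le> real n ^ (s - 2) * exp (- p * (real (card T) - real (s - 2)))"
      using bound by (simp add: few_def)
    also have "\<dots> \<le> real n ^ (s - 2) * exp (- p * (real m / 2 - real s))"
    proof (intro mult_left_mono)
      have "real m \<le> 2 * real (card T)" using of_nat_mono[OF T(4), where 'a = real] by simp
      moreover have "real (s - 2) \<le> real s" by simp
      ultimately have "real m / 2 - real s \<le> real (card T) - real (s - 2)" by linarith
      then show "exp (- p * (real (card T) - real (s - 2))) \<le> exp (- p * (real m / 2 - real s))"
        using p by simp
    qed simp
    finally show ?thesis .
  qed
  \<comment> \<open>A factor \<open>n\<close> for the vertex \<open>w\<close> and
    \<open>n^(s - 2)\<close> for the possible neighbour sets make up the exponent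
    \<open>s - 1\<close>.\<close>
  have \<eta>: "(\<Sum>w\<in>W. real n ^ (s - 2) * exp (- p * (real m / 2 - real s))) \<le> \<eta>" if "W \<subseteq> {1..n}" for W :: "nat set"
  proof -
    have "real (card W) \<le> real n" using card_mono[OF _ that] by simp
    then have "real (card W) * (real n ^ (s - 2) * exp (- p * (real m / 2 - real s)))
        \<le> real n * (real n ^ (s - 2) * exp (- p * (real m / 2 - real s)))"
      by (intro mult_right_mono) auto
    moreover have "s - 1 = Suc (s - 2)" using rs by simp
    ultimately show ?thesis by (simp add: \<eta>_def mult.assoc)
  qed
  have first: "?pr {G. a \<le> nbad (G \<inter> ?E)} \<le> 8 * real (r + s) * \<epsilon>"
  proof -
    have finP: "finite Pairs" by (simp add: Pairs_def R_def)
    have "?pr {G. a \<le> nbad (G \<inter> ?E)} \<le> real (card Pairs) * \<epsilon> / a"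
      unfolding nbad_def random_graph_eq
    proof (rule prob_many_le[OF finite_K_edges finP _ a0])
      fix z assume "z \<in> Pairs"
      then show "measure_pmf.prob (random_subset (K_edges n) p) {G. {fst z, snd z} \<notin> ?cl (G \<inter> ?E)} \<le> \<epsilon>"
        using pair[of "fst z" "snd z"] by (auto simp: Pairs_def random_graph_eq)
    qed
    also have "\<dots> \<le> real m ^ 2 * \<epsilon> / a"
    proof -
      have "card Pairs \<le> card (R \<times> R)"
        unfolding Pairs_def by (rule card_mono) (auto simp: R_def)
      then have "card Pairs \<le> m ^ 2" using RU(3) by (simp add: card_cartesian_product power2_eq_square)
      then have "real (card Pairs) \<le> real m ^ 2" by (metis of_nat_mono of_nat_power)
      then show ?thesis using \<epsilon>0 a0 by (intro divide_right_mono mult_right_mono) auto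
    qed
    also have "\<dots> = 8 * real (r + s) * \<epsilon>" using m0 rs by (simp add: a_def)
    finally show ?thesis .
  qed
  define \<Q> where "\<Q> = {Q. Q \<subseteq> R \<and> m \<le> 2 * card Q}"
  have second: "?pr {G. X (G \<inter> ?E) \<in> \<Q> \<and> (\<exists>w\<in>U. few w (X (G \<inter> ?E)) (G - ?E))} \<le> \<eta>"
    unfolding random_graph_eq
  proof (rule prob_random_subset_conditional[OF finite_K_edges K_edges_mono[OF hn]])
    show "finite \<Q>" by (simp add: \<Q>_def R_def)
    show "0 \<le> \<eta>" by (simp add: \<eta>_def)
    fix Q assume Q: "Q \<in> \<Q>"
    have "?pr {G. \<exists>w\<in>U. few w Q (G - ?E)} \<le> (\<Sum>w\<in>U. ?pr {G. few w Q (G - ?E)})"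
      by (rule prob_Ex_le) (simp add: U_def)
    also have "\<dots> \<le> (\<Sum>w\<in>U. real n ^ (s - 2) * exp (- p * (real m / 2 - real s)))"
      using Q RU by (intro sum_mono fewI) (auto simp: \<Q>_def)
    also have "\<dots> \<le> \<eta>" by (rule \<eta>[OF RU(2)])
    finally show "measure_pmf.prob (random_subset (K_edges n) p) {G. \<exists>w\<in>U. few w Q (G - ?E)} \<le> \<eta>"
      by (simp add: random_graph_eq)
  qed
  \<comment> \<open>\<open>U\<close> is a fixed set, so a plain union bound over \<open>w\<close>
    replaces the conditioning.\<close>
  have third: "?pr {G. \<exists>w\<in>{1..h}. few w U (G - ?E)} \<le> \<eta>"
  proof -
    have "?pr {G. \<exists>w\<in>{1..h}. few w U (G - ?E)} \<le> (\<Sum>w\<in>{1..h}. ?pr {G. few w U (G - ?E)})"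
      by (rule prob_Ex_le) simp
    also have "\<dots> \<le> (\<Sum>w\<in>{1..h}. real n ^ (s - 2) * exp (- p * (real m / 2 - real s)))"
      using RU hn cardU by (intro sum_mono fewI) (auto simp: U_def)
    also have "\<dots> \<le> \<eta>" by (rule \<eta>) (use hn in auto)
    finally show ?thesis .
  qed
  have perc: "percolates (complete_bipartite r s) n G"
    if G: "G \<subseteq> K_edges n" and bad: "nbad (G \<inter> ?E) \<le> a"
      and nb1: "\<forall>w\<in>U. \<not> few w (X (G \<inter> ?E)) (G - ?E)" and nb2: "\<forall>w\<in>{1..h}. \<not> few w U (G - ?E)" for G
  proof -
    define Q where "Q = X (G \<inter> ?E)"
    have good: "good (G \<inter> ?E) Q" unfolding Q_def by (rule X[OF bad])
    have Q: "Q \<subseteq> {1..n}" "r + s \<le> card Q" using good RU m by (auto simp: good_def)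
    have cQ: "clique_in (?cl G) Q"
      using good closure_mono[of "G \<inter> ?E" G r s n] by (auto simp: good_def clique_in_def)
    have deg: "s - 1 \<le> card {z \<in> T. {w, z} \<in> ?cl G}" if "\<not> few w T (G - ?E)" "finite T" for w T
    proof -
      have "card {z \<in> T. {w, z} \<in> G - ?E} \<le> card {z \<in> T. {w, z} \<in> ?cl G}"
        using that(2) subset_closure[of G "complete_bipartite r s" n] by (intro card_mono) auto
      then show ?thesis using that(1) unfolding few_def by linarith
    qed
    have finQ: "finite Q" using Q finite_subset by blast
    have rs1: "1 \<le> r" "1 \<le> s" using rs by auto
    have "clique_in (?cl G) (U \<union> Q)"
    proof (rule clique_extend[OF bip_closed_closure rs1 Q(1) cQ Q(2) RU(2)])
      show "s - 1 \<le> card {z \<in> Q. {w, z} \<in> ?cl G}" if "w \<in> U" for w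
        using nb1 that finQ by (intro deg) (simp_all add: Q_def)
    qed
    then have cU: "clique_in (?cl G) U" by (rule clique_in_subset) simp
    have "4 * (r + s) \<le> 2 * card U" using m cardU by (rule le_trans)
    then have "r + s \<le> card U" by auto
    have "clique_in (?cl G) ({1..h} \<union> U)"
    proof (rule clique_extend[OF bip_closed_closure rs1 RU(2) cU \<open>r + s \<le> card U\<close>])
      show "{1..h} \<subseteq> {1..n}" using hn by auto
      show "s - 1 \<le> card {z \<in> U. {w, z} \<in> ?cl G}" if "w \<in> {1..h}" for w
        using nb2 that by (intro deg) (simp_all add: U_def)
    qed
    moreover have "{1..h} \<union> U = {1..n}" using hn by (auto simp: U_def)
    ultimately have "K_edges n \<subseteq> ?cl G"
      by (auto simp: K_edges_def clique_in_def)
    then show ?thesis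
      unfolding percolates_def using closure_subset_K_edges[OF G] by blast
  qed
  let ?A = "{G. a \<le> nbad (G \<inter> ?E)}"
  let ?B = "{G. X (G \<inter> ?E) \<in> \<Q> \<and> (\<exists>w\<in>U. few w (X (G \<inter> ?E)) (G - ?E))}"
  let ?C = "{G. \<exists>w\<in>{1..h}. few w U (G - ?E)}"
  have "?pr {G. \<not> percolates (complete_bipartite r s) n G} \<le> ?pr {G. G \<in> ?A \<union> (?B \<union> ?C)}"
    unfolding random_graph_eq
  proof (rule prob_random_subset_mono)
    fix G assume G: "G \<subseteq> K_edges n" "\<not> percolates (complete_bipartite r s) n G"
    show "G \<in> ?A \<union> (?B \<union> ?C)"
    proof (rule ccontr)
      assume notin: "G \<notin> ?A \<union> (?B \<union> ?C)"
      then have bad: "nbad (G \<inter> ?E) \<le> a" by simp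
      then have "X (G \<inter> ?E) \<in> \<Q>" using X by (auto simp: good_def \<Q>_def)
      then have "percolates (complete_bipartite r s) n G"
        using notin by (intro perc[OF G(1) bad]) auto
      then show False using G(2) by blast
    qed
  qed
  also have "\<dots> = ?pr (?A \<union> (?B \<union> ?C))" by (simp only: Collect_mem_eq)
  also have "\<dots> \<le> ?pr ?A + (?pr ?B + ?pr ?C)"
    by (intro order_trans[OF measure_Un_le] add_mono order_refl measure_Un_le) simp_all
  also have "\<dots> \<le> 8 * real (r + s) * \<epsilon> + (\<eta> + \<eta>)"
    using first second third by linarith
  finally show ?thesis by (simp add: \<epsilon>_def \<eta>_def m_def)
qed

lemma real_nat_div_ge: "real n / real d - 1 \<le> real (n div d)"
  using real_of_int_floor_gt_diff_one[of "real n / real d"] by (simp add: floor_divide_of_nat_eq)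

text \<open>With \<open>y = ln n / ln (ln n)\<close>, take \<open>p\<close> such that
  \<open>p^lam = A y^2 / n\<close>. Then \<open>q / N \<le> 32 r / (A y)\<close> and
  \<open>K \<le> 2 y t\<close>, so the overlap term is small for large \<open>A\<close>, and the
  diagonal term decays at least like \<open>y^(-K) / p\<close>.\<close>

lemma critical_upper:
  assumes rs: "r \<ge> 4" "s \<ge> 3" "s \<le> r" "r \<le> (s - 2)^2 + s"
  defines "lam \<equiv> lambda_bip r s"
  shows "\<exists>C>0. \<forall>\<^sub>F n in sequentially. \<exists>p. 0 \<le> p \<and> p \<le> 1 \<and>
    1 / 2 \<le> measure_pmf.prob (random_graph n p) {G. percolates (complete_bipartite r s) n G} \<and>
    p \<le> C * (ln (real n) / ln (ln (real n))) powr (2 / lam) * real n powr (- 1 / lam)"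
proof -
  define t where "t = real (r + s)"
  \<comment> \<open>Chosen so that \<open>64 r t / A = 1 / (128 t)\<close>, the bound for
    \<open>K q / N\<close>; moreover \<open>A \<ge> 32 r\<close> makes
    \<open>q / N \<le> 1 / y\<close>.\<close>
  define A where "A = 8192 * real r * t ^ 2"
  define L where "L = (\<lambda>x::real. ln x / ln (ln x))"
  have lam: "2 \<le> lam" unfolding lam_def using rs lambda_bip_ge_2 by blast
  have t: "t \<ge> 7" using rs by (simp add: t_def)
  have r4: "real r \<ge> 4" using rs by simp
  have "1 * 1 \<le> 8192 * real r * t ^ 2"
    using t r4 by (intro mult_mono) auto
  then have A: "1 \<le> A" by (simp add: A_def)
  have A32: "32 * real r \<le> A"
  proof -
    have "1 * 1 \<le> t * t" using t by (intro mult_mono) auto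
    then have "32 * real r * 1 \<le> 8192 * real r * t ^ 2"
      using r4 by (intro mult_mono) (auto simp: power2_eq_square)
    then show ?thesis by (simp add: A_def)
  qed
  have ev1: "\<forall>\<^sub>F n in sequentially. 1 \<le> L (real n)"
    unfolding L_def by real_asymp
  have ev2: "\<forall>\<^sub>F n in sequentially. A * (L (real n) ^ 2 / real n) < 1"
  proof -
    have "(\<lambda>n. L (real n) ^ 2 / real n) \<longlonglongrightarrow> 0" unfolding L_def by real_asymp
    then have "(\<lambda>n. A * (L (real n) ^ 2 / real n)) \<longlonglongrightarrow> A * 0" by (intro tendsto_mult tendsto_const)
    then show ?thesis by (rule order_tendstoD) simp
  qed
  \<comment> \<open>With \<open>y = L n\<close>, \<open>y ln y\<close> is asymptotic to
    \<open>ln n\<close>, so \<open>y^(-5 y)\<close> is \<open>n^(-5 + o(1))\<close>.\<close>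
  have ev3: "\<forall>\<^sub>F n in sequentially. real n * L (real n) powr (- 5 * L (real n)) < 1 / (64 * t)"
  proof -
    have "(\<lambda>n. real n * L (real n) powr (- 5 * L (real n))) \<longlonglongrightarrow> 0" unfolding L_def by real_asymp
    then show ?thesis using t by (intro order_tendstoD(2)) auto
  qed
  have ev4: "\<forall>\<^sub>F n in sequentially. real n ^ (s - 1) * exp (- (real n powr (1 / 2)) / 16) < 1 / 8"
  proof -
    have "((\<lambda>x::real. x powr real (s - 1) * exp (- (x powr (1 / 2)) / 16)) \<longlongrightarrow> 0) at_top"
      by real_asymp
    then have "(\<lambda>n. real n powr real (s - 1) * exp (- (real n powr (1 / 2)) / 16)) \<longlonglongrightarrow> 0"
      by (rule filterlim_compose[OF _ filterlim_real_sequentially])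
    then have "\<forall>\<^sub>F n in sequentially. real n powr real (s - 1) * exp (- (real n powr (1 / 2)) / 16) < 1 / 8"
      by (rule order_tendstoD) simp
    then show ?thesis
      using eventually_gt_at_top[of 0] by eventually_elim (simp add: powr_realpow)
  qed
  have "\<forall>\<^sub>F n in sequentially. \<exists>p. 0 \<le> p \<and> p \<le> 1 \<and>
    1 / 2 \<le> measure_pmf.prob (random_graph n p) {G. percolates (complete_bipartite r s) n G} \<and>
    p \<le> A powr (1 / lam) * (ln (real n) / ln (ln (real n))) powr (2 / lam) * real n powr (- 1 / lam)"
    using ev1 ev2 ev3 ev4 eventually_ge_at_top[of "32 * (r + s)"]
  proof eventually_elim
    case (elim n)
    define x where "x = real n"
    define y where "y = L x"
    define l where "l = nat \<lceil>y\<rceil>"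
    \<comment> \<open>The divisor ensures \<open>2 * l * r * N \<le> n div 4\<close>, the room
      available for the parts.\<close>
    define N where "N = n div (8 * l * r)"
    define p where "p = (A * y ^ 2 / x) powr (1 / lam)"
    define q where "q = (1 / p) powr lam"
    define K where "K = l * (r - 1) + l * (s - 1)"
    have y: "1 \<le> y" using elim(1) by (simp add: y_def x_def)
    have x: "0 < x" "32 * t \<le> x"
      using elim(5) rs of_nat_mono[OF elim(5), where 'a = real] by (auto simp: x_def t_def)
    have Ay: "A * y ^ 2 < x" using elim(2) x by (simp add: y_def x_def field_simps)
    have "1 * 1 \<le> A * y ^ 2" using A y by (intro mult_mono) auto
    then have Ay1: "1 \<le> A * y ^ 2" by simp
    have l: "y \<le> real l" "real l \<le> 2 * y" "0 < l" unfolding l_def using y by linarith+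
    have p0: "0 < p" unfolding p_def using A y x by simp
    have p1: "p \<le> 1" unfolding p_def using Ay Ay1 x lam by (intro powr_le1) auto
    \<comment> \<open>A crude bound from \<open>lam \<ge> 2\<close> and
      \<open>A y^2 \<ge> 1\<close>. It controls \<open>1 / p\<close> on the diagonal and makes the
      probability of too few neighbours exponentially small in \<open>sqrt n\<close>.\<close>
    have p_ge: "1 / x powr (1 / 2) \<le> p"
    proof -
      have "(1 / x) powr (1 / 2) \<le> (1 / x) powr (1 / lam)"
        using x t lam by (intro powr_mono') (simp_all add: field_simps)
      also have "\<dots> \<le> p" unfolding p_def using x Ay1 lam by (intro powr_mono2 divide_right_mono) auto
      finally show ?thesis using x by (simp add: powr_divide)
    qed
    have q: "q = x / (A * y ^ 2)"
    proof -
      have "q = (1 / (A * y ^ 2 / x) powr (1 / lam)) powr lam" by (simp add: q_def p_def)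
      also have "\<dots> = 1 / ((A * y ^ 2 / x) powr (1 / lam)) powr lam" by (simp add: powr_divide)
      also have "((A * y ^ 2 / x) powr (1 / lam)) powr lam = A * y ^ 2 / x"
        using lam Ay1 x by (simp add: powr_powr)
      finally show ?thesis by simp
    qed
    have lr: "16 * real l * real r \<le> x"
    proof -
      have "16 * real l * real r \<le> 32 * real r * y" using l(2) r4 by (simp add: algebra_simps)
      also have "\<dots> \<le> A * y ^ 2"
      proof -
        have "32 * real r * y \<le> A * y" using A32 y by (intro mult_right_mono) auto
        also have "\<dots> \<le> A * (y * y)" using A y by (intro mult_left_mono) auto
        finally show ?thesis by (simp add: power2_eq_square)
      qed
      finally show ?thesis using Ay by simp
    qed
    have N: "x / (16 * real l * real r) \<le> real N"
    proof -
      have d: "8 * real l * real r > 0" using l r4 by simp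
      have "x / (8 * real l * real r) - 1 \<le> real N"
        using real_nat_div_ge[of n "8 * l * r"] by (simp add: N_def x_def)
      moreover have "x / (16 * real l * real r) \<ge> 1" using lr d by simp
      moreover have "x / (8 * real l * real r) = 2 * (x / (16 * real l * real r))" by simp
      ultimately show ?thesis by linarith
    qed
    have N0: "0 < N" using N lr l r4 x
      by (metis divide_pos_pos mult_pos_pos not_le of_nat_0_less_iff of_nat_0_le_iff zero_less_numeral less_le_trans)
    have qN: "q / real N \<le> 32 * real r / (A * y)"
    proof -
      have "q / real N \<le> q / (x / (16 * real l * real r))"
      proof (rule divide_left_mono[OF N])
        show "0 \<le> q" using x Ay1 q by simp
        show "0 < real N * (x / (16 * real l * real r))"
          using N0 x l r4 by (intro mult_pos_pos divide_pos_pos) auto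
      qed
      also have "\<dots> = 16 * real l * real r / (A * y ^ 2)" using x q by simp
      also have "\<dots> \<le> 16 * (2 * y) * real r / (A * y ^ 2)"
        using l Ay1 by (intro divide_right_mono mult_right_mono mult_left_mono) auto
      also have "\<dots> = 32 * real r / (A * y)" using y by (simp add: power2_eq_square)
      finally show ?thesis .
    qed
    have q0: "0 \<le> q / real N" unfolding q using x Ay1 by simp
    have Kq: "real K * q / real N \<le> 1 / (128 * t)"
    proof -
      have "K \<le> l * r + l * s" unfolding K_def by (intro add_mono mult_le_mono2) auto
      then have "real K \<le> real (l * r + l * s)" by (rule of_nat_mono)
      also have "\<dots> = real l * t" by (simp add: t_def algebra_simps)
      also have "\<dots> \<le> 2 * y * t" using l t by (intro mult_right_mono) auto
      finally have "real K * (q / real N) \<le> (2 * y * t) * (32 * real r / (A * y))"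
        using qN q0 y t by (intro mult_mono) auto
      also have "\<dots> = 1 / (128 * t)" using y t r4 by (simp add: A_def power2_eq_square field_simps)
      finally show ?thesis by simp
    qed
    have exp_le: "exp z \<le> 1 + 2 * z" if "0 \<le> z" "z \<le> 1 / 2" for z :: real
      using exp_bound_lemma[of z] that by simp
    have first: "exp (real K * q / real N) - 1 \<le> 1 / (64 * t)"
    proof -
      have "0 \<le> real K * q / real N" using mult_nonneg_nonneg[OF of_nat_0_le_iff[of K] q0] by simp
      moreover have "1 / (128 * t) \<le> 1 / 2" using t by simp
      ultimately have "exp (real K * q / real N) \<le> 1 + 2 * (real K * q / real N)"
        using Kq by (intro exp_le) linarith+
      also have "2 * (real K * q / real N) \<le> 1 / (64 * t)" using Kq by simp
      finally show ?thesis by simp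
    qed
    have second: "(q / real N) ^ K / p \<le> 1 / (64 * t)"
    proof -
      have "32 * real r / (A * y) \<le> 1 / y"
        using y A32 A by (simp add: field_simps)
      then have "(q / real N) ^ K \<le> (1 / y) ^ K" using qN q0 by (intro power_mono) auto
      also have "\<dots> = y powr (- real K)" using y by (simp add: powr_minus powr_realpow power_one_over inverse_eq_divide)
      also have "\<dots> \<le> y powr (- 5 * y)"
      proof -
        \<comment> \<open>The 5 in the exponent comes from \<open>r - 1 \<ge> 3\<close> and
          \<open>s - 1 \<ge> 2\<close>.\<close>
        have "l * 3 + l * 2 \<le> K" unfolding K_def using rs by (intro add_mono mult_le_mono2) auto
        then have "5 * real l \<le> real K" using of_nat_mono[of "l * 3 + l * 2" K, where 'a = real] by simp
        then have "- real K \<le> - 5 * y" using l(1) by linarith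
        then show ?thesis using y by (intro powr_mono) auto
      qed
      finally have "(q / real N) ^ K / p \<le> y powr (- 5 * y) / (1 / x)"
      proof (rule frac_le[rotated])
        have "1 / x \<le> 1 / x powr (1 / 2)"
          using x t powr_mono[of "1 / 2" 1 x] by (intro divide_left_mono) auto
        then show "1 / x \<le> p" using p_ge by linarith
      qed (use x in auto)
      also have "\<dots> = x * y powr (- 5 * y)" by simp
      also have "\<dots> \<le> 1 / (64 * t)" using elim(3) by (simp add: x_def y_def)
      finally show ?thesis .
    qed
    have third: "x ^ (s - 1) * exp (- p * (real (n div 4) / 2 - real s)) \<le> 1 / 8"
    proof -
      have "x / 16 \<le> real (n div 4) / 2 - real s"
      proof -
        have "x / 4 - 1 \<le> real (n div 4)" using real_nat_div_ge[of n 4] by (simp add: x_def)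
        moreover have "real s \<le> t" by (simp add: t_def)
        ultimately show ?thesis using x t by linarith
      qed
      then have "1 / x powr (1 / 2) * (x / 16) \<le> p * (real (n div 4) / 2 - real s)"
        using p_ge p0 x by (intro mult_mono) auto
      moreover have "1 / x powr (1 / 2) * (x / 16) = x powr (1 / 2) / 16"
        using x by (simp add: powr_half_sqrt real_div_sqrt)
      ultimately have "exp (- p * (real (n div 4) / 2 - real s)) \<le> exp (- (x powr (1 / 2)) / 16)" by simp
      then have "x ^ (s - 1) * exp (- p * (real (n div 4) / 2 - real s)) \<le> x ^ (s - 1) * exp (- (x powr (1 / 2)) / 16)"
        using x by (intro mult_left_mono) auto
      then show ?thesis using elim(4) by (simp add: x_def)
    qed
    have size: "n div 4 + 2 * l * r * N \<le> n div 2"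
    proof -
      have "8 * l * r * N \<le> n" unfolding N_def by (rule times_div_less_eq_dividend)
      then have "2 * l * r * N \<le> n div 4" by linarith
      then show ?thesis by linarith
    qed
    have big: "4 * (r + s) \<le> n div 4" using elim(5) by linarith
    have "measure_pmf.prob (random_graph n p) {G. \<not> percolates (complete_bipartite r s) n G}
      \<le> 8 * t * (exp (real K * q / real N) - 1 + (q / real N) ^ K / p)
        + 2 * (x ^ (s - 1) * exp (- p * (real (n div 4) / 2 - real s)))"
      unfolding t_def K_def q_def lam_def x_def
      by (rule prob_not_percolates_le[OF rs l(3) N0 p0 p1 size big])
    \<comment> \<open>Error budget: \<open>1 / 4\<close> for too many uninfected pairs and
      \<open>1 / 4\<close> for vertices with too few neighbours.\<close>
    also have "\<dots> \<le> 8 * t * (1 / (64 * t) + 1 / (64 * t)) + 2 * (1 / 8)"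
      using first second third t by (intro add_mono mult_left_mono) auto
    also have "\<dots> = 1 / 2" using t by (simp add: field_simps)
    finally have "measure_pmf.prob (random_graph n p) {G. \<not> percolates (complete_bipartite r s) n G} \<le> 1 / 2" .
    moreover have "measure_pmf.prob (random_graph n p) {G. \<not> percolates (complete_bipartite r s) n G} =
        1 - measure_pmf.prob (random_graph n p) {G. percolates (complete_bipartite r s) n G}"
      using measure_pmf.prob_compl[of "{G. percolates (complete_bipartite r s) n G}" "random_graph n p"]
      by (simp add: Compl_eq_Diff_UNIV[symmetric] Collect_neg_eq)
    ultimately have "1 / 2 \<le> measure_pmf.prob (random_graph n p) {G. percolates (complete_bipartite r s) n G}"
      by linarith
    moreover have "p = A powr (1 / lam) * y powr (2 / lam) * x powr (- 1 / lam)"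
    proof -
      have "p = A powr (1 / lam) * (y ^ 2) powr (1 / lam) / x powr (1 / lam)"
        unfolding p_def using A y x by (simp add: powr_mult powr_divide)
      also have "(y ^ 2) powr (1 / lam) = y powr (2 / lam)"
        using y by (simp add: powr_powr flip: powr_numeral)
      finally show ?thesis by (simp add: powr_minus divide_inverse)
    qed
    ultimately show ?case
      using p0 p1 by (intro exI[of _ p]) (simp add: y_def L_def x_def)
  qed
  then show ?thesis using A by (intro exI[of _ "A powr (1 / lam)"]) auto
qed

theorem theorem1p1:
  fixes r s :: nat
  assumes "r \<ge> 4" and "s \<ge> 3" and "s \<le> r" and "r \<le> (s - 2)^2 + s"
  shows "\<exists>c C :: real. c > 0 \<and> C > 0 \<and>
    (\<forall>\<^sub>F n :: nat in sequentially.
       c * inverse (ln (real n)) * real n powr (- 1 / lambda_bip r s)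
         \<le> critical_threshold n (complete_bipartite r s) \<and>
       critical_threshold n (complete_bipartite r s)
         \<le> C * (ln (real n) / ln (ln (real n))) powr (2 / lambda_bip r s)
             * real n powr (- 1 / lambda_bip r s))"
proof -
  obtain c where c: "c > 0" "\<forall>\<^sub>F n in sequentially. \<forall>p. 0 \<le> p \<longrightarrow> p \<le> 1 \<longrightarrow>
    1 / 2 \<le> measure_pmf.prob (random_graph n p) {G. percolates (complete_bipartite r s) n G} \<longrightarrow>
    c * inverse (ln (real n)) * real n powr (- 1 / lambda_bip r s) \<le> p"
    using critical_lower[OF assms] by blast
  obtain C where C: "C > 0" "\<forall>\<^sub>F n in sequentially. \<exists>p. 0 \<le> p \<and> p \<le> 1 \<and>
    1 / 2 \<le> measure_pmf.prob (random_graph n p) {G. percolates (complete_bipartite r s) n G} \<and>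
    p \<le> C * (ln (real n) / ln (ln (real n))) powr (2 / lambda_bip r s) * real n powr (- 1 / lambda_bip r s)"
    using critical_upper[OF assms] by blast
  have "\<forall>\<^sub>F n in sequentially.
       c * inverse (ln (real n)) * real n powr (- 1 / lambda_bip r s)
         \<le> critical_threshold n (complete_bipartite r s) \<and>
       critical_threshold n (complete_bipartite r s)
         \<le> C * (ln (real n) / ln (ln (real n))) powr (2 / lambda_bip r s)
             * real n powr (- 1 / lambda_bip r s)"
    using c(2) C(2)
  proof eventually_elim
    case (elim n)
    define P where "P = {p. 0 \<le> p \<and> p \<le> 1 \<and>
      1 / 2 \<le> measure_pmf.prob (random_graph n p) {G. percolates (complete_bipartite r s) n G}}"
    have crit: "critical_threshold n (complete_bipartite r s) = Inf P"
      by (simp add: critical_threshold_def P_def)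
    obtain p where p: "p \<in> P"
      "p \<le> C * (ln (real n) / ln (ln (real n))) powr (2 / lambda_bip r s) * real n powr (- 1 / lambda_bip r s)"
      using elim(2) unfolding P_def by blast
    \<comment> \<open>The witness \<open>p\<close> also shows that \<open>P\<close> is nonempty, as
      is required for bounding its infimum from below.\<close>
    have "c * inverse (ln (real n)) * real n powr (- 1 / lambda_bip r s) \<le> Inf P"
      using p(1) elim(1) by (intro cInf_greatest) (auto simp: P_def)
    moreover have "Inf P \<le> p"
      using p(1) by (intro cInf_lower bdd_belowI[of _ 0]) (auto simp: P_def)
    ultimately show ?case unfolding crit using p(2) by linarith
  qed
  then show ?thesis using c(1) C(1) by blast
qed

end
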